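(* Let $\mathbb{A}$ be a 2-category and $X$ an object of $\mathbb{A}$ such that, for every object $A$ of $\mathbb{A}$, the hom-category $\mathbb{A}(A,X)$ has a strict initial object, and, for every morphism $f \colon A \to B$ of $\mathbb{A}$, the functor $- \cdot f \colon \mathbb{A}(B,X) \to \mathbb{A}(A,X)$ preserves initial objects. Then the forgetful functor (fibration) $\mathbb{A} \Downarrow X \to \mathbb{A}$ from the lax comma category to the underlying category of $\mathbb{A}$ preserves effective descent morphisms.
   Context: The lax comma category $\mathbb{A} \Downarrow X$ is the (1-)category whose objects are morphisms $f \colon A \to X$ of $\mathbb{A}$ with codomain $X$, and whose morphisms from $f \colon A \to X$ to $g \colon B \to X$ are pairs $(p,\pi)$ with $p \colon A \to B$ a morphism of $\mathbb{A}$ and $\pi \colon f \Rightarrow g \cdot p$ a 2-cell. The composite of $(p,\pi) \colon f \to g$ and $(q,\chi) \colon g \to h$ is $(q\cdot p, (\chi \cdot p)\circ \pi)$. Equivalently, it is the total category of the Grothendieck construction of $\mathbb{A}(-,X)$ restricted to the underlying category of $\mathbb{A}^{\mathrm{op}}$. The forgetful functor sends $f \colon A \to X$ to $A$ and $(p,\pi)$ to $p$; effective descent in $\mathbb{A}$ refers to the underlying category of $\mathbb{A}$. An initial object $\mathsf{0}$ of a category is strict if every object $x$ admitting a morphism $x \to \mathsf{0}$ is isomorphic to $\mathsf{0}$. A morphism $p \colon a \to b$ in a category $\mathcal{X}$ is an effective descent morphism if all pullbacks along $p$ exist in $\mathcal{X}$ (equivalently, the functor $p_! \colon \mathcal{X}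 \downarrow a \to \mathcal{X} \downarrow b$, $f \mapsto p \circ f$, between slice categories has a right adjoint $p^*$) and $p^*$ is monadic (its comparison functor into the Eilenberg-Moore category of the monad induced by $p_! \dashv p^*$ is an equivalence). No existence of other pullbacks in $\mathcal{X}$ is assumed. A functor $F$ preserves effective descent morphisms if $F(p)$ is an effective descent morphism whenever $p$ is. *)

theory Defs
  imports Main
begin

section \<open>Categories, functors and natural transformations\<close>

text \<open>
  The operations of a category are total functions on the carrier types; only their values on the
  sets of objects and arrows are meaningful. Composition is written in the usual order:
  \<open>Comp C g f\<close> is ``\<open>g\<close> after \<open>f\<close>''.
\<close>

record ('o, 'm) cat =
  Obj :: "'o set"
  Arr :: "'m set"
  Dom :: "'m \<Rightarrow> 'o"
  Cod :: "'m \<Rightarrow> 'o"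
  Id :: "'o \<Rightarrow> 'm"
  Comp :: "'m \<Rightarrow> 'm \<Rightarrow> 'm"

definition hom :: "('o, 'm) cat \<Rightarrow> 'o \<Rightarrow> 'o \<Rightarrow> 'm set" where
  "hom C x y = {f \<in> Arr C. Dom C f = x \<and> Cod C f = y}"

locale category =
  fixes C :: "('o, 'm) cat"
  assumes Dom_Obj: "f \<in> Arr C \<Longrightarrow> Dom C f \<in> Obj C"
    and Cod_Obj: "f \<in> Arr C \<Longrightarrow> Cod C f \<in> Obj C"
    and Id_hom: "x \<in> Obj C \<Longrightarrow> Id C x \<in> hom C x x"
    and Comp_hom: "\<lbrakk>f \<in> hom C x y; g \<in> hom C y z\<rbrakk> \<Longrightarrow> Comp C g f \<in> hom C x z"
    and Comp_Id_left: "f \<in> hom C x y \<Longrightarrow> Comp C (Id C y) f = f"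
    and Comp_Id_right: "f \<in> hom C x y \<Longrightarrow> Comp C f (Id C x) = f"
    and Comp_assoc: "\<lbrakk>f \<in> hom C w x; g \<in> hom C x y; h \<in> hom C y z\<rbrakk>
      \<Longrightarrow> Comp C h (Comp C g f) = Comp C (Comp C h g) f"

definition iso_arr :: "('o, 'm) cat \<Rightarrow> 'm \<Rightarrow> bool" where
  "iso_arr C f \<longleftrightarrow> f \<in> Arr C \<and>
     (\<exists>g \<in> hom C (Cod C f) (Dom C f).
        Comp C g f = Id C (Dom C f) \<and> Comp C f g = Id C (Cod C f))"

definition isomorphic :: "('o, 'm) cat \<Rightarrow> 'o \<Rightarrow> 'o \<Rightarrow> bool" where
  "isomorphic C x y \<longleftrightarrow> (\<exists>f \<in> hom C x y. iso_arr C f)"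

record ('o1, 'm1, 'o2, 'm2) ftor =
  FO :: "'o1 \<Rightarrow> 'o2"
  FA :: "'m1 \<Rightarrow> 'm2"

locale cat_functor = C: category C + D: category D
  for C :: "('o1, 'm1) cat" and D :: "('o2, 'm2) cat" +
  fixes F :: "('o1, 'm1, 'o2, 'm2) ftor"
  assumes FO_Obj: "x \<in> Obj C \<Longrightarrow> FO F x \<in> Obj D"
    and FA_hom: "f \<in> hom C x y \<Longrightarrow> FA F f \<in> hom D (FO F x) (FO F y)"
    and FA_Id: "x \<in> Obj C \<Longrightarrow> FA F (Id C x) = Id D (FO F x)"
    and FA_Comp: "\<lbrakk>f \<in> hom C x y; g \<in> hom C y z\<rbrakk>
      \<Longrightarrow> FA F (Comp C g f) = Comp D (FA F g) (FA F f)"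

definition id_ftor :: "('o, 'm, 'o, 'm) ftor" where
  "id_ftor = \<lparr>FO = (\<lambda>x. x), FA = (\<lambda>f. f)\<rparr>"

definition comp_ftor ::
  "('o2, 'm2, 'o3, 'm3) ftor \<Rightarrow> ('o1, 'm1, 'o2, 'm2) ftor \<Rightarrow> ('o1, 'm1, 'o3, 'm3) ftor" where
  "comp_ftor G F = \<lparr>FO = (\<lambda>x. FO G (FO F x)), FA = (\<lambda>f. FA G (FA F f))\<rparr>"

locale nat_trans = F: cat_functor C D F + G: cat_functor C D G
  for C :: "('o1, 'm1) cat" and D :: "('o2, 'm2) cat"
    and F G :: "('o1, 'm1, 'o2, 'm2) ftor" +
  fixes \<tau> :: "'o1 \<Rightarrow> 'm2"
  assumes component: "x \<in> Obj C \<Longrightarrow> \<tau> x \<in> hom D (FO F x) (FO G x)"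
    and naturality: "f \<in> hom C x y \<Longrightarrow> Comp D (\<tau> y) (FA F f) = Comp D (FA G f) (\<tau> x)"

locale nat_iso = nat_trans +
  assumes component_iso: "x \<in> Obj C \<Longrightarrow> iso_arr D (\<tau> x)"

definition equivalence_functor ::
  "('o1, 'm1) cat \<Rightarrow> ('o2, 'm2) cat \<Rightarrow> ('o1, 'm1, 'o2, 'm2) ftor \<Rightarrow> bool" where
  "equivalence_functor C D F \<longleftrightarrow> cat_functor C D F \<and>
     (\<exists>G \<eta> \<epsilon>. cat_functor D C G \<and>
        nat_iso C C id_ftor (comp_ftor G F) \<eta> \<and>
        nat_iso D D (comp_ftor F G) id_ftor \<epsilon>)"


section \<open>Initial objects\<close>

definition initial :: "('o, 'm) cat \<Rightarrow> 'o \<Rightarrow> bool" where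
  "initial C z \<longleftrightarrow> z \<in> Obj C \<and> (\<forall>x \<in> Obj C. \<exists>!f. f \<in> hom C z x)"

definition strict_initial :: "('o, 'm) cat \<Rightarrow> 'o \<Rightarrow> bool" where
  "strict_initial C z \<longleftrightarrow> initial C z \<and>
     (\<forall>x \<in> Obj C. hom C x z \<noteq> {} \<longrightarrow> isomorphic C x z)"

definition preserves_initial_objects ::
  "('o1, 'm1) cat \<Rightarrow> ('o2, 'm2) cat \<Rightarrow> ('o1, 'm1, 'o2, 'm2) ftor \<Rightarrow> bool" where
  "preserves_initial_objects C D F \<longleftrightarrow> (\<forall>z. initial C z \<longrightarrow> initial D (FO F z))"


section \<open>Adjunctions and monadicity\<close>

locale adjunction =
    F: cat_functor C D F + G: cat_functor D C G +
    unit: nat_trans C C id_ftor "comp_ftor G F" \<eta> +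
    counit: nat_trans D D "comp_ftor F G" id_ftor \<epsilon>
  for C :: "('o1, 'm1) cat" and D :: "('o2, 'm2) cat"
    and F :: "('o1, 'm1, 'o2, 'm2) ftor" and G :: "('o2, 'm2, 'o1, 'm1) ftor"
    and \<eta> :: "'o1 \<Rightarrow> 'm1" and \<epsilon> :: "'o2 \<Rightarrow> 'm2" +
  assumes triangle_left: "x \<in> Obj C \<Longrightarrow> Comp D (\<epsilon> (FO F x)) (FA F (\<eta> x)) = Id D (FO F x)"
    and triangle_right: "y \<in> Obj D \<Longrightarrow> Comp C (FA G (\<epsilon> y)) (\<eta> (FO G y)) = Id C (FO G y)"

text \<open>
  The Eilenberg--Moore category of a monad with endofunctor \<open>T\<close>, unit \<open>\<eta>\<close> and
  multiplication \<open>\<mu>\<close>. A morphism of algebras is stored together with its source and target,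
  because the underlying arrow does not determine the two structure maps.
\<close>

definition em_algebras ::
  "('o, 'm) cat \<Rightarrow> ('o, 'm, 'o, 'm) ftor \<Rightarrow> ('o \<Rightarrow> 'm) \<Rightarrow> ('o \<Rightarrow> 'm) \<Rightarrow> ('o \<times> 'm) set" where
  "em_algebras C T \<eta> \<mu> = {(x, \<alpha>). x \<in> Obj C \<and> \<alpha> \<in> hom C (FO T x) x \<and>
     Comp C \<alpha> (\<eta> x) = Id C x \<and> Comp C \<alpha> (\<mu> x) = Comp C \<alpha> (FA T \<alpha>)}"

definition em_category ::
  "('o, 'm) cat \<Rightarrow> ('o, 'm, 'o, 'm) ftor \<Rightarrow> ('o \<Rightarrow> 'm) \<Rightarrow> ('o \<Rightarrow> 'm) \<Rightarrow>
   ('o \<times> 'm, ('o \<times> 'm) \<times> 'm \<times> ('o \<times> 'm)) cat" where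
  "em_category C T \<eta> \<mu> = \<lparr>
     Obj = em_algebras C T \<eta> \<mu>,
     Arr = {((x, \<alpha>), h, (y, \<beta>)) | x \<alpha> h y \<beta>.
              (x, \<alpha>) \<in> em_algebras C T \<eta> \<mu> \<and> (y, \<beta>) \<in> em_algebras C T \<eta> \<mu> \<and>
              h \<in> hom C x y \<and> Comp C h \<alpha> = Comp C \<beta> (FA T h)},
     Dom = (\<lambda>(a, h, b). a),
     Cod = (\<lambda>(a, h, b). b),
     Id = (\<lambda>a. (a, Id C (fst a), a)),
     Comp = (\<lambda>(b, k, c) (a, h, b'). (a, Comp C k h, c))\<rparr>"

text \<open>
  For an adjunction \<open>F \<stileturn> G\<close> with unit \<open>\<eta>\<close> and counit \<open>\<epsilon>\<close>, with
  \<open>G\<close> having codomain \<open>C\<close>, the induced monad on \<open>C\<close> is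
  \<open>(GF, \<eta>, G\<epsilon>F)\<close>.
\<close>

definition adj_em_category ::
  "('o1, 'm1) cat \<Rightarrow> ('o1, 'm1, 'o2, 'm2) ftor \<Rightarrow> ('o2, 'm2, 'o1, 'm1) ftor \<Rightarrow>
   ('o1 \<Rightarrow> 'm1) \<Rightarrow> ('o2 \<Rightarrow> 'm2) \<Rightarrow>
   ('o1 \<times> 'm1, ('o1 \<times> 'm1) \<times> 'm1 \<times> ('o1 \<times> 'm1)) cat" where
  "adj_em_category C F G \<eta> \<epsilon> = em_category C (comp_ftor G F) \<eta> (\<lambda>x. FA G (\<epsilon> (FO F x)))"

definition em_comparison ::
  "('o2, 'm2) cat \<Rightarrow> ('o2, 'm2, 'o1, 'm1) ftor \<Rightarrow> ('o2 \<Rightarrow> 'm2) \<Rightarrow>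
   ('o2, 'm2, 'o1 \<times> 'm1, ('o1 \<times> 'm1) \<times> 'm1 \<times> ('o1 \<times> 'm1)) ftor" where
  "em_comparison D G \<epsilon> = (let K = (\<lambda>y. (FO G y, FA G (\<epsilon> y))) in
     \<lparr>FO = K, FA = (\<lambda>g. (K (Dom D g), FA G g, K (Cod D g)))\<rparr>)"

definition monadic_adjunction ::
  "('o1, 'm1) cat \<Rightarrow> ('o2, 'm2) cat \<Rightarrow> ('o1, 'm1, 'o2, 'm2) ftor \<Rightarrow>
   ('o2, 'm2, 'o1, 'm1) ftor \<Rightarrow> ('o1 \<Rightarrow> 'm1) \<Rightarrow> ('o2 \<Rightarrow> 'm2) \<Rightarrow> bool" where
  "monadic_adjunction C D F G \<eta> \<epsilon> \<longleftrightarrow> adjunction C D F G \<eta> \<epsilon> \<and>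
     equivalence_functor D (adj_em_category C F G \<eta> \<epsilon>) (em_comparison D G \<epsilon>)"


section \<open>Effective descent morphisms\<close>

text \<open>
  A morphism of the slice \<open>C \<down> b\<close> from \<open>f\<close> to \<open>g\<close> is stored as the
  triple \<open>(f, h, g)\<close> with \<open>g \<circ> h = f\<close>.
\<close>

definition slice :: "('o, 'm) cat \<Rightarrow> 'o \<Rightarrow> ('m, 'm \<times> 'm \<times> 'm) cat" where
  "slice C b = \<lparr>
     Obj = {f \<in> Arr C. Cod C f = b},
     Arr = {(f, h, g) | f h g. f \<in> Arr C \<and> Cod C f = b \<and> g \<in> Arr C \<and> Cod C g = b \<and>
              h \<in> hom C (Dom C f) (Dom C g) \<and> Comp C g h = f},
     Dom = (\<lambda>(f, h, g). f),
     Cod = (\<lambda>(f, h, g). g),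
     Id = (\<lambda>f. (f, Id C (Dom C f), f)),
     Comp = (\<lambda>(g, k, l) (f, h, g'). (f, Comp C k h, l))\<rparr>"

definition slice_push ::
  "('o, 'm) cat \<Rightarrow> 'm \<Rightarrow> ('m, 'm \<times> 'm \<times> 'm, 'm, 'm \<times> 'm \<times> 'm) ftor" where
  "slice_push C p = \<lparr>FO = (\<lambda>f. Comp C p f),
     FA = (\<lambda>(f, h, g). (Comp C p f, h, Comp C p g))\<rparr>"

definition is_pullback :: "('o, 'm) cat \<Rightarrow> 'm \<Rightarrow> 'm \<Rightarrow> 'm \<Rightarrow> 'm \<Rightarrow> bool" where
  "is_pullback C p g u v \<longleftrightarrow>
     p \<in> Arr C \<and> g \<in> Arr C \<and> Cod C p = Cod C g \<and>
     u \<in> hom C (Dom C u) (Dom C p) \<and> v \<in> hom C (Dom C u) (Dom C g) \<and>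
     Comp C p u = Comp C g v \<and>
     (\<forall>w u' v'. u' \<in> hom C w (Dom C p) \<longrightarrow> v' \<in> hom C w (Dom C g) \<longrightarrow>
        Comp C p u' = Comp C g v' \<longrightarrow>
        (\<exists>!h. h \<in> hom C w (Dom C u) \<and> Comp C u h = u' \<and> Comp C v h = v'))"

text \<open>
  The pullback functor \<open>p\<^sup>*\<close> is taken to be any right adjoint of \<open>p\<^sub>!\<close>. It is
  unique up to isomorphism, so monadicity does not depend on the choice.
\<close>

definition effective_descent :: "('o, 'm) cat \<Rightarrow> 'm \<Rightarrow> bool" where
  "effective_descent C p \<longleftrightarrow> p \<in> Arr C \<and>
     (\<forall>g \<in> Arr C. Cod C g = Cod C p \<longrightarrow> (\<exists>u v. is_pullback C p g u v)) \<and>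
     (\<exists>G \<eta> \<epsilon>. monadic_adjunction (slice C (Dom C p)) (slice C (Cod C p)) (slice_push C p) G \<eta> \<epsilon>)"

definition preserves_effective_descent ::
  "('o1, 'm1) cat \<Rightarrow> ('o2, 'm2) cat \<Rightarrow> ('o1, 'm1, 'o2, 'm2) ftor \<Rightarrow> bool" where
  "preserves_effective_descent C D F \<longleftrightarrow>
     (\<forall>p. effective_descent C p \<longrightarrow> effective_descent D (FA F p))"


section \<open>Strict 2-categories\<close>

record ('o, 'm, 'c) two_cat = "('o, 'm) cat" +
  Cell :: "'c set"
  Src :: "'c \<Rightarrow> 'm"
  Tgt :: "'c \<Rightarrow> 'm"
  VId :: "'m \<Rightarrow> 'c"
  VComp :: "'c \<Rightarrow> 'c \<Rightarrow> 'c"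
  HComp :: "'c \<Rightarrow> 'c \<Rightarrow> 'c"

definition underlying :: "('o, 'm, 'c) two_cat \<Rightarrow> ('o, 'm) cat" where
  "underlying A = \<lparr>Obj = Obj A, Arr = Arr A, Dom = Dom A, Cod = Cod A, Id = Id A, Comp = Comp A\<rparr>"

definition hom_category :: "('o, 'm, 'c) two_cat \<Rightarrow> 'o \<Rightarrow> 'o \<Rightarrow> ('m, 'c) cat" where
  "hom_category A x y = \<lparr>
     Obj = hom (underlying A) x y,
     Arr = {\<alpha> \<in> Cell A. Src A \<alpha> \<in> hom (underlying A) x y \<and> Tgt A \<alpha> \<in> hom (underlying A) x y},
     Dom = Src A, Cod = Tgt A, Id = VId A, Comp = VComp A\<rparr>"

locale two_category =
  fixes A :: "('o, 'm, 'c) two_cat"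
  assumes category_underlying: "category (underlying A)"
    and category_hom: "\<lbrakk>x \<in> Obj A; y \<in> Obj A\<rbrakk> \<Longrightarrow> category (hom_category A x y)"
    and cell_parallel: "\<alpha> \<in> Cell A \<Longrightarrow> Src A \<alpha> \<in> Arr A \<and> Tgt A \<alpha> \<in> Arr A \<and>
      Dom A (Src A \<alpha>) = Dom A (Tgt A \<alpha>) \<and> Cod A (Src A \<alpha>) = Cod A (Tgt A \<alpha>)"
    and HComp_hom: "\<lbrakk>\<alpha> \<in> hom (hom_category A x y) f f'; \<beta> \<in> hom (hom_category A y z) g g'\<rbrakk>
      \<Longrightarrow> HComp A \<beta> \<alpha> \<in> hom (hom_category A x z) (Comp A g f) (Comp A g' f')"
    and HComp_VId: "\<lbrakk>f \<in> hom (underlying A) x y; g \<in> hom (underlying A) y z\<rbrakk>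
      \<Longrightarrow> HComp A (VId A g) (VId A f) = VId A (Comp A g f)"
    and interchange: "\<lbrakk>\<alpha> \<in> hom (hom_category A x y) f f'; \<alpha>' \<in> hom (hom_category A x y) f' f'';
        \<beta> \<in> hom (hom_category A y z) g g'; \<beta>' \<in> hom (hom_category A y z) g' g''\<rbrakk>
      \<Longrightarrow> HComp A (VComp A \<beta>' \<beta>) (VComp A \<alpha>' \<alpha>) = VComp A (HComp A \<beta>' \<alpha>') (HComp A \<beta> \<alpha>)"
    and HComp_Id_left: "\<alpha> \<in> Arr (hom_category A x y) \<Longrightarrow> HComp A (VId A (Id A y)) \<alpha> = \<alpha>"
    and HComp_Id_right: "\<alpha> \<in> Arr (hom_category A x y) \<Longrightarrow> HComp A \<alpha> (VId A (Id A x)) = \<alpha>"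
    and HComp_assoc: "\<lbrakk>\<alpha> \<in> Arr (hom_category A w x); \<beta> \<in> Arr (hom_category A x y);
        \<gamma> \<in> Arr (hom_category A y z)\<rbrakk>
      \<Longrightarrow> HComp A \<gamma> (HComp A \<beta> \<alpha>) = HComp A (HComp A \<gamma> \<beta>) \<alpha>"

definition whisker_right :: "('o, 'm, 'c) two_cat \<Rightarrow> 'c \<Rightarrow> 'm \<Rightarrow> 'c" where
  "whisker_right A \<alpha> f = HComp A \<alpha> (VId A f)"

text \<open>The functor \<open>- \<cdot> f\<close> from \<open>A(B, X)\<close> to \<open>A(A', X)\<close>, for \<open>f : A' \<rightarrow> B\<close>.\<close>

definition precomposition :: "('o, 'm, 'c) two_cat \<Rightarrow> 'm \<Rightarrow> ('m, 'c, 'm, 'c) ftor" where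
  "precomposition A f = \<lparr>FO = (\<lambda>g. Comp A g f), FA = (\<lambda>\<alpha>. whisker_right A \<alpha> f)\<rparr>"


section \<open>The lax comma category\<close>

text \<open>
  A morphism \<open>(p, \<pi>)\<close> from \<open>f\<close> to \<open>g\<close>, with
  \<open>\<pi> : f \<Rightarrow> g \<cdot> p\<close>, is stored together with its source and target, because
  \<open>g\<close> is not determined by \<open>p\<close> and \<open>\<pi>\<close>.
\<close>

definition lax_comma ::
  "('o, 'm, 'c) two_cat \<Rightarrow> 'o \<Rightarrow> ('m, 'm \<times> ('m \<times> 'c) \<times> 'm) cat" where
  "lax_comma A X = \<lparr>
     Obj = {f \<in> Arr A. Cod A f = X},
     Arr = {(f, (p, \<pi>), g) | f p \<pi> g.
              f \<in> Arr A \<and> Cod A f = X \<and> g \<in> Arr A \<and> Cod A g = X \<and>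
              p \<in> hom (underlying A) (Dom A f) (Dom A g) \<and>
              \<pi> \<in> hom (hom_category A (Dom A f) X) f (Comp A g p)},
     Dom = (\<lambda>(f, p\<pi>, g). f),
     Cod = (\<lambda>(f, p\<pi>, g). g),
     Id = (\<lambda>f. (f, (Id A (Dom A f), VId A f), f)),
     Comp = (\<lambda>(g, (q, \<chi>), h) (f, (p, \<pi>), g').
       (f, (Comp A q p, VComp A (whisker_right A \<chi> p) \<pi>), h))\<rparr>"

definition lax_comma_forget ::
  "('o, 'm, 'c) two_cat \<Rightarrow> ('m, 'm \<times> ('m \<times> 'c) \<times> 'm, 'o, 'm) ftor" where
  "lax_comma_forget A = \<lparr>FO = (\<lambda>f. Dom A f), FA = (\<lambda>(f, (p, \<pi>), g). p)\<rparr>"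

end

theory Submission
  imports Defs
begin

text \<open>
  Write \<open>L\<close> for the lax comma category and \<open>U\<close> for the forgetful functor to the underlying
  category of \<open>A\<close>. Sending an object \<open>a\<close> to the initial object \<open>J a\<close> of the hom-category
  from \<open>a\<close> to \<open>X\<close> gives a full and faithful left adjoint of \<open>U\<close> with \<open>U J\<close> the
  identity. Since the initial objects are strict and stable under precomposition, every object of \<open>L\<close> that
  maps to some \<open>J a\<close> is itself of the form \<open>J b\<close>, up to isomorphism. So \<open>J\<close> embeds
  \<open>A\<close> in \<open>L\<close> as a coreflective sieve, and every coreflection onto a sieve preserves effective
  descent morphisms (locale \<open>sieve_coreflection\<close>).

  Let \<open>P : f \<rightarrow> g\<close> be an effective descent morphism of \<open>L\<close>. The slice of \<open>A\<close> over
  \<open>U g\<close> is the full subcategory of the slice of \<open>L\<close> over \<open>g\<close> on the arrows out of objects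
  \<open>J a\<close>; likewise for \<open>f\<close>, and \<open>P\<^sub>!\<close> restricts to \<open>(U P)\<^sub>!\<close>. Pulling back
  along \<open>P\<close> cannot leave the subcategories, as they are sieves. What has to be shown is that descent data in
  the subcategory are realized inside the subcategory (\<open>quotient_of_restricted_object\<close>). Monadicity presents
  the realizing object \<open>y\<close> as a quotient of an object of the subcategory; the quotient map factors through
  the coreflection of \<open>y\<close>, which is monic, and a monic arrow through which a quotient map factors is
  invertible here.

  To carry this out without choosing pullbacks, monadicity of an adjunction is first translated into conditions on
  homs that mention the left adjoint only (\<open>monadic_iff_left_adjoint\<close>): existence of couniversal arrows, a
  quotient property of these arrows, and realizability of algebras given by their action on generalized elements.
  They restrict to full subcategories that are coreflective sieves (\<open>monadic_left_adjoint_restricts\<close>). The existence of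
  pullbacks along a morphism \<open>p\<close> comes for free, since a couniversal arrow for \<open>p\<^sub>!\<close> is a pullback
  square (\<open>pullback_of_couniversal\<close>).
\<close>

section \<open>Categories and functors\<close>

lemma hom_iff: "f \<in> hom C x y \<longleftrightarrow> f \<in> Arr C \<and> Dom C f = x \<and> Cod C f = y"
  by (auto simp: hom_def)

context category
begin

lemma Arr_Comp [simp]:
  assumes "f \<in> Arr C" "g \<in> Arr C" "Dom C g = Cod C f"
  shows "Comp C g f \<in> Arr C" "Dom C (Comp C g f) = Dom C f" "Cod C (Comp C g f) = Cod C g"
  using Comp_hom[of f "Dom C f" "Cod C f" g "Cod C g"] assms by (auto simp: hom_iff)

lemma Arr_Id [simp]:
  assumes "x \<in> Obj C"
  shows "Id C x \<in> Arr C" "Dom C (Id C x) = x" "Cod C (Id C x) = x"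
  using Id_hom[OF assms] by (auto simp: hom_iff)

lemma Comp_Id_Arr [simp]:
  assumes "f \<in> Arr C"
  shows "Cod C f = y \<Longrightarrow> Comp C (Id C y) f = f" "Dom C f = x \<Longrightarrow> Comp C f (Id C x) = f"
  using assms Comp_Id_left Comp_Id_right by (auto simp: hom_iff)

lemma assoc:
  assumes "f \<in> Arr C" "g \<in> Arr C" "h \<in> Arr C" "Dom C g = Cod C f" "Dom C h = Cod C g"
  shows "Comp C (Comp C h g) f = Comp C h (Comp C g f)"
  using Comp_assoc[of f "Dom C f" "Cod C f" g "Cod C g" h "Cod C h"] assms by (auto simp: hom_iff)

lemma Obj_of_hom: "f \<in> hom C x y \<Longrightarrow> x \<in> Obj C" "f \<in> hom C x y \<Longrightarrow> y \<in> Obj C"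
  using Dom_Obj Cod_Obj by (auto simp: hom_iff)

lemma iso_arrI:
  assumes "f \<in> hom C x y" "g \<in> hom C y x" "Comp C g f = Id C x" "Comp C f g = Id C y"
  shows "iso_arr C f"
  using assms unfolding iso_arr_def by (auto simp: hom_iff intro!: bexI[of _ g])

lemma iso_arrE:
  assumes "iso_arr C f" "f \<in> hom C x y"
  obtains g where "g \<in> hom C y x" "Comp C g f = Id C x" "Comp C f g = Id C y"
  using assms unfolding iso_arr_def by (auto simp: hom_iff)

lemma isomorphicE:
  assumes "isomorphic C x y"
  obtains f g where "f \<in> hom C x y" "g \<in> hom C y x" "Comp C g f = Id C x" "Comp C f g = Id C y"
  using assms unfolding isomorphic_def by (meson iso_arrE)

lemma isomorphicI:
  assumes "f \<in> hom C x y" "g \<in> hom C y x" "Comp C g f = Id C x" "Comp C f g = Id C y"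
  shows "isomorphic C x y"
  using assms iso_arrI unfolding isomorphic_def by blast

lemma isomorphic_sym: "isomorphic C x y \<Longrightarrow> isomorphic C y x"
  by (meson isomorphicE isomorphicI)

end

lemma cat_functor_id: "category C \<Longrightarrow> cat_functor C C id_ftor"
  by (intro cat_functor.intro cat_functor_axioms.intro) (simp_all add: id_ftor_def)

lemma cat_functor_comp:
  assumes "cat_functor C D F" "cat_functor D E G"
  shows "cat_functor C E (comp_ftor G F)"
proof -
  interpret F: cat_functor C D F by fact
  interpret G: cat_functor D E G by fact
  show ?thesis
  proof (intro cat_functor.intro cat_functor_axioms.intro F.C.category_axioms G.D.category_axioms)
    show "FA (comp_ftor G F) (Comp C g f) = Comp E (FA (comp_ftor G F) g) (FA (comp_ftor G F) f)"
      if "f \<in> hom C x y" "g \<in> hom C y z" for f g x y z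
      using F.FA_Comp[OF that] G.FA_Comp[OF that[THEN F.FA_hom]] by (simp add: comp_ftor_def)
  qed (simp_all add: comp_ftor_def F.FO_Obj G.FO_Obj F.FA_hom G.FA_hom F.FA_Id G.FA_Id)
qed

context cat_functor
begin

lemma FA_Arr [simp]:
  assumes "f \<in> Arr C"
  shows "FA F f \<in> Arr D" "Dom D (FA F f) = FO F (Dom C f)" "Cod D (FA F f) = FO F (Cod C f)"
  using FA_hom[of f "Dom C f" "Cod C f"] assms by (auto simp: hom_iff)

lemma FA_Comp_Arr:
  assumes "f \<in> Arr C" "g \<in> Arr C" "Dom C g = Cod C f"
  shows "FA F (Comp C g f) = Comp D (FA F g) (FA F f)"
  using FA_Comp[of f "Dom C f" "Cod C f" g "Cod C g"] assms by (auto simp: hom_iff)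

definition fully_faithful :: bool where
  "fully_faithful \<longleftrightarrow> (\<forall>x \<in> Obj C. \<forall>y \<in> Obj C. \<forall>g \<in> hom D (FO F x) (FO F y).
     \<exists>!f. f \<in> hom C x y \<and> FA F f = g)"

definition essentially_surjective :: bool where
  "essentially_surjective \<longleftrightarrow> (\<forall>y \<in> Obj D. \<exists>x \<in> Obj C. isomorphic D (FO F x) y)"

lemma fully_faithfulD:
  assumes "fully_faithful" "x \<in> Obj C" "y \<in> Obj C" "g \<in> hom D (FO F x) (FO F y)"
  obtains f where "f \<in> hom C x y" "FA F f = g"
  using assms unfolding fully_faithful_def by meson

lemma faithfulD:
  assumes "fully_faithful" "f \<in> hom C x y" "f' \<in> hom C x y" "FA F f = FA F f'"
  shows "f = f'"
  using assms FA_hom[OF assms(2)] C.Obj_of_hom[OF assms(2)] unfolding fully_faithful_def by metis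

text \<open>
  The invertible unit can be cancelled, so \<open>F\<close> is faithful, and the invertible counit makes the
  quasi-inverse \<open>G\<close> faithful in the same way. Fullness uses both: conjugating \<open>G h\<close> with
  the unit gives an arrow whose image under \<open>F\<close> has the same image under \<open>G\<close> as
  \<open>h\<close>.
\<close>

lemma equivalence_imp_fully_faithful_essentially_surjective:
  assumes "equivalence_functor C D F"
  shows "fully_faithful" "essentially_surjective"
proof -
  obtain G \<eta> \<epsilon> where "cat_functor D C G" and "nat_iso C C id_ftor (comp_ftor G F) \<eta>"
    and "nat_iso D D (comp_ftor F G) id_ftor \<epsilon>"
    using assms unfolding equivalence_functor_def by blast
  interpret G: cat_functor D C G by fact
  interpret e: nat_iso C C id_ftor "comp_ftor G F" \<eta> by fact
  interpret n: nat_iso D D "comp_ftor F G" id_ftor \<epsilon> by fact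
  note [simp] = id_ftor_def comp_ftor_def
  have eta: "\<eta> x \<in> hom C x (FO G (FO F x))" if "x \<in> Obj C" for x
    using e.component[OF that] by simp
  have eps: "\<epsilon> y \<in> hom D (FO F (FO G y)) y" if "y \<in> Obj D" for y
    using n.component[OF that] by simp
  have cancel_eta: "f = f'" if f: "f \<in> hom C x y" "f' \<in> hom C x y" and eq: "Comp C (\<eta> y) f = Comp C (\<eta> y) f'" for f f' x y
  proof -
    have y: "y \<in> Obj C" using C.Obj_of_hom f by blast
    obtain k where k: "k \<in> hom C (FO G (FO F y)) y" "Comp C k (\<eta> y) = Id C y"
      using C.iso_arrE[OF e.component_iso[OF y] eta[OF y]] by blast
    have "f = Comp C (Comp C k (\<eta> y)) f" using f k by (simp add: hom_iff)
    also have "\<dots> = Comp C k (Comp C (\<eta> y) f')"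
      using f k(1) eta[OF y] eq by (simp add: hom_iff C.assoc)
    also have "\<dots> = Comp C (Comp C k (\<eta> y)) f'"
      using f k(1) eta[OF y] by (simp add: hom_iff C.assoc)
    also have "\<dots> = f'" using f k by (simp add: hom_iff)
    finally show ?thesis .
  qed
  have faith: "f = f'" if f: "f \<in> hom C x y" "f' \<in> hom C x y" and eq: "FA F f = FA F f'" for f f' x y
    using cancel_eta[OF f] e.naturality[OF f(1)] e.naturality[OF f(2)] eq by simp
  have faithG: "g = g'" if g: "g \<in> hom D x y" "g' \<in> hom D x y" and eq: "FA G g = FA G g'" for g g' x y
  proof -
    have x: "x \<in> Obj D" using D.Obj_of_hom g by blast
    obtain k where k: "k \<in> hom D x (FO F (FO G x))" "Comp D (\<epsilon> x) k = Id D x"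
      using D.iso_arrE[OF n.component_iso[OF x] eps[OF x]] by blast
    have *: "Comp D g (\<epsilon> x) = Comp D g' (\<epsilon> x)"
      using n.naturality[OF g(1)] n.naturality[OF g(2)] eq by simp
    have "g = Comp D g (Comp D (\<epsilon> x) k)" using g k by (simp add: hom_iff)
    also have "\<dots> = Comp D (Comp D g' (\<epsilon> x)) k"
      using g k(1) eps[OF x] * by (simp add: hom_iff D.assoc[symmetric])
    also have "\<dots> = g'" using g k eps[OF x] by (simp add: hom_iff D.assoc)
    finally show ?thesis .
  qed
  show "fully_faithful"
    unfolding fully_faithful_def
  proof (intro ballI ex_ex1I)
    fix x y h assume xy: "x \<in> Obj C" "y \<in> Obj C" and h: "h \<in> hom D (FO F x) (FO F y)"
    obtain k where k: "k \<in> hom C (FO G (FO F y)) y" "Comp C (\<eta> y) k = Id C (FO G (FO F y))"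
      using C.iso_arrE[OF e.component_iso[OF xy(2)] eta[OF xy(2)]] by auto
    let ?f = "Comp C k (Comp C (FA G h) (\<eta> x))"
    have f: "?f \<in> hom C x y" using k(1) h eta xy by (simp add: hom_iff)
    obtain k' where k': "k' \<in> hom C (FO G (FO F x)) x" "Comp C (\<eta> x) k' = Id C (FO G (FO F x))"
      using C.iso_arrE[OF e.component_iso[OF xy(1)] eta[OF xy(1)]] by auto
    have 1: "Comp C (\<eta> y) ?f = Comp C (Comp C (\<eta> y) k) (Comp C (FA G h) (\<eta> x))"
      using k(1) h eta xy by (simp add: hom_iff C.assoc)
    have "Comp C (FA G (FA F ?f)) (\<eta> x) = Comp C (FA G h) (\<eta> x)"
      using e.naturality[OF f] 1 k h eta[of x] xy by (simp add: hom_iff FO_Obj)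
    then have "Comp C (Comp C (FA G (FA F ?f)) (\<eta> x)) k' = Comp C (Comp C (FA G h) (\<eta> x)) k'" by simp
    moreover have "FA F ?f \<in> hom D (FO F x) (FO F y)" using FA_hom[OF f] .
    ultimately have "FA G (FA F ?f) = FA G h"
      using f k' h eta[of x] xy(1) by (simp add: hom_iff C.assoc)
    then have "FA F ?f = h" using faithG[OF FA_hom[OF f] h] by blast
    then show "\<exists>f. f \<in> hom C x y \<and> FA F f = h" using f by blast
  qed (use faith in metis)
  show "essentially_surjective"
    unfolding essentially_surjective_def isomorphic_def
    using eps n.component_iso G.FO_Obj by blast
qed

lemma fully_faithful_essentially_surjective_imp_equivalence:
  assumes ff: "fully_faithful" and es: "essentially_surjective"
  shows "equivalence_functor C D F"
proof -
  have "\<forall>y. \<exists>x i j. y \<in> Obj D \<longrightarrow> x \<in> Obj C \<and> i \<in> hom D (FO F x) y \<and> j \<in> hom D y (FO F x) \<and>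
      Comp D j i = Id D (FO F x) \<and> Comp D i j = Id D y"
    using es unfolding essentially_surjective_def by (meson D.isomorphicE)
  then obtain g i j where g: "\<And>y. y \<in> Obj D \<Longrightarrow> g y \<in> Obj C"
    and i: "\<And>y. y \<in> Obj D \<Longrightarrow> i y \<in> hom D (FO F (g y)) y"
    and j: "\<And>y. y \<in> Obj D \<Longrightarrow> j y \<in> hom D y (FO F (g y))"
    and ji: "\<And>y. y \<in> Obj D \<Longrightarrow> Comp D (j y) (i y) = Id D (FO F (g y))"
    and ij: "\<And>y. y \<in> Obj D \<Longrightarrow> Comp D (i y) (j y) = Id D y"
    by metis
  define pre where "pre x y h = (THE f. f \<in> hom C x y \<and> FA F f = h)" for x y h
  have pre: "pre x y h \<in> hom C x y \<and> FA F (pre x y h) = h"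
    if "x \<in> Obj C" "y \<in> Obj C" "h \<in> hom D (FO F x) (FO F y)" for x y h
    unfolding pre_def using ff[unfolded fully_faithful_def, rule_format, OF that] by (rule theI')
  define G where "G = \<lparr>FO = g, FA = (\<lambda>h. pre (g (Dom D h)) (g (Cod D h))
      (Comp D (j (Cod D h)) (Comp D h (i (Dom D h)))))\<rparr>"
  have GO [simp]: "FO G y = g y" for y by (simp add: G_def)
  have G: "FA G h \<in> hom C (g x) (g y) \<and> FA F (FA G h) = Comp D (j y) (Comp D h (i x))"
    if h: "h \<in> hom D x y" for h x y
  proof -
    have xy: "x \<in> Obj D" "y \<in> Obj D" using D.Obj_of_hom[OF h] .
    have "Comp D (j y) (Comp D h (i x)) \<in> hom D (FO F (g x)) (FO F (g y))"
      using i[OF xy(1)] j[OF xy(2)] h by (simp add: hom_iff)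
    with pre[of "g x" "g y" "Comp D (j y) (Comp D h (i x))"] g xy h show ?thesis
      by (simp add: hom_iff G_def)
  qed
  have counit: "Comp D (i y) (FA F (FA G h)) = Comp D h (i x)" if h: "h \<in> hom D x y" for h x y
  proof -
    have xy: "x \<in> Obj D" "y \<in> Obj D" using D.Obj_of_hom[OF h] .
    have "Comp D (i y) (FA F (FA G h)) = Comp D (Comp D (i y) (j y)) (Comp D h (i x))"
      using G[OF h] i[OF xy(1)] i[OF xy(2)] j[OF xy(2)] h by (simp add: hom_iff D.assoc)
    then show ?thesis using ij[OF xy(2)] i[OF xy(1)] h by (simp add: hom_iff xy)
  qed
  have cancel: "a = b" if ab: "a \<in> hom D w (FO F (g y))" "b \<in> hom D w (FO F (g y))" and y: "y \<in> Obj D"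
      and eq: "Comp D (i y) a = Comp D (i y) b" for a b w y
  proof -
    have "Comp D (Comp D (j y) (i y)) a = Comp D (Comp D (j y) (i y)) b"
      using ab eq i[OF y] j[OF y] by (simp add: hom_iff D.assoc)
    then show ?thesis using ji[OF y] ab by (simp add: hom_iff)
  qed
  have Gf: "cat_functor D C G"
  proof unfold_locales
    show "FO G x \<in> Obj C" if "x \<in> Obj D" for x using g[OF that] by simp
    show "FA G f \<in> hom C (FO G x) (FO G y)" if "f \<in> hom D x y" for f x y using G[OF that] by simp
    show "FA G (Id D x) = Id C (FO G x)" if x: "x \<in> Obj D" for x
    proof (rule faithfulD[OF ff])
      show "FA G (Id D x) \<in> hom C (g x) (g x)" using G[OF D.Id_hom[OF x]] by blast
      show "Id C (FO G x) \<in> hom C (g x) (g x)" using C.Id_hom[OF g[OF x]] by simp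
      show "FA F (FA G (Id D x)) = FA F (Id C (FO G x))"
        using G[OF D.Id_hom[OF x]] ji[OF x] i[OF x] g[OF x] by (simp add: hom_iff FA_Id)
    qed
    show "FA G (Comp D k h) = Comp C (FA G k) (FA G h)"
      if h: "h \<in> hom D x y" and k: "k \<in> hom D y z" for h k x y z
    proof (rule faithfulD[OF ff])
      have kh: "Comp D k h \<in> hom D x z" using D.Comp_hom[OF h k] .
      have z: "z \<in> Obj D" "y \<in> Obj D" "x \<in> Obj D" using D.Obj_of_hom h k by blast+
      show "FA G (Comp D k h) \<in> hom C (g x) (g z)" using G[OF kh] by blast
      show c: "Comp C (FA G k) (FA G h) \<in> hom C (g x) (g z)" using G[OF h] G[OF k] C.Comp_hom by blast
      show "FA F (FA G (Comp D k h)) = FA F (Comp C (FA G k) (FA G h))"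
      proof (rule cancel)
        show "FA F (FA G (Comp D k h)) \<in> hom D (FO F (g x)) (FO F (g z))" using G[OF kh] FA_hom by blast
        show "FA F (Comp C (FA G k) (FA G h)) \<in> hom D (FO F (g x)) (FO F (g z))" using c FA_hom by blast
        have "Comp D (i z) (FA F (Comp C (FA G k) (FA G h))) = Comp D (Comp D (i z) (FA F (FA G k))) (FA F (FA G h))"
          using G[OF h] G[OF k] i[OF z(1)] FA_hom[of "FA G k"] FA_hom[of "FA G h"]
          by (simp add: hom_iff D.assoc FA_Comp_Arr)
        also have "\<dots> = Comp D k (Comp D (i y) (FA F (FA G h)))"
          using counit[OF k] k i[OF z(2)] G[OF h] FA_hom[of "FA G h" "g x" "g y"] by (simp add: hom_iff D.assoc)
        also have "\<dots> = Comp D (Comp D k h) (i x)"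
          using counit[OF h] h k i[OF z(3)] by (simp add: hom_iff D.assoc)
        finally show "Comp D (i z) (FA F (FA G (Comp D k h))) = Comp D (i z) (FA F (Comp C (FA G k) (FA G h)))"
          using counit[OF kh] by simp
      qed (rule z)
    qed
  qed
  interpret G: cat_functor D C G by (rule Gf)
  define \<eta> where "\<eta> x = pre x (g (FO F x)) (j (FO F x))" for x
  have eta: "\<eta> x \<in> hom C x (g (FO F x)) \<and> FA F (\<eta> x) = j (FO F x)" if x: "x \<in> Obj C" for x
    unfolding \<eta>_def using pre j[of "FO F x"] g FO_Obj x by blast
  note [simp] = id_ftor_def comp_ftor_def
  have "nat_iso C C id_ftor (comp_ftor G F) \<eta>"
  proof (intro nat_iso.intro nat_trans.intro nat_iso_axioms.intro nat_trans_axioms.intro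
      cat_functor_id[OF C.category_axioms] cat_functor_comp[OF cat_functor_axioms Gf])
    show "\<eta> x \<in> hom C (FO id_ftor x) (FO (comp_ftor G F) x)" if "x \<in> Obj C" for x using eta[OF that] by simp
    show "Comp C (\<eta> y) (FA id_ftor f) = Comp C (FA (comp_ftor G F) f) (\<eta> x)" if f: "f \<in> hom C x y" for f x y
    proof -
      have xy: "x \<in> Obj C" "y \<in> Obj C" using C.Obj_of_hom[OF f] .
      have Ff: "FA F f \<in> hom D (FO F x) (FO F y)" using FA_hom[OF f] .
      have 1: "FA F (Comp C (FA G (FA F f)) (\<eta> x)) = Comp D (FA F (FA G (FA F f))) (j (FO F x))"
        using G[OF Ff] eta[OF xy(1)] by (simp add: hom_iff FA_Comp_Arr)
      have 2: "\<dots> = Comp D (j (FO F y)) (Comp D (FA F f) (Comp D (i (FO F x)) (j (FO F x))))"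
        using G[OF Ff] i[OF FO_Obj[OF xy(1)]] j[OF FO_Obj[OF xy(1)]] j[OF FO_Obj[OF xy(2)]] Ff
        by (simp add: hom_iff D.assoc)
      have 3: "\<dots> = Comp D (j (FO F y)) (FA F f)"
        using ij[OF FO_Obj[OF xy(1)]] Ff by (simp add: hom_iff)
      have "FA F (Comp C (\<eta> y) f) = FA F (Comp C (FA G (FA F f)) (\<eta> x))"
        using 1 2 3 eta[OF xy(2)] f by (simp add: hom_iff FA_Comp_Arr)
      then have "Comp C (\<eta> y) f = Comp C (FA G (FA F f)) (\<eta> x)"
        by (intro faithfulD[OF ff, of _ x "g (FO F y)"])
          (use eta[OF xy(1)] eta[OF xy(2)] f G[OF Ff] in \<open>auto simp: hom_iff\<close>)
      then show ?thesis by simp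
    qed
    show "iso_arr C (\<eta> x)" if x: "x \<in> Obj C" for x
    proof -
      let ?y = "FO F x"
      let ?k = "pre (g ?y) x (i ?y)"
      have y: "?y \<in> Obj D" using FO_Obj[OF x] .
      have k: "?k \<in> hom C (g ?y) x" "FA F ?k = i ?y" using pre[OF g[OF y] x i[OF y]] by auto
      have "Comp C ?k (\<eta> x) = Id C x"
        by (rule faithfulD[OF ff, of _ x x])
          (use k eta[OF x] ij[OF y] x in \<open>auto simp: hom_iff FA_Comp_Arr FA_Id\<close>)
      moreover have "Comp C (\<eta> x) ?k = Id C (g ?y)"
        by (rule faithfulD[OF ff, of _ "g ?y" "g ?y"])
          (use k eta[OF x] ji[OF y] g[OF y] in \<open>auto simp: hom_iff FA_Comp_Arr FA_Id\<close>)
      ultimately show ?thesis using C.iso_arrI[OF conjunct1[OF eta[OF x]] k(1)] by blast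
    qed
  qed
  moreover have "nat_iso D D (comp_ftor F G) id_ftor i"
  proof (intro nat_iso.intro nat_trans.intro nat_iso_axioms.intro nat_trans_axioms.intro
      cat_functor_id[OF D.category_axioms] cat_functor_comp[OF Gf cat_functor_axioms])
    show "iso_arr D (i y)" if "y \<in> Obj D" for y
      using D.iso_arrI[OF i j ji ij] that by blast
  qed (simp_all add: i counit)
  ultimately show ?thesis
    unfolding equivalence_functor_def using Gf cat_functor_axioms by blast
qed

end

section \<open>Monadicity without a chosen right adjoint\<close>

text \<open>
  The pair \<open>(x, e)\<close> is the value at \<open>y\<close> of a right adjoint of \<open>F\<close>, together
  with the counit there. Phrasing everything through such pairs makes the choice of a right adjoint
  irrelevant.
\<close>

definition couniversal ::
  "('o1, 'm1) cat \<Rightarrow> ('o2, 'm2) cat \<Rightarrow> ('o1, 'm1, 'o2, 'm2) ftor \<Rightarrow> 'o1 \<Rightarrow> 'm2 \<Rightarrow> 'o2 \<Rightarrow> bool" where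
  "couniversal C D F x e y \<longleftrightarrow> x \<in> Obj C \<and> e \<in> hom D (FO F x) y \<and>
     (\<forall>w \<in> Obj C. \<forall>t \<in> hom D (FO F w) y. \<exists>!u. u \<in> hom C w x \<and> Comp D e (FA F u) = t)"

definition respects_kernel ::
  "('o1, 'm1) cat \<Rightarrow> ('o2, 'm2) cat \<Rightarrow> ('o1, 'm1, 'o2, 'm2) ftor \<Rightarrow> 'o1 \<Rightarrow> 'm2 \<Rightarrow> 'm2 \<Rightarrow> bool" where
  "respects_kernel C D F x e s \<longleftrightarrow>
     (\<forall>w \<in> Obj C. \<forall>a \<in> hom D (FO F w) (FO F x). \<forall>b \<in> hom D (FO F w) (FO F x).
        Comp D e a = Comp D e b \<longrightarrow> Comp D s a = Comp D s b)"

text \<open>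
  If \<open>e\<close> is a counit component, this says that \<open>e\<close> is the coequalizer of its canonical
  presentation by free objects.
\<close>

definition quotient_arrow ::
  "('o1, 'm1) cat \<Rightarrow> ('o2, 'm2) cat \<Rightarrow> ('o1, 'm1, 'o2, 'm2) ftor \<Rightarrow> 'o1 \<Rightarrow> 'm2 \<Rightarrow> 'o2 \<Rightarrow> bool" where
  "quotient_arrow C D F x e y \<longleftrightarrow>
     (\<forall>z. \<forall>s \<in> hom D (FO F x) z. respects_kernel C D F x e s \<longrightarrow>
        (\<exists>!k. k \<in> hom D y z \<and> Comp D k e = s))"

text \<open>
  An algebra on \<open>x\<close> for the monad \<open>G F\<close>, written without \<open>G\<close>: a structure map
  \<open>\<alpha> : G F x \<rightarrow> x\<close> is recorded by what it does to generalized elements, so that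
  \<open>a w t\<close> is \<open>\<alpha>\<close> after the adjunct \<open>w \<rightarrow> G F x\<close> of
  \<open>t : F w \<rightarrow> F x\<close>. The two equations are the unit law and the associativity law; together they
  imply naturality in \<open>w\<close>. The object \<open>w\<close> is an argument because \<open>F\<close> may
  identify objects, so that \<open>t\<close> does not determine it.
\<close>

definition kleisli_algebra ::
  "('o1, 'm1) cat \<Rightarrow> ('o2, 'm2) cat \<Rightarrow> ('o1, 'm1, 'o2, 'm2) ftor \<Rightarrow> 'o1 \<Rightarrow>
   ('o1 \<Rightarrow> 'm2 \<Rightarrow> 'm1) \<Rightarrow> bool" where
  "kleisli_algebra C D F x a \<longleftrightarrow> x \<in> Obj C \<and>
     (\<forall>w \<in> Obj C. \<forall>t \<in> hom D (FO F w) (FO F x). a w t \<in> hom C w x) \<and>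
     (\<forall>w \<in> Obj C. \<forall>u \<in> hom C w x. a w (FA F u) = u) \<and>
     (\<forall>w \<in> Obj C. \<forall>w' \<in> Obj C. \<forall>v \<in> hom D (FO F w) (FO F x). \<forall>t \<in> hom D (FO F w') (FO F w).
        a w' (Comp D v t) = a w' (Comp D (FA F (a w v)) t))"

definition coequalizes_algebra ::
  "('o1, 'm1) cat \<Rightarrow> ('o2, 'm2) cat \<Rightarrow> ('o1, 'm1, 'o2, 'm2) ftor \<Rightarrow> 'o1 \<Rightarrow>
   ('o1 \<Rightarrow> 'm2 \<Rightarrow> 'm1) \<Rightarrow> 'm2 \<Rightarrow> bool" where
  "coequalizes_algebra C D F x a e \<longleftrightarrow>
     (\<forall>w \<in> Obj C. \<forall>t \<in> hom D (FO F w) (FO F x). Comp D e t = Comp D e (FA F (a w t)))"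

text \<open>
  The three clauses say that a right adjoint exists, that the Eilenberg--Moore comparison functor is fully
  faithful, and that it is essentially surjective (see \<open>monadic_iff_left_adjoint\<close>). Only homs of
  \<open>C\<close> and \<open>D\<close> occur in them, so that they can be compared directly with the
  corresponding clauses for full subcategories.
\<close>

definition monadic_left_adjoint ::
  "('o1, 'm1) cat \<Rightarrow> ('o2, 'm2) cat \<Rightarrow> ('o1, 'm1, 'o2, 'm2) ftor \<Rightarrow> bool" where
  "monadic_left_adjoint C D F \<longleftrightarrow>
     (\<forall>y \<in> Obj D. \<exists>x e. couniversal C D F x e y) \<and>
     (\<forall>x e y. couniversal C D F x e y \<longrightarrow> quotient_arrow C D F x e y) \<and>
     (\<forall>x a. kleisli_algebra C D F x a \<longrightarrow>
        (\<exists>y e. couniversal C D F x e y \<and> coequalizes_algebra C D F x a e))"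

context cat_functor
begin

lemma couniversal_factor:
  assumes "couniversal C D F x e y" "w \<in> Obj C" "t \<in> hom D (FO F w) y"
  obtains u where "u \<in> hom C w x" "Comp D e (FA F u) = t"
  using assms unfolding couniversal_def by meson

lemma couniversal_unique:
  assumes "couniversal C D F x e y" "u \<in> hom C w x" "u' \<in> hom C w x"
    "Comp D e (FA F u) = Comp D e (FA F u')"
  shows "u = u'"
proof -
  have w: "w \<in> Obj C" using C.Obj_of_hom assms(2) by blast
  have e: "e \<in> hom D (FO F x) y" using assms(1) unfolding couniversal_def by blast
  have "Comp D e (FA F u) \<in> hom D (FO F w) y" using D.Comp_hom[OF FA_hom[OF assms(2)] e] .
  then show ?thesis using assms w unfolding couniversal_def by metis
qed

lemma couniversal_arrow:
  assumes "couniversal C D F x e y"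
  shows "x \<in> Obj C" "y \<in> Obj D" "e \<in> hom D (FO F x) y"
  using assms D.Obj_of_hom unfolding couniversal_def by blast+

lemma couniversal_iso:
  assumes e: "couniversal C D F x e y" and e': "couniversal C D F x' e' y"
  obtains i j where "i \<in> hom C x x'" "j \<in> hom C x' x" "Comp C j i = Id C x" "Comp C i j = Id C x'"
    "Comp D e' (FA F i) = e" "Comp D e (FA F j) = e'"
proof -
  note x = couniversal_arrow[OF e] and x' = couniversal_arrow[OF e']
  obtain i where i: "i \<in> hom C x x'" "Comp D e' (FA F i) = e" using couniversal_factor[OF e' x(1,3)] .
  obtain j where j: "j \<in> hom C x' x" "Comp D e (FA F j) = e'" using couniversal_factor[OF e x'(1,3)] .
  have "Comp D e (FA F (Comp C j i)) = Comp D (Comp D e (FA F j)) (FA F i)"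
    using i(1) j(1) x(3) by (simp add: hom_iff D.assoc FA_Comp_Arr)
  then have "Comp C j i = Id C x"
    by (intro couniversal_unique[OF e]) (use i j x in \<open>auto simp: hom_iff FA_Id\<close>)
  moreover have "Comp D e' (FA F (Comp C i j)) = Comp D (Comp D e' (FA F i)) (FA F j)"
    using i(1) j(1) x'(3) by (simp add: hom_iff D.assoc FA_Comp_Arr)
  then have "Comp C i j = Id C x'"
    by (intro couniversal_unique[OF e']) (use i j x' in \<open>auto simp: hom_iff FA_Id\<close>)
  ultimately show ?thesis using i j that by blast
qed

lemma couniversal_precomp_iso:
  assumes e: "couniversal C D F x e y" and i: "i \<in> hom C x' x" and j: "j \<in> hom C x x'"
    and ji: "Comp C j i = Id C x'" and ij: "Comp C i j = Id C x"
  shows "couniversal C D F x' (Comp D e (FA F i)) y"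
proof -
  note x = couniversal_arrow[OF e]
  have x': "x' \<in> Obj C" using C.Obj_of_hom i by blast
  have shift: "Comp D (Comp D e (FA F i)) (FA F u) = Comp D e (FA F (Comp C i u))"
    if "u \<in> hom C w x'" for u w
    using that i x(3) by (simp add: hom_iff D.assoc FA_Comp_Arr)
  show ?thesis
    unfolding couniversal_def
  proof (intro conjI ballI ex_ex1I)
    show "Comp D e (FA F i) \<in> hom D (FO F x') y" using D.Comp_hom[OF FA_hom[OF i] x(3)] .
    fix w t assume w: "w \<in> Obj C" and t: "t \<in> hom D (FO F w) y"
    obtain u where u: "u \<in> hom C w x" "Comp D e (FA F u) = t" using couniversal_factor[OF e w t] .
    have ju: "Comp C j u \<in> hom C w x'" using C.Comp_hom[OF u(1) j] .
    have "Comp C i (Comp C j u) = Comp C (Comp C i j) u" using i j u(1) by (simp add: hom_iff C.assoc)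
    then have "Comp C i (Comp C j u) = u" using ij u(1) by (simp add: hom_iff)
    then show "\<exists>u. u \<in> hom C w x' \<and> Comp D (Comp D e (FA F i)) (FA F u) = t"
      using shift[OF ju] ju u(2) by auto
  next
    fix w t u u' assume "u \<in> hom C w x' \<and> Comp D (Comp D e (FA F i)) (FA F u) = t"
      and "u' \<in> hom C w x' \<and> Comp D (Comp D e (FA F i)) (FA F u') = t"
    then have u: "u \<in> hom C w x'" and u': "u' \<in> hom C w x'"
      and eq: "Comp D e (FA F (Comp C i u)) = Comp D e (FA F (Comp C i u'))"
      using shift by auto
    have "Comp C i u = Comp C i u'"
      using couniversal_unique[OF e C.Comp_hom[OF u i] C.Comp_hom[OF u' i] eq] .
    then have "Comp C (Comp C j i) u = Comp C (Comp C j i) u'"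
      using i j u u' by (simp add: hom_iff C.assoc)
    then show "u = u'" using ji u u' by (simp add: hom_iff)
  qed (rule x')
qed

lemma couniversal_postcomp_iso:
  assumes e: "couniversal C D F x e y" and i: "i \<in> hom D y y'" and j: "j \<in> hom D y' y"
    and ji: "Comp D j i = Id D y" and ij: "Comp D i j = Id D y'"
  shows "couniversal C D F x (Comp D i e) y'"
proof -
  note x = couniversal_arrow[OF e]
  show ?thesis
    unfolding couniversal_def
  proof (intro conjI ballI ex_ex1I)
    show "Comp D i e \<in> hom D (FO F x) y'" using D.Comp_hom[OF x(3) i] .
    fix w t assume w: "w \<in> Obj C" and t: "t \<in> hom D (FO F w) y'"
    obtain u where u: "u \<in> hom C w x" "Comp D e (FA F u) = Comp D j t"
      using couniversal_factor[OF e w D.Comp_hom[OF t j]] .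
    have "Comp D (Comp D i e) (FA F u) = Comp D i (Comp D j t)"
      using u x(3) i by (simp add: hom_iff D.assoc)
    also have "\<dots> = Comp D (Comp D i j) t" using i j t by (simp add: hom_iff D.assoc)
    finally show "\<exists>u. u \<in> hom C w x \<and> Comp D (Comp D i e) (FA F u) = t"
      using u(1) t ij by (auto simp: hom_iff)
  next
    fix w t u u' assume "u \<in> hom C w x \<and> Comp D (Comp D i e) (FA F u) = t"
      and "u' \<in> hom C w x \<and> Comp D (Comp D i e) (FA F u') = t"
    then have u: "u \<in> hom C w x" and u': "u' \<in> hom C w x"
      and eq: "Comp D (Comp D i e) (FA F u) = Comp D (Comp D i e) (FA F u')" by auto
    have "Comp D (Comp D j i) (Comp D e (FA F u)) = Comp D j (Comp D (Comp D i e) (FA F u))"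
      using u x(3) i j by (simp add: hom_iff D.assoc)
    moreover have "Comp D (Comp D j i) (Comp D e (FA F u')) = Comp D j (Comp D (Comp D i e) (FA F u'))"
      using u' x(3) i j by (simp add: hom_iff D.assoc)
    ultimately have "Comp D e (FA F u) = Comp D e (FA F u')"
      using eq ji u u' x(3) by (simp add: hom_iff)
    then show "u = u'" using couniversal_unique[OF e u u'] by blast
  qed (rule x)
qed

lemma quotient_arrow_iso:
  assumes e: "couniversal C D F x e y" and e': "couniversal C D F x' e' y"
    and q: "quotient_arrow C D F x e y"
  shows "quotient_arrow C D F x' e' y"
proof -
  note x = couniversal_arrow[OF e] and x' = couniversal_arrow[OF e']
  obtain i j where i: "i \<in> hom C x x'" and j: "j \<in> hom C x' x" and ij: "Comp C i j = Id C x'"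
    and ei: "Comp D e' (FA F i) = e" and ej: "Comp D e (FA F j) = e'"
    using couniversal_iso[OF e e'] by metis
  have Fij: "Comp D (FA F i) (FA F j) = Id D (FO F x')"
    using i j ij x'(1) FA_Comp[OF j i] FA_Id by simp
  show ?thesis
    unfolding quotient_arrow_def
  proof (intro allI ballI impI)
    fix z s assume s: "s \<in> hom D (FO F x') z" and rk: "respects_kernel C D F x' e' s"
    have si: "Comp D s (FA F i) \<in> hom D (FO F x) z" using D.Comp_hom[OF FA_hom[OF i] s] .
    have "respects_kernel C D F x e (Comp D s (FA F i))"
      unfolding respects_kernel_def
    proof (intro ballI impI)
      fix w a b assume w: "w \<in> Obj C" and a: "a \<in> hom D (FO F w) (FO F x)" and b: "b \<in> hom D (FO F w) (FO F x)"
        and eq: "Comp D e a = Comp D e b"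
      have "Comp D e' (Comp D (FA F i) a) = Comp D e a" "Comp D e' (Comp D (FA F i) b) = Comp D e b"
        using a b i x'(3) ei[symmetric] by (simp_all add: hom_iff D.assoc)
      then have "Comp D s (Comp D (FA F i) a) = Comp D s (Comp D (FA F i) b)"
        using rk[unfolded respects_kernel_def, rule_format, OF w D.Comp_hom[OF a FA_hom[OF i]]
          D.Comp_hom[OF b FA_hom[OF i]]] eq by simp
      then show "Comp D (Comp D s (FA F i)) a = Comp D (Comp D s (FA F i)) b"
        using a b i s by (simp add: hom_iff D.assoc)
    qed
    then have ex1: "\<exists>!k. k \<in> hom D y z \<and> Comp D k e = Comp D s (FA F i)"
      using q si unfolding quotient_arrow_def by blast
    have "Comp D k e' = s \<longleftrightarrow> Comp D k e = Comp D s (FA F i)" if k: "k \<in> hom D y z" for k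
    proof
      assume "Comp D k e' = s"
      then have "Comp D s (FA F i) = Comp D k (Comp D e' (FA F i))"
        using k x'(3) i by (simp add: hom_iff D.assoc[symmetric])
      then show "Comp D k e = Comp D s (FA F i)" using ei by simp
    next
      assume eq: "Comp D k e = Comp D s (FA F i)"
      have "Comp D k e' = Comp D (Comp D k e) (FA F j)"
        using k x(3) j ej by (simp add: hom_iff D.assoc)
      also have "\<dots> = Comp D s (Comp D (FA F i) (FA F j))"
        unfolding eq using s i j by (simp add: hom_iff D.assoc)
      finally show "Comp D k e' = s" using Fij s by (simp add: hom_iff)
    qed
    then show "\<exists>!k. k \<in> hom D y z \<and> Comp D k e' = s" using ex1 by (metis (no_types, lifting))
  qed
qed

end

section \<open>Eilenberg--Moore comparison\<close>

lemma hom_em_category: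
  "hom (em_category C T \<eta> \<mu>) (x, \<alpha>) (y, \<beta>) = {((x, \<alpha>), h, (y, \<beta>)) | h.
     (x, \<alpha>) \<in> em_algebras C T \<eta> \<mu> \<and> (y, \<beta>) \<in> em_algebras C T \<eta> \<mu> \<and>
     h \<in> hom C x y \<and> Comp C h \<alpha> = Comp C \<beta> (FA T h)}"
  by (auto simp: em_category_def hom_def)

lemma em_category_simps [simp]:
  "Obj (em_category C T \<eta> \<mu>) = em_algebras C T \<eta> \<mu>"
  "Id (em_category C T \<eta> \<mu>) a = (a, Id C (fst a), a)"
  "Comp (em_category C T \<eta> \<mu>) (b, k, c) (a, h, b') = (a, Comp C k h, c)"
  by (simp_all add: em_category_def)

lemma category_em_category:
  assumes "cat_functor C C T"
  shows "category (em_category C T \<eta> \<mu>)"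
proof -
  interpret T: cat_functor C C T by fact
  let ?E = "em_category C T \<eta> \<mu>"
  show ?thesis
  proof
    fix f assume "f \<in> Arr ?E"
    then show "Dom ?E f \<in> Obj ?E" "Cod ?E f \<in> Obj ?E" by (auto simp: em_category_def)
  next
    fix a assume "a \<in> Obj ?E"
    then show "Id ?E a \<in> hom ?E a a"
      by (cases a) (auto simp: hom_em_category em_algebras_def T.C.Id_hom T.FA_Id hom_iff)
  next
    fix f g a b c assume f: "f \<in> hom ?E a b" and g: "g \<in> hom ?E b c"
    obtain x \<alpha> y \<beta> z \<gamma> where [simp]: "a = (x, \<alpha>)" "b = (y, \<beta>)" "c = (z, \<gamma>)" by (metis surj_pair)
    obtain h where [simp]: "f = (a, h, b)" and h: "h \<in> hom C x y" "Comp C h \<alpha> = Comp C \<beta> (FA T h)"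
      and ab: "a \<in> em_algebras C T \<eta> \<mu>" "b \<in> em_algebras C T \<eta> \<mu>"
      using f by (auto simp: hom_em_category)
    obtain k where [simp]: "g = (b, k, c)" and k: "k \<in> hom C y z" "Comp C k \<beta> = Comp C \<gamma> (FA T k)"
      and c: "c \<in> em_algebras C T \<eta> \<mu>"
      using g by (auto simp: hom_em_category)
    have st: "\<alpha> \<in> hom C (FO T x) x" "\<beta> \<in> hom C (FO T y) y" "\<gamma> \<in> hom C (FO T z) z"
      using ab c by (auto simp: em_algebras_def)
    have "Comp C (Comp C k h) \<alpha> = Comp C (Comp C k \<beta>) (FA T h)"
      using h k(1) st by (simp add: hom_iff T.C.assoc)
    also have "\<dots> = Comp C \<gamma> (FA T (Comp C k h))"
      unfolding k(2) using h(1) k(1) st by (simp add: hom_iff T.C.assoc T.FA_Comp_Arr)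
    finally show "Comp ?E g f \<in> hom ?E a c"
      using h(1) k(1) ab c by (auto simp: hom_em_category intro: T.C.Comp_hom)
  next
    fix f a b assume f: "f \<in> hom ?E a b"
    then obtain x \<alpha> y \<beta> h where "a = (x, \<alpha>)" "b = (y, \<beta>)" "f = (a, h, b)" "h \<in> hom C x y"
      by (cases a; cases b) (auto simp: hom_em_category)
    then show "Comp ?E (Id ?E b) f = f" "Comp ?E f (Id ?E a) = f" by (simp_all add: hom_iff)
  next
    fix f g h a b c d assume f: "f \<in> hom ?E a b" and g: "g \<in> hom ?E b c" and h: "h \<in> hom ?E c d"
    obtain f' where f': "f = (a, f', b)" "f' \<in> hom C (fst a) (fst b)"
      using f by (cases a; cases b) (auto simp: hom_em_category)
    obtain g' where g': "g = (b, g', c)" "g' \<in> hom C (fst b) (fst c)"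
      using g by (cases b; cases c) (auto simp: hom_em_category)
    obtain h' where h': "h = (c, h', d)" "h' \<in> hom C (fst c) (fst d)"
      using h by (cases c; cases d) (auto simp: hom_em_category)
    show "Comp ?E h (Comp ?E g f) = Comp ?E (Comp ?E h g) f"
      using f' g' h' by (simp add: hom_iff T.C.assoc)
  qed
qed

context adjunction
begin

lemma unit_hom: "x \<in> Obj C \<Longrightarrow> \<eta> x \<in> hom C x (FO G (FO F x))"
  using unit.component by (simp add: id_ftor_def comp_ftor_def)

lemma counit_hom: "y \<in> Obj D \<Longrightarrow> \<epsilon> y \<in> hom D (FO F (FO G y)) y"
  using counit.component by (simp add: id_ftor_def comp_ftor_def)

lemma unit_natural: "f \<in> hom C x y \<Longrightarrow> Comp C (\<eta> y) f = Comp C (FA G (FA F f)) (\<eta> x)"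
  using unit.naturality by (simp add: id_ftor_def comp_ftor_def)

lemma counit_natural: "g \<in> hom D x y \<Longrightarrow> Comp D (\<epsilon> y) (FA F (FA G g)) = Comp D g (\<epsilon> x)"
  using counit.naturality by (simp add: id_ftor_def comp_ftor_def)

definition adjunct :: "'o1 \<Rightarrow> 'm2 \<Rightarrow> 'm1" where
  "adjunct w t = Comp C (FA G t) (\<eta> w)"

lemma adjunct:
  assumes w: "w \<in> Obj C" and t: "t \<in> hom D (FO F w) y"
  shows "adjunct w t \<in> hom C w (FO G y)" "Comp D (\<epsilon> y) (FA F (adjunct w t)) = t"
proof -
  have y: "y \<in> Obj D" using F.D.Obj_of_hom t by blast
  note [simp] = unit_hom[OF w, unfolded hom_iff] counit_hom[OF y, unfolded hom_iff]
    counit_hom[OF F.FO_Obj[OF w], unfolded hom_iff]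
  have t': "t \<in> Arr D" "Dom D t = FO F w" "Cod D t = y" using t by (auto simp: hom_iff)
  show "adjunct w t \<in> hom C w (FO G y)" using t' by (simp add: adjunct_def hom_iff)
  have "Comp D (\<epsilon> y) (FA F (adjunct w t)) = Comp D (Comp D (\<epsilon> y) (FA F (FA G t))) (FA F (\<eta> w))"
    using t' by (simp add: adjunct_def F.FA_Comp_Arr F.D.assoc)
  also have "\<dots> = Comp D t (Comp D (\<epsilon> (FO F w)) (FA F (\<eta> w)))"
    using t' by (simp add: counit_natural[OF t] F.D.assoc)
  also have "\<dots> = t" using t' triangle_left[OF w] by simp
  finally show "Comp D (\<epsilon> y) (FA F (adjunct w t)) = t" .
qed

lemma adjunct_unique:
  assumes u: "u \<in> hom C w (FO G y)" and y: "y \<in> Obj D"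
  shows "adjunct w (Comp D (\<epsilon> y) (FA F u)) = u"
proof -
  have w: "w \<in> Obj C" using F.C.Obj_of_hom u by blast
  note [simp] = unit_hom[OF w, unfolded hom_iff] counit_hom[OF y, unfolded hom_iff]
    unit_hom[OF G.FO_Obj[OF y], unfolded hom_iff]
  have u': "u \<in> Arr C" "Dom C u = w" "Cod C u = FO G y" using u by (auto simp: hom_iff)
  have "adjunct w (Comp D (\<epsilon> y) (FA F u)) = Comp C (FA G (\<epsilon> y)) (Comp C (FA G (FA F u)) (\<eta> w))"
    using u' by (simp add: adjunct_def G.FA_Comp_Arr F.C.assoc)
  also have "\<dots> = Comp C (Comp C (FA G (\<epsilon> y)) (\<eta> (FO G y))) u"
    using u' by (simp add: unit_natural[OF u, symmetric] F.C.assoc)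
  also have "\<dots> = u" using u' triangle_right[OF y] by simp
  finally show ?thesis .
qed

lemma couniversal_counit:
  assumes y: "y \<in> Obj D"
  shows "couniversal C D F (FO G y) (\<epsilon> y) y"
  unfolding couniversal_def
proof (intro conjI ballI ex_ex1I G.FO_Obj y counit_hom)
  show "\<exists>u. u \<in> hom C w (FO G y) \<and> Comp D (\<epsilon> y) (FA F u) = t"
    if "w \<in> Obj C" "t \<in> hom D (FO F w) y" for w t
    using adjunct[OF that] by blast
qed (metis adjunct_unique y)

abbreviation (input) EM where "EM \<equiv> adj_em_category C F G \<eta> \<epsilon>"
abbreviation (input) K where "K \<equiv> em_comparison D G \<epsilon>"

lemma hom_EM:
  "hom EM (x, \<alpha>) (y, \<beta>) = {((x, \<alpha>), h, (y, \<beta>)) | h.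
     (x, \<alpha>) \<in> Obj EM \<and> (y, \<beta>) \<in> Obj EM \<and>
     h \<in> hom C x y \<and> Comp C h \<alpha> = Comp C \<beta> (FA G (FA F h))}"
  by (auto simp: adj_em_category_def hom_em_category comp_ftor_def)

lemma Obj_EM: "(x, \<alpha>) \<in> Obj EM \<longleftrightarrow> x \<in> Obj C \<and> \<alpha> \<in> hom C (FO G (FO F x)) x \<and>
    Comp C \<alpha> (\<eta> x) = Id C x \<and> Comp C \<alpha> (FA G (\<epsilon> (FO F x))) = Comp C \<alpha> (FA G (FA F \<alpha>))"
  by (auto simp: adj_em_category_def em_algebras_def comp_ftor_def)

lemma category_EM: "category EM"
  unfolding adj_em_category_def
  by (intro category_em_category cat_functor_comp[OF F.cat_functor_axioms G.cat_functor_axioms])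

lemma EM_simps:
  "Id EM a = (a, Id C (fst a), a)"
  "Comp EM (b, k, c) (a, h, b') = (a, Comp C k h, c)"
  by (simp_all add: adj_em_category_def)

lemma K_simps:
  "FO K y = (FO G y, FA G (\<epsilon> y))"
  "g \<in> hom D y z \<Longrightarrow> FA K g = (FO K y, FA G g, FO K z)"
  by (simp_all add: em_comparison_def Let_def hom_iff)

lemma counit_algebra:
  assumes y: "y \<in> Obj D"
  shows "(FO G y, FA G (\<epsilon> y)) \<in> Obj EM"
proof -
  have e: "\<epsilon> y \<in> hom D (FO F (FO G y)) y" using counit_hom[OF y] .
  have e': "\<epsilon> (FO F (FO G y)) \<in> hom D (FO F (FO G (FO F (FO G y)))) (FO F (FO G y))"
    using counit_hom[OF F.FO_Obj[OF G.FO_Obj[OF y]]] .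
  have "Comp C (FA G (\<epsilon> y)) (FA G (\<epsilon> (FO F (FO G y)))) = FA G (Comp D (\<epsilon> y) (\<epsilon> (FO F (FO G y))))"
    using G.FA_Comp[OF e' e] by simp
  also have "\<dots> = FA G (Comp D (\<epsilon> y) (FA F (FA G (\<epsilon> y))))" using counit_natural[OF e] by simp
  also have "\<dots> = Comp C (FA G (\<epsilon> y)) (FA G (FA F (FA G (\<epsilon> y))))"
    using G.FA_Comp[OF F.FA_hom[OF G.FA_hom[OF e]] e] by simp
  finally show ?thesis
    using y e triangle_right[OF y] G.FO_Obj G.FA_hom[OF e] by (simp add: Obj_EM)
qed

lemma comparison_functor: "cat_functor D EM K"
proof (intro cat_functor.intro category_EM F.D.category_axioms cat_functor_axioms.intro)
  show "FO K y \<in> Obj EM" if "y \<in> Obj D" for y using counit_algebra[OF that] by (simp add: K_simps)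
  show "FA K g \<in> hom EM (FO K y) (FO K z)" if g: "g \<in> hom D y z" for g y z
  proof -
    have yz: "y \<in> Obj D" "z \<in> Obj D" using F.D.Obj_of_hom[OF g] .
    have "Comp C (FA G g) (FA G (\<epsilon> y)) = Comp C (FA G (\<epsilon> z)) (FA G (FA F (FA G g)))"
      using counit_natural[OF g] G.FA_Comp[OF counit_hom[OF yz(1)] g]
        G.FA_Comp[OF F.FA_hom[OF G.FA_hom[OF g]] counit_hom[OF yz(2)]] by simp
    then show ?thesis
      using counit_algebra[OF yz(1)] counit_algebra[OF yz(2)] G.FA_hom[OF g] K_simps(2)[OF g]
      by (simp add: K_simps(1) hom_EM)
  qed
  show "FA K (Id D y) = Id EM (FO K y)" if y: "y \<in> Obj D" for y
    using K_simps(2)[OF F.D.Id_hom[OF y]] G.FA_Id[OF y] by (simp add: K_simps(1) EM_simps)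
  show "FA K (Comp D h g) = Comp EM (FA K h) (FA K g)" if g: "g \<in> hom D x y" and h: "h \<in> hom D y z" for g h x y z
    using K_simps(2)[OF F.D.Comp_hom[OF g h]] K_simps(2)[OF g] K_simps(2)[OF h] G.FA_Comp[OF g h]
    by (simp add: EM_simps)
qed

text \<open>
  Transposing both sides of the algebra morphism equation for \<open>h\<close> along the counit at
  \<open>z\<close> turns it into the statement that the transpose \<open>s\<close> of \<open>h\<close> coequalizes
  \<open>F G \<epsilon>\<close> and \<open>\<epsilon> F G\<close> at \<open>y\<close>. These two arrows generate the kernel of
  \<open>\<epsilon>\<close> at \<open>y\<close>: every \<open>a : F w \<rightarrow> F G y\<close> is identified by
  \<open>s\<close> with an arrow that only depends on \<open>\<epsilon> \<cdot> a\<close>.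
\<close>

lemma respects_kernel_counit_iff:
  assumes y: "y \<in> Obj D" and h: "h \<in> hom C (FO G y) (FO G z)" and z: "z \<in> Obj D"
  shows "respects_kernel C D F (FO G y) (\<epsilon> y) (Comp D (\<epsilon> z) (FA F h)) \<longleftrightarrow>
    Comp C h (FA G (\<epsilon> y)) = Comp C (FA G (\<epsilon> z)) (FA G (FA F h))"
proof -
  let ?x = "FO G y" and ?s = "Comp D (\<epsilon> z) (FA F h)"
  let ?w = "FO G (FO F ?x)"
  have x: "?x \<in> Obj C" and w: "?w \<in> Obj C" using y G.FO_Obj F.FO_Obj by auto
  have ey: "\<epsilon> y \<in> hom D (FO F ?x) y" and ez: "\<epsilon> z \<in> hom D (FO F (FO G z)) z"
    using counit_hom y z by auto
  have ex: "\<epsilon> (FO F ?x) \<in> hom D (FO F ?w) (FO F ?x)" using counit_hom[OF F.FO_Obj[OF x]] .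
  have Gey: "FA G (\<epsilon> y) \<in> hom C ?w ?x" using G.FA_hom[OF ey] .
  have Fh: "FA F h \<in> hom D (FO F ?x) (FO F (FO G z))" using F.FA_hom[OF h] .
  have s: "?s \<in> hom D (FO F ?x) z" using F.D.Comp_hom[OF Fh ez] .
  have left: "Comp D (\<epsilon> z) (FA F (Comp C h (FA G (\<epsilon> y)))) = Comp D ?s (FA F (FA G (\<epsilon> y)))"
    using h Gey ez by (simp add: hom_iff F.FA_Comp_Arr F.D.assoc)
  have "Comp D (\<epsilon> z) (FA F (Comp C (FA G (\<epsilon> z)) (FA G (FA F h)))) = Comp D (\<epsilon> z) (FA F (FA G ?s))"
    using G.FA_Comp[OF Fh ez] by simp
  also have "\<dots> = Comp D ?s (\<epsilon> (FO F ?x))" using counit_natural[OF s] .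
  finally have right: "Comp D (\<epsilon> z) (FA F (Comp C (FA G (\<epsilon> z)) (FA G (FA F h)))) = Comp D ?s (\<epsilon> (FO F ?x))" .
  have c1: "Comp C h (FA G (\<epsilon> y)) \<in> hom C ?w (FO G z)" using F.C.Comp_hom[OF Gey h] .
  have c2: "Comp C (FA G (\<epsilon> z)) (FA G (FA F h)) \<in> hom C ?w (FO G z)"
    using F.C.Comp_hom[OF G.FA_hom[OF Fh] G.FA_hom[OF ez]] .
  have *: "Comp C h (FA G (\<epsilon> y)) = Comp C (FA G (\<epsilon> z)) (FA G (FA F h)) \<longleftrightarrow>
      Comp D ?s (FA F (FA G (\<epsilon> y))) = Comp D ?s (\<epsilon> (FO F ?x))"
    using left right F.couniversal_unique[OF couniversal_counit[OF z] c1 c2] by auto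
  show ?thesis
    unfolding *
  proof
    assume "respects_kernel C D F ?x (\<epsilon> y) ?s"
    from this[unfolded respects_kernel_def, rule_format, OF w F.FA_hom[OF Gey] ex]
    show "Comp D ?s (FA F (FA G (\<epsilon> y))) = Comp D ?s (\<epsilon> (FO F ?x))"
      using counit_natural[OF ey] by simp
  next
    assume eq: "Comp D ?s (FA F (FA G (\<epsilon> y))) = Comp D ?s (\<epsilon> (FO F ?x))"
    have canon: "Comp D ?s a = Comp D ?s (FA F (adjunct v (Comp D (\<epsilon> y) a)))"
      if v: "v \<in> Obj C" and a: "a \<in> hom D (FO F v) (FO F ?x)" for v a
    proof -
      let ?a = "adjunct v a"
      have a': "?a \<in> hom C v ?w" "Comp D (\<epsilon> (FO F ?x)) (FA F ?a) = a" using adjunct[OF v a] .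
      have Fa: "FA F ?a \<in> hom D (FO F v) (FO F ?w)" using F.FA_hom[OF a'(1)] .
      have "adjunct v (Comp D (\<epsilon> y) a) = Comp C (FA G (\<epsilon> y)) ?a"
        using G.FA_Comp[OF a ey] G.FA_hom[OF a] Gey unit_hom[OF v] by (simp add: adjunct_def hom_iff F.C.assoc)
      then have "Comp D ?s (FA F (adjunct v (Comp D (\<epsilon> y) a))) = Comp D (Comp D ?s (FA F (FA G (\<epsilon> y)))) (FA F ?a)"
        using F.FA_Comp[OF a'(1) Gey] F.FA_hom[OF Gey] Fa s by (simp add: hom_iff F.D.assoc)
      also have "\<dots> = Comp D ?s (Comp D (\<epsilon> (FO F ?x)) (FA F ?a))"
        unfolding eq using s ex Fa by (simp add: hom_iff F.D.assoc)
      finally show ?thesis using a'(2) by simp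
    qed
    show "respects_kernel C D F ?x (\<epsilon> y) ?s"
      unfolding respects_kernel_def using canon by metis
  qed
qed

text \<open>
  Algebra morphisms between the images of \<open>y\<close> and \<open>z\<close> transpose to the arrows
  \<open>F G y \<rightarrow> z\<close> that respect the kernel of the counit, and those in the image of the comparison
  functor transpose to the arrows that factor through the counit.
\<close>

lemma comparison_fully_faithful_iff:
  "cat_functor.fully_faithful D EM K \<longleftrightarrow>
    (\<forall>y \<in> Obj D. quotient_arrow C D F (FO G y) (\<epsilon> y) y)"
proof -
  interpret K: cat_functor D EM K by (rule comparison_functor)
  have hom_K: "f \<in> hom EM (FO K y) (FO K z) \<longleftrightarrow> (\<exists>h. f = (FO K y, h, FO K z) \<and> h \<in> hom C (FO G y) (FO G z) \<and>
      respects_kernel C D F (FO G y) (\<epsilon> y) (Comp D (\<epsilon> z) (FA F h)))" if "y \<in> Obj D" "z \<in> Obj D" for y z f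
    using that by (auto simp: K_simps(1) hom_EM counit_algebra respects_kernel_counit_iff)
  have FA_K: "FA K k = (FO K y, h, FO K z) \<longleftrightarrow> Comp D k (\<epsilon> y) = Comp D (\<epsilon> z) (FA F h)"
    if y: "y \<in> Obj D" and z: "z \<in> Obj D" and k: "k \<in> hom D y z" and h: "h \<in> hom C (FO G y) (FO G z)" for y z k h
  proof -
    have "FA K k = (FO K y, h, FO K z) \<longleftrightarrow> FA G k = h" using K_simps(2)[OF k] by simp
    also have "\<dots> \<longleftrightarrow> Comp D (\<epsilon> z) (FA F (FA G k)) = Comp D (\<epsilon> z) (FA F h)"
      using F.couniversal_unique[OF couniversal_counit[OF z] G.FA_hom[OF k] h] by auto
    finally show ?thesis using counit_natural[OF k] by simp
  qed
  show ?thesis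
  proof
    assume ff: "K.fully_faithful"
    show "\<forall>y \<in> Obj D. quotient_arrow C D F (FO G y) (\<epsilon> y) y"
      unfolding quotient_arrow_def
    proof (intro ballI allI impI)
      fix y z s assume y: "y \<in> Obj D" and s: "s \<in> hom D (FO F (FO G y)) z"
        and rk: "respects_kernel C D F (FO G y) (\<epsilon> y) s"
      have z: "z \<in> Obj D" using F.D.Obj_of_hom s by blast
      define h where "h = adjunct (FO G y) s"
      have h: "h \<in> hom C (FO G y) (FO G z)" "Comp D (\<epsilon> z) (FA F h) = s"
        unfolding h_def using adjunct[OF G.FO_Obj[OF y] s] .
      have "(FO K y, h, FO K z) \<in> hom EM (FO K y) (FO K z)" using hom_K[OF y z] h rk by auto
      then have "\<exists>!k. k \<in> hom D y z \<and> FA K k = (FO K y, h, FO K z)"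
        using ff y z unfolding K.fully_faithful_def by blast
      then show "\<exists>!k. k \<in> hom D y z \<and> Comp D k (\<epsilon> y) = s"
        using FA_K[OF y z _ h(1)] h(2) by (metis (no_types, lifting))
    qed
  next
    assume q: "\<forall>y \<in> Obj D. quotient_arrow C D F (FO G y) (\<epsilon> y) y"
    show "K.fully_faithful"
      unfolding K.fully_faithful_def
    proof (intro ballI)
      fix y z f assume y: "y \<in> Obj D" and z: "z \<in> Obj D" and f: "f \<in> hom EM (FO K y) (FO K z)"
      obtain h where h: "f = (FO K y, h, FO K z)" "h \<in> hom C (FO G y) (FO G z)"
        and rk: "respects_kernel C D F (FO G y) (\<epsilon> y) (Comp D (\<epsilon> z) (FA F h))"
        using hom_K[OF y z] f by auto
      have "Comp D (\<epsilon> z) (FA F h) \<in> hom D (FO F (FO G y)) z"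
        using F.D.Comp_hom[OF F.FA_hom[OF h(2)] counit_hom[OF z]] .
      then have "\<exists>!k. k \<in> hom D y z \<and> Comp D k (\<epsilon> y) = Comp D (\<epsilon> z) (FA F h)"
        using q y rk unfolding quotient_arrow_def by blast
      then show "\<exists>!k. k \<in> hom D y z \<and> FA K k = f"
        using FA_K[OF y z _ h(2)] h(1) by (metis (no_types, lifting))
    qed
  qed
qed

lemma kleisli_algebra_of_EM:
  assumes "(x, \<alpha>) \<in> Obj EM"
  shows "kleisli_algebra C D F x (\<lambda>w t. Comp C \<alpha> (adjunct w t))"
proof -
  have x: "x \<in> Obj C" and a: "\<alpha> \<in> hom C (FO G (FO F x)) x" and un: "Comp C \<alpha> (\<eta> x) = Id C x"
    and mu: "Comp C \<alpha> (FA G (\<epsilon> (FO F x))) = Comp C \<alpha> (FA G (FA F \<alpha>))"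
    using assms by (auto simp: Obj_EM)
  have FGx: "FO F x \<in> Obj D" using x F.FO_Obj by blast
  show ?thesis
    unfolding kleisli_algebra_def
  proof (intro conjI ballI x)
    show "Comp C \<alpha> (adjunct w t) \<in> hom C w x" if "w \<in> Obj C" "t \<in> hom D (FO F w) (FO F x)" for w t
      using F.C.Comp_hom[OF adjunct(1)[OF that] a] .
    show "Comp C \<alpha> (adjunct w (FA F u)) = u" if w: "w \<in> Obj C" and u: "u \<in> hom C w x" for w u
    proof -
      have "Comp C \<alpha> (adjunct w (FA F u)) = Comp C (Comp C \<alpha> (\<eta> x)) u"
        using unit_natural[OF u] a u unit_hom[OF x] by (simp add: adjunct_def hom_iff F.C.assoc)
      then show ?thesis using un u by (simp add: hom_iff)
    qed
    fix w w' v t assume w: "w \<in> Obj C" and w': "w' \<in> Obj C" and v: "v \<in> hom D (FO F w) (FO F x)"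
      and t: "t \<in> hom D (FO F w') (FO F w)"
    let ?v = "adjunct w v"
    have v': "?v \<in> hom C w (FO G (FO F x))" "Comp D (\<epsilon> (FO F x)) (FA F ?v) = v" using adjunct[OF w v] .
    have e: "\<epsilon> (FO F x) \<in> hom D (FO F (FO G (FO F x))) (FO F x)" using counit_hom[OF FGx] .
    note in_hom = a v'(1) e t unit_hom[OF w'] F.FA_hom[OF v'(1)]
    have "Comp C \<alpha> (adjunct w' (Comp D (FA F (Comp C \<alpha> ?v)) t))
        = Comp C (Comp C \<alpha> (FA G (FA F \<alpha>))) (Comp C (FA G (FA F ?v)) (Comp C (FA G t) (\<eta> w')))"
      using in_hom by (simp add: adjunct_def hom_iff F.FA_Comp_Arr G.FA_Comp_Arr F.C.assoc)
    also have "\<dots> = Comp C \<alpha> (Comp C (FA G (Comp D (\<epsilon> (FO F x)) (FA F ?v))) (Comp C (FA G t) (\<eta> w')))"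
      unfolding mu[symmetric] using in_hom by (simp add: hom_iff G.FA_Comp_Arr F.C.assoc)
    also have "\<dots> = Comp C \<alpha> (adjunct w' (Comp D v t))"
      unfolding v'(2) using in_hom v by (simp add: adjunct_def hom_iff G.FA_Comp_Arr F.C.assoc)
    finally show "Comp C \<alpha> (adjunct w' (Comp D v t)) = Comp C \<alpha> (adjunct w' (Comp D (FA F (Comp C \<alpha> ?v)) t))"
      by simp
  qed
qed

text \<open>
  By the Yoneda argument, \<open>a\<close> is determined by its value at the universal arrow, the counit at
  \<open>F x\<close>; that value is the structure map.
\<close>

lemma kleisli_algebra_structure:
  assumes a: "kleisli_algebra C D F x a"
  defines "\<alpha> \<equiv> a (FO G (FO F x)) (\<epsilon> (FO F x))"
  shows "(x, \<alpha>) \<in> Obj EM"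
    and "\<lbrakk>w \<in> Obj C; t \<in> hom D (FO F w) (FO F x)\<rbrakk> \<Longrightarrow> a w t = Comp C \<alpha> (adjunct w t)"
proof -
  have x: "x \<in> Obj C" using a unfolding kleisli_algebra_def by blast
  have hom: "a w t \<in> hom C w x" if "w \<in> Obj C" "t \<in> hom D (FO F w) (FO F x)" for w t
    using a that unfolding kleisli_algebra_def by blast
  have retr: "a w (FA F u) = u" if "w \<in> Obj C" "u \<in> hom C w x" for w u
    using a that unfolding kleisli_algebra_def by blast
  have mult: "a w' (Comp D v t) = a w' (Comp D (FA F (a w v)) t)"
    if "w \<in> Obj C" "w' \<in> Obj C" "v \<in> hom D (FO F w) (FO F x)" "t \<in> hom D (FO F w') (FO F w)" for w w' v t
    using a that unfolding kleisli_algebra_def by blast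
  have nat: "a w' (Comp D v (FA F u)) = Comp C (a w v) u"
    if "v \<in> hom D (FO F w) (FO F x)" "u \<in> hom C w' w" for w w' v u
  proof -
    have ww: "w \<in> Obj C" "w' \<in> Obj C" using F.C.Obj_of_hom that(2) by blast+
    have "a w' (Comp D v (FA F u)) = a w' (FA F (Comp C (a w v) u))"
      using mult[OF ww that(1) F.FA_hom[OF that(2)]] F.FA_Comp[OF that(2) hom[OF ww(1) that(1)]] by simp
    then show ?thesis using retr[OF ww(2) F.C.Comp_hom[OF that(2) hom[OF ww(1) that(1)]]] by simp
  qed
  let ?T = "FO G (FO F x)"
  have T: "?T \<in> Obj C" using x F.FO_Obj G.FO_Obj by blast
  have TT: "FO G (FO F ?T) \<in> Obj C" using T F.FO_Obj G.FO_Obj by blast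
  have e: "\<epsilon> (FO F x) \<in> hom D (FO F ?T) (FO F x)" using counit_hom[OF F.FO_Obj[OF x]] .
  have e': "\<epsilon> (FO F ?T) \<in> hom D (FO F (FO G (FO F ?T))) (FO F ?T)" using counit_hom[OF F.FO_Obj[OF T]] .
  have \<alpha>: "\<alpha> \<in> hom C ?T x" unfolding \<alpha>_def using hom[OF T e] .
  have "Comp C \<alpha> (\<eta> x) = a x (Comp D (\<epsilon> (FO F x)) (FA F (\<eta> x)))"
    unfolding \<alpha>_def using nat[OF e unit_hom[OF x]] by simp
  also have "\<dots> = Id C x"
    using triangle_left[OF x] retr[OF x F.C.Id_hom[OF x]] F.FA_Id[OF x] by simp
  finally have 1: "Comp C \<alpha> (\<eta> x) = Id C x" .
  have "Comp C \<alpha> (FA G (\<epsilon> (FO F x))) = a (FO G (FO F ?T)) (Comp D (\<epsilon> (FO F x)) (FA F (FA G (\<epsilon> (FO F x)))))"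
    unfolding \<alpha>_def using nat[OF e G.FA_hom[OF e]] by simp
  also have "\<dots> = a (FO G (FO F ?T)) (Comp D (\<epsilon> (FO F x)) (\<epsilon> (FO F ?T)))" using counit_natural[OF e] by simp
  also have "\<dots> = a (FO G (FO F ?T)) (Comp D (FA F \<alpha>) (\<epsilon> (FO F ?T)))"
    unfolding \<alpha>_def using mult[OF T TT e e'] by simp
  also have "\<dots> = a (FO G (FO F ?T)) (Comp D (\<epsilon> (FO F x)) (FA F (FA G (FA F \<alpha>))))"
    using counit_natural[OF F.FA_hom[OF \<alpha>]] by simp
  also have "\<dots> = Comp C \<alpha> (FA G (FA F \<alpha>))"
    unfolding \<alpha>_def[symmetric] using nat[OF e G.FA_hom[OF F.FA_hom[OF \<alpha>]]] \<alpha>_def by simp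
  finally show "(x, \<alpha>) \<in> Obj EM" using 1 x \<alpha> by (simp add: Obj_EM)
  show "a w t = Comp C \<alpha> (adjunct w t)" if w: "w \<in> Obj C" and t: "t \<in> hom D (FO F w) (FO F x)"
    unfolding \<alpha>_def using nat[OF e adjunct(1)[OF w t]] adjunct(2)[OF w t] by simp
qed

text \<open>
  As before, transposing along the counit at \<open>y\<close> turns the algebra morphism equation into an equation
  between arrows to \<open>y\<close>. It is the case \<open>t = \<epsilon> (F x)\<close> of the coequalizing property, and
  every other \<open>t\<close> factors through this one.
\<close>

lemma EM_hom_iff_coequalizes:
  assumes alg: "(x, \<alpha>) \<in> Obj EM" and y: "y \<in> Obj D" and p: "\<phi> \<in> hom C x (FO G y)"
  shows "Comp C \<phi> \<alpha> = Comp C (FA G (\<epsilon> y)) (FA G (FA F \<phi>)) \<longleftrightarrow>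
    coequalizes_algebra C D F x (\<lambda>w t. Comp C \<alpha> (adjunct w t)) (Comp D (\<epsilon> y) (FA F \<phi>))"
proof -
  have x: "x \<in> Obj C" and a: "\<alpha> \<in> hom C (FO G (FO F x)) x" using alg by (auto simp: Obj_EM)
  let ?T = "FO G (FO F x)" and ?e = "Comp D (\<epsilon> y) (FA F \<phi>)"
  have T: "?T \<in> Obj C" using x F.FO_Obj G.FO_Obj by blast
  have ex: "\<epsilon> (FO F x) \<in> hom D (FO F ?T) (FO F x)" using counit_hom[OF F.FO_Obj[OF x]] .
  have ey: "\<epsilon> y \<in> hom D (FO F (FO G y)) y" using counit_hom[OF y] .
  have Fp: "FA F \<phi> \<in> hom D (FO F x) (FO F (FO G y))" using F.FA_hom[OF p] .
  have e: "?e \<in> hom D (FO F x) y" using F.D.Comp_hom[OF Fp ey] .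
  have left: "Comp D (\<epsilon> y) (FA F (Comp C \<phi> \<alpha>)) = Comp D ?e (FA F \<alpha>)"
    using F.FA_Comp[OF a p] F.FA_hom[OF a] Fp ey by (simp add: hom_iff F.D.assoc)
  have right: "Comp D (\<epsilon> y) (FA F (Comp C (FA G (\<epsilon> y)) (FA G (FA F \<phi>)))) = Comp D ?e (\<epsilon> (FO F x))"
    using G.FA_Comp[OF Fp ey] counit_natural[OF e] by simp
  have *: "Comp C \<phi> \<alpha> = Comp C (FA G (\<epsilon> y)) (FA G (FA F \<phi>)) \<longleftrightarrow> Comp D ?e (\<epsilon> (FO F x)) = Comp D ?e (FA F \<alpha>)"
    using left right F.couniversal_unique[OF couniversal_counit[OF y] F.C.Comp_hom[OF a p]
        F.C.Comp_hom[OF G.FA_hom[OF Fp] G.FA_hom[OF ey]]] by auto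
  show ?thesis
    unfolding *
  proof
    assume eq: "Comp D ?e (\<epsilon> (FO F x)) = Comp D ?e (FA F \<alpha>)"
    show "coequalizes_algebra C D F x (\<lambda>w t. Comp C \<alpha> (adjunct w t)) ?e"
      unfolding coequalizes_algebra_def
    proof (intro ballI)
      fix w t assume w: "w \<in> Obj C" and t: "t \<in> hom D (FO F w) (FO F x)"
      have t': "adjunct w t \<in> hom C w ?T" "Comp D (\<epsilon> (FO F x)) (FA F (adjunct w t)) = t" using adjunct[OF w t] .
      have Ft': "FA F (adjunct w t) \<in> hom D (FO F w) (FO F ?T)" using F.FA_hom[OF t'(1)] .
      have "Comp D ?e t = Comp D (Comp D ?e (\<epsilon> (FO F x))) (FA F (adjunct w t))"
        using t'(2) e ex Ft' F.D.assoc[of "FA F (adjunct w t)" "\<epsilon> (FO F x)" ?e] by (simp add: hom_iff)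
      also have "\<dots> = Comp D ?e (Comp D (FA F \<alpha>) (FA F (adjunct w t)))"
        unfolding eq using e F.FA_hom[OF a] Ft' F.D.assoc[of "FA F (adjunct w t)" "FA F \<alpha>" ?e] by (simp add: hom_iff)
      finally show "Comp D ?e t = Comp D ?e (FA F (Comp C \<alpha> (adjunct w t)))"
        using F.FA_Comp[OF t'(1) a] by simp
    qed
  next
    assume "coequalizes_algebra C D F x (\<lambda>w t. Comp C \<alpha> (adjunct w t)) ?e"
    from this[unfolded coequalizes_algebra_def, rule_format, OF T ex]
    have "Comp D ?e (\<epsilon> (FO F x)) = Comp D ?e (FA F (Comp C \<alpha> (adjunct ?T (\<epsilon> (FO F x)))))" .
    moreover have "adjunct ?T (\<epsilon> (FO F x)) = Id C ?T"
      unfolding adjunct_def using triangle_right[OF F.FO_Obj[OF x]] .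
    ultimately show "Comp D ?e (\<epsilon> (FO F x)) = Comp D ?e (FA F \<alpha>)" using a by (simp add: hom_iff)
  qed
qed

text \<open>
  An isomorphism between \<open>x\<close> and \<open>G y\<close> is the same as a couniversal arrow
  \<open>e : F x \<rightarrow> y\<close>, and it is compatible with the structure maps exactly when \<open>e\<close>
  coequalizes the algebra.
\<close>

lemma isomorphic_comparison_iff:
  assumes alg: "(x, \<alpha>) \<in> Obj EM" and y: "y \<in> Obj D"
  shows "isomorphic EM (FO K y) (x, \<alpha>) \<longleftrightarrow>
    (\<exists>e. couniversal C D F x e y \<and> coequalizes_algebra C D F x (\<lambda>w t. Comp C \<alpha> (adjunct w t)) e)"
proof
  interpret EM: category EM by (rule category_EM)
  assume "isomorphic EM (FO K y) (x, \<alpha>)"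
  then obtain f g where f: "f \<in> hom EM (FO K y) (x, \<alpha>)" and g: "g \<in> hom EM (x, \<alpha>) (FO K y)"
    and gf: "Comp EM g f = Id EM (FO K y)" and fg: "Comp EM f g = Id EM (x, \<alpha>)"
    by (rule EM.isomorphicE)
  obtain \<psi> where \<psi>: "f = (FO K y, \<psi>, (x, \<alpha>))" "\<psi> \<in> hom C (FO G y) x"
    using f by (auto simp: K_simps(1) hom_EM)
  obtain \<phi> where \<phi>: "g = ((x, \<alpha>), \<phi>, FO K y)" "\<phi> \<in> hom C x (FO G y)"
    and eq: "Comp C \<phi> \<alpha> = Comp C (FA G (\<epsilon> y)) (FA G (FA F \<phi>))"
    using g by (auto simp: K_simps(1) hom_EM)
  have "Comp C \<phi> \<psi> = Id C (FO G y)" "Comp C \<psi> \<phi> = Id C x"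
    using gf fg \<phi>(1) \<psi>(1) by (simp_all add: EM_simps K_simps(1))
  then have "couniversal C D F x (Comp D (\<epsilon> y) (FA F \<phi>)) y"
    using F.couniversal_precomp_iso[OF couniversal_counit[OF y] \<phi>(2) \<psi>(2)] by blast
  moreover have "coequalizes_algebra C D F x (\<lambda>w t. Comp C \<alpha> (adjunct w t)) (Comp D (\<epsilon> y) (FA F \<phi>))"
    using EM_hom_iff_coequalizes[OF alg y \<phi>(2)] eq by blast
  ultimately show "\<exists>e. couniversal C D F x e y \<and>
      coequalizes_algebra C D F x (\<lambda>w t. Comp C \<alpha> (adjunct w t)) e" by blast
next
  interpret EM: category EM by (rule category_EM)
  assume "\<exists>e. couniversal C D F x e y \<and> coequalizes_algebra C D F x (\<lambda>w t. Comp C \<alpha> (adjunct w t)) e"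
  then obtain e where e: "couniversal C D F x e y"
    and coeq: "coequalizes_algebra C D F x (\<lambda>w t. Comp C \<alpha> (adjunct w t)) e" by blast
  obtain \<phi> \<psi> where \<phi>: "\<phi> \<in> hom C x (FO G y)" and \<psi>: "\<psi> \<in> hom C (FO G y) x"
    and inv: "Comp C \<psi> \<phi> = Id C x" "Comp C \<phi> \<psi> = Id C (FO G y)" and ep: "Comp D (\<epsilon> y) (FA F \<phi>) = e"
    using F.couniversal_iso[OF e couniversal_counit[OF y]] by metis
  have eq: "Comp C \<phi> \<alpha> = Comp C (FA G (\<epsilon> y)) (FA G (FA F \<phi>))"
    using EM_hom_iff_coequalizes[OF alg y \<phi>] coeq ep by simp
  have a: "\<alpha> \<in> hom C (FO G (FO F x)) x" using alg by (auto simp: Obj_EM)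
  have ey: "\<epsilon> y \<in> hom D (FO F (FO G y)) y" using counit_hom[OF y] .
  have TT: "Comp C (FA G (FA F \<phi>)) (FA G (FA F \<psi>)) = Id C (FO G (FO F (FO G y)))"
    using G.FA_Comp[OF F.FA_hom[OF \<psi>] F.FA_hom[OF \<phi>]] F.FA_Comp[OF \<psi> \<phi>] inv(2)
      F.FA_Id[OF G.FO_Obj[OF y]] G.FA_Id[OF F.FO_Obj[OF G.FO_Obj[OF y]]] by simp
  note in_hom = \<phi> \<psi> a ey
  have "Comp C \<psi> (FA G (\<epsilon> y)) = Comp C \<psi> (Comp C (FA G (\<epsilon> y)) (Comp C (FA G (FA F \<phi>)) (FA G (FA F \<psi>))))"
    unfolding TT using in_hom by (simp add: hom_iff)
  also have "\<dots> = Comp C \<psi> (Comp C (Comp C (FA G (\<epsilon> y)) (FA G (FA F \<phi>))) (FA G (FA F \<psi>)))"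
    using in_hom by (simp add: hom_iff F.C.assoc)
  also have "\<dots> = Comp C (Comp C \<psi> \<phi>) (Comp C \<alpha> (FA G (FA F \<psi>)))"
    unfolding eq[symmetric] using in_hom by (simp add: hom_iff F.C.assoc)
  also have "\<dots> = Comp C \<alpha> (FA G (FA F \<psi>))" unfolding inv(1) using in_hom by (simp add: hom_iff)
  finally have eq': "Comp C \<psi> (FA G (\<epsilon> y)) = Comp C \<alpha> (FA G (FA F \<psi>))" .
  show "isomorphic EM (FO K y) (x, \<alpha>)"
  proof (rule EM.isomorphicI)
    show "(FO K y, \<psi>, (x, \<alpha>)) \<in> hom EM (FO K y) (x, \<alpha>)"
      using eq' \<psi> alg counit_algebra[OF y] by (simp add: K_simps(1) hom_EM)
    show "((x, \<alpha>), \<phi>, FO K y) \<in> hom EM (x, \<alpha>) (FO K y)"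
      using eq \<phi> alg counit_algebra[OF y] by (simp add: K_simps(1) hom_EM)
  qed (simp_all add: EM_simps K_simps(1) inv)
qed

lemma comparison_essentially_surjective_iff:
  "cat_functor.essentially_surjective D EM K \<longleftrightarrow>
    (\<forall>x a. kleisli_algebra C D F x a \<longrightarrow>
      (\<exists>y e. couniversal C D F x e y \<and> coequalizes_algebra C D F x a e))"
proof -
  interpret K: cat_functor D EM K by (rule comparison_functor)
  show ?thesis
  proof
    assume es: "K.essentially_surjective"
    show "\<forall>x a. kleisli_algebra C D F x a \<longrightarrow>
      (\<exists>y e. couniversal C D F x e y \<and> coequalizes_algebra C D F x a e)"
    proof (intro allI impI)
      fix x a assume a: "kleisli_algebra C D F x a"
      let ?\<alpha> = "a (FO G (FO F x)) (\<epsilon> (FO F x))"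
      note alg = kleisli_algebra_structure[OF a]
      obtain y where y: "y \<in> Obj D" "isomorphic EM (FO K y) (x, ?\<alpha>)"
        using es alg(1) unfolding K.essentially_surjective_def by blast
      then obtain e where e: "couniversal C D F x e y"
        "coequalizes_algebra C D F x (\<lambda>w t. Comp C ?\<alpha> (adjunct w t)) e"
        using isomorphic_comparison_iff[OF alg(1) y(1)] by blast
      then have "coequalizes_algebra C D F x a e"
        unfolding coequalizes_algebra_def by (simp add: alg(2))
      then show "\<exists>y e. couniversal C D F x e y \<and> coequalizes_algebra C D F x a e" using e(1) by blast
    qed
  next
    assume *: "\<forall>x a. kleisli_algebra C D F x a \<longrightarrow>
      (\<exists>y e. couniversal C D F x e y \<and> coequalizes_algebra C D F x a e)"
    show "K.essentially_surjective"
      unfolding K.essentially_surjective_def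
    proof
      fix b assume b: "b \<in> Obj EM"
      obtain x \<alpha> where xa: "b = (x, \<alpha>)" by (cases b)
      then have alg: "(x, \<alpha>) \<in> Obj EM" using b by simp
      obtain y e where e: "couniversal C D F x e y"
        "coequalizes_algebra C D F x (\<lambda>w t. Comp C \<alpha> (adjunct w t)) e"
        using * kleisli_algebra_of_EM[OF alg] by blast
      then show "\<exists>y \<in> Obj D. isomorphic EM (FO K y) b"
        using isomorphic_comparison_iff[OF alg] F.couniversal_arrow(2)[OF e(1)] xa by blast
    qed
  qed
qed

theorem monadic_adjunction_iff:
  "monadic_adjunction C D F G \<eta> \<epsilon> \<longleftrightarrow> monadic_left_adjoint C D F"
proof -
  interpret K: cat_functor D EM K by (rule comparison_functor)
  have "monadic_adjunction C D F G \<eta> \<epsilon> \<longleftrightarrow> equivalence_functor D EM K"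
    unfolding monadic_adjunction_def using adjunction_axioms by blast
  also have "\<dots> \<longleftrightarrow> K.fully_faithful \<and> K.essentially_surjective"
    using K.equivalence_imp_fully_faithful_essentially_surjective
      K.fully_faithful_essentially_surjective_imp_equivalence by blast
  also have "K.fully_faithful \<longleftrightarrow> (\<forall>x e y. couniversal C D F x e y \<longrightarrow> quotient_arrow C D F x e y)"
    unfolding comparison_fully_faithful_iff
    using couniversal_counit F.quotient_arrow_iso F.couniversal_arrow(2) by blast
  finally show ?thesis
    unfolding monadic_left_adjoint_def comparison_essentially_surjective_iff
    using couniversal_counit by blast
qed

end

context cat_functor
begin

lemma adjunction_of_couniversal:
  assumes "\<forall>y \<in> Obj D. \<exists>x e. couniversal C D F x e y"
  shows "\<exists>G \<eta> \<epsilon>. adjunction C D F G \<eta> \<epsilon>"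
proof -
  have "\<exists>r e. \<forall>y \<in> Obj D. couniversal C D F (r y) (e y) y" using assms by metis
  then obtain r e where e: "\<And>y. y \<in> Obj D \<Longrightarrow> couniversal C D F (r y) (e y) y" by blast
  have r: "r y \<in> Obj C" and eh: "e y \<in> hom D (FO F (r y)) y" if "y \<in> Obj D" for y
    using couniversal_arrow[OF e[OF that]] by auto
  define adj where "adj w y t = (SOME u. u \<in> hom C w (r y) \<and> Comp D (e y) (FA F u) = t)" for w y t
  have adj: "adj w y t \<in> hom C w (r y)" "Comp D (e y) (FA F (adj w y t)) = t"
    if "w \<in> Obj C" "t \<in> hom D (FO F w) y" for w y t
  proof -
    have y: "y \<in> Obj D" using D.Obj_of_hom that(2) by blast
    have "\<exists>u. u \<in> hom C w (r y) \<and> Comp D (e y) (FA F u) = t"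
      using couniversal_factor[OF e[OF y] that] by metis
    then have "adj w y t \<in> hom C w (r y) \<and> Comp D (e y) (FA F (adj w y t)) = t"
      unfolding adj_def by (rule someI_ex)
    then show "adj w y t \<in> hom C w (r y)" "Comp D (e y) (FA F (adj w y t)) = t" by auto
  qed
  define G where "G = \<lparr>FO = r, FA = (\<lambda>h. adj (r (Dom D h)) (Cod D h) (Comp D h (e (Dom D h))))\<rparr>"
  define \<eta> where "\<eta> x = adj x (FO F x) (Id D (FO F x))" for x
  have GO [simp]: "FO G y = r y" for y by (simp add: G_def)
  have G: "FA G h \<in> hom C (r x) (r y)" "Comp D (e y) (FA F (FA G h)) = Comp D h (e x)"
    if h: "h \<in> hom D x y" for h x y
  proof -
    have x: "x \<in> Obj D" using D.Obj_of_hom h by blast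
    have "FA G h = adj (r x) y (Comp D h (e x))" using h by (simp add: G_def hom_iff)
    then show "FA G h \<in> hom C (r x) (r y)" "Comp D (e y) (FA F (FA G h)) = Comp D h (e x)"
      using adj[OF r[OF x] D.Comp_hom[OF eh[OF x] h]] by auto
  qed
  have eta: "\<eta> x \<in> hom C x (r (FO F x))" "Comp D (e (FO F x)) (FA F (\<eta> x)) = Id D (FO F x)"
    if x: "x \<in> Obj C" for x
    unfolding \<eta>_def using adj[OF x D.Id_hom[OF FO_Obj[OF x]]] .
  have Gf: "cat_functor D C G"
  proof (intro cat_functor.intro cat_functor_axioms.intro C.category_axioms D.category_axioms)
    show "FO G y \<in> Obj C" if "y \<in> Obj D" for y using r[OF that] by simp
    show "FA G h \<in> hom C (FO G x) (FO G y)" if "h \<in> hom D x y" for h x y using G(1)[OF that] by simp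
    show "FA G (Id D y) = Id C (FO G y)" if y: "y \<in> Obj D" for y
      by (rule couniversal_unique[OF e[OF y], of _ "r y"])
        (use G[OF D.Id_hom[OF y]] C.Id_hom[OF r[OF y]] eh[OF y] r[OF y] in \<open>auto simp: FA_Id hom_iff\<close>)
    show "FA G (Comp D k h) = Comp C (FA G k) (FA G h)" if h: "h \<in> hom D x y" and k: "k \<in> hom D y z" for h k x y z
    proof -
      have xyz: "x \<in> Obj D" "y \<in> Obj D" "z \<in> Obj D" using D.Obj_of_hom h k by blast+
      note in_hom = h k G(1)[OF h] G(1)[OF k] eh[OF xyz(1)] eh[OF xyz(2)] eh[OF xyz(3)]
      have "Comp D (e z) (FA F (Comp C (FA G k) (FA G h))) = Comp D (Comp D (e z) (FA F (FA G k))) (FA F (FA G h))"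
        using in_hom by (simp add: hom_iff FA_Comp_Arr D.assoc)
      also have "\<dots> = Comp D k (Comp D (e y) (FA F (FA G h)))"
        unfolding G(2)[OF k] using in_hom by (simp add: hom_iff D.assoc)
      also have "\<dots> = Comp D (Comp D k h) (e x)"
        unfolding G(2)[OF h] using in_hom by (simp add: hom_iff D.assoc)
      finally show ?thesis
        using couniversal_unique[OF e[OF xyz(3)] G(1)[OF D.Comp_hom[OF h k]] C.Comp_hom[OF G(1)[OF h] G(1)[OF k]]]
          G(2)[OF D.Comp_hom[OF h k]] by simp
    qed
  qed
  interpret G: cat_functor D C G by (rule Gf)
  note [simp] = id_ftor_def comp_ftor_def
  have "adjunction C D F G \<eta> e"
  proof (intro adjunction.intro adjunction_axioms.intro nat_trans.intro nat_trans_axioms.intro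
      cat_functor_id[OF C.category_axioms] cat_functor_id[OF D.category_axioms]
      cat_functor_comp[OF cat_functor_axioms Gf] cat_functor_comp[OF Gf cat_functor_axioms]
      Gf cat_functor_axioms)
    show "Comp C (\<eta> y) (FA id_ftor f) = Comp C (FA (comp_ftor G F) f) (\<eta> x)" if f: "f \<in> hom C x y" for f x y
    proof -
      have xy: "x \<in> Obj C" "y \<in> Obj C" using C.Obj_of_hom[OF f] .
      note in_hom = f FA_hom[OF f] G(1)[OF FA_hom[OF f]] eta(1)[OF xy(1)] eta(1)[OF xy(2)]
        eh[OF FO_Obj[OF xy(1)]] eh[OF FO_Obj[OF xy(2)]]
      have "Comp D (e (FO F y)) (FA F (Comp C (\<eta> y) f)) = Comp D (Comp D (e (FO F y)) (FA F (\<eta> y))) (FA F f)"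
        using in_hom by (simp add: hom_iff FA_Comp_Arr D.assoc)
      also have "\<dots> = Comp D (FA F f) (Comp D (e (FO F x)) (FA F (\<eta> x)))"
        unfolding eta(2)[OF xy(1)] eta(2)[OF xy(2)] using in_hom by (simp add: hom_iff)
      also have "\<dots> = Comp D (Comp D (e (FO F y)) (FA F (FA G (FA F f)))) (FA F (\<eta> x))"
        unfolding G(2)[OF FA_hom[OF f]] using in_hom by (simp add: hom_iff D.assoc)
      also have "\<dots> = Comp D (e (FO F y)) (FA F (Comp C (FA G (FA F f)) (\<eta> x)))"
        using in_hom by (simp add: hom_iff FA_Comp_Arr D.assoc)
      finally show ?thesis
        using couniversal_unique[OF e[OF FO_Obj[OF xy(2)]] C.Comp_hom[OF f eta(1)[OF xy(2)]]
          C.Comp_hom[OF eta(1)[OF xy(1)] G(1)[OF FA_hom[OF f]]]] by simp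
    qed
    show "Comp C (FA G (e y)) (\<eta> (FO G y)) = Id C (FO G y)" if y: "y \<in> Obj D" for y
    proof -
      have Fr: "FO F (r y) \<in> Obj D" using FO_Obj[OF r[OF y]] .
      note in_hom = eh[OF y] eh[OF Fr] G(1)[OF eh[OF y]] eta(1)[OF r[OF y]]
      have "Comp D (e y) (FA F (Comp C (FA G (e y)) (\<eta> (r y)))) =
          Comp D (Comp D (e y) (FA F (FA G (e y)))) (FA F (\<eta> (r y)))"
        using in_hom by (simp add: hom_iff FA_Comp_Arr D.assoc)
      also have "\<dots> = Comp D (e y) (Comp D (e (FO F (r y))) (FA F (\<eta> (r y))))"
        unfolding G(2)[OF eh[OF y]] using in_hom by (simp add: hom_iff D.assoc)
      also have "\<dots> = Comp D (e y) (FA F (Id C (r y)))"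
        unfolding eta(2)[OF r[OF y]] using FA_Id[OF r[OF y]] by simp
      finally show ?thesis
        using couniversal_unique[OF e[OF y] C.Comp_hom[OF eta(1)[OF r[OF y]] G(1)[OF eh[OF y]]] C.Id_hom[OF r[OF y]]]
        by simp
    qed
  qed (simp_all add: eta G eh)
  then show ?thesis by blast
qed

text \<open>
  By \<open>monadic_adjunction_iff\<close> every right adjoint serves equally well, and the first clause of
  \<open>monadic_left_adjoint\<close> provides one.
\<close>

theorem monadic_iff_left_adjoint:
  "(\<exists>G \<eta> \<epsilon>. monadic_adjunction C D F G \<eta> \<epsilon>) \<longleftrightarrow> monadic_left_adjoint C D F"
proof
  assume "\<exists>G \<eta> \<epsilon>. monadic_adjunction C D F G \<eta> \<epsilon>"
  then show "monadic_left_adjoint C D F"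
    using adjunction.monadic_adjunction_iff unfolding monadic_adjunction_def by blast
next
  assume m: "monadic_left_adjoint C D F"
  then obtain G \<eta> \<epsilon> where "adjunction C D F G \<eta> \<epsilon>"
    using adjunction_of_couniversal unfolding monadic_left_adjoint_def by blast
  then show "\<exists>G \<eta> \<epsilon>. monadic_adjunction C D F G \<eta> \<epsilon>"
    using m adjunction.monadic_adjunction_iff by blast
qed

end

section \<open>Restriction of monadicity to full subcategories\<close>

definition mono_arr :: "('o, 'm) cat \<Rightarrow> 'm \<Rightarrow> bool" where
  "mono_arr C k \<longleftrightarrow> (\<forall>w. \<forall>a \<in> hom C w (Dom C k). \<forall>b \<in> hom C w (Dom C k).
     Comp C k a = Comp C k b \<longrightarrow> a = b)"

text \<open>
  Up to equivalence \<open>C'\<close> and \<open>D'\<close> are full subcategories, through \<open>I\<close> and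
  \<open>K\<close>, to which \<open>F\<close> restricts as \<open>F'\<close>. The sieve condition says that an object
  of \<open>C\<close> whose image maps to an object of \<open>D'\<close> already lies in \<open>C'\<close>; it also
  puts the value at an object of \<open>D'\<close> of any right adjoint of \<open>F\<close> into \<open>C'\<close>.
  The last condition says that \<open>D'\<close> is coreflective in \<open>D\<close> with monic counit.
\<close>

locale monadic_restriction =
  F: cat_functor C D F + F': cat_functor C' D' F' + I: cat_functor C' C I + K: cat_functor D' D K
  for C :: "('o1, 'm1) cat" and D :: "('o2, 'm2) cat"
    and C' :: "('o3, 'm3) cat" and D' :: "('o4, 'm4) cat"
    and F :: "('o1, 'm1, 'o2, 'm2) ftor" and F' :: "('o3, 'm3, 'o4, 'm4) ftor"
    and I :: "('o3, 'm3, 'o1, 'm1) ftor" and K :: "('o4, 'm4, 'o2, 'm2) ftor" +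
  assumes I_ff: "I.fully_faithful" and K_ff: "K.fully_faithful"
    and FI_Obj: "x \<in> Obj C' \<Longrightarrow> FO F (FO I x) = FO K (FO F' x)"
    and FI_Arr: "u \<in> Arr C' \<Longrightarrow> FA F (FA I u) = FA K (FA F' u)"
    and sieve: "\<lbrakk>w \<in> Obj C; y \<in> Obj D'; t \<in> hom D (FO F w) (FO K y)\<rbrakk>
      \<Longrightarrow> \<exists>w' \<in> Obj C'. isomorphic C (FO I w') w"
    and coreflection: "z \<in> Obj D \<Longrightarrow> \<exists>y' \<in> Obj D'. \<exists>k \<in> hom D (FO K y') z. mono_arr D k \<and>
      (\<forall>v \<in> Obj D'. \<forall>t \<in> hom D (FO K v) z. \<exists>t' \<in> hom D (FO K v) (FO K y'). Comp D k t' = t)"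
begin

lemma reflects_couniversal:
  assumes x: "x \<in> Obj C'" and e: "e \<in> hom D' (FO F' x) y"
    and u: "couniversal C D F (FO I x) (FA K e) (FO K y)"
  shows "couniversal C' D' F' x e y"
proof -
  have y: "y \<in> Obj D'" using F'.D.Obj_of_hom e by blast
  have iff: "Comp D' e (FA F' v) = t \<longleftrightarrow> Comp D (FA K e) (FA F (FA I v)) = FA K t"
    if v: "v \<in> hom C' w x" and t: "t \<in> hom D' (FO F' w) y" for v w t
  proof -
    have "Comp D (FA K e) (FA F (FA I v)) = FA K (Comp D' e (FA F' v))"
      using FI_Arr[of v] v K.FA_Comp[OF F'.FA_hom[OF v] e] by (simp add: hom_iff)
    then show ?thesis using K.faithfulD[OF K_ff F'.D.Comp_hom[OF F'.FA_hom[OF v] e] t] by auto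
  qed
  show ?thesis
    unfolding couniversal_def
  proof (intro conjI ballI ex_ex1I x e)
    fix w t assume w: "w \<in> Obj C'" and t: "t \<in> hom D' (FO F' w) y"
    have "FA K t \<in> hom D (FO F (FO I w)) (FO K y)" using K.FA_hom[OF t] FI_Obj[OF w] by simp
    then obtain v where v: "v \<in> hom C (FO I w) (FO I x)" "Comp D (FA K e) (FA F v) = FA K t"
      using F.couniversal_factor[OF u I.FO_Obj[OF w]] by blast
    obtain v' where "v' \<in> hom C' w x" "FA I v' = v" using I.fully_faithfulD[OF I_ff w x v(1)] .
    then show "\<exists>u. u \<in> hom C' w x \<and> Comp D' e (FA F' u) = t" using iff t v(2) by blast
  next
    fix w t v v' assume t: "t \<in> hom D' (FO F' w) y" and "v \<in> hom C' w x \<and> Comp D' e (FA F' v) = t"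
      and "v' \<in> hom C' w x \<and> Comp D' e (FA F' v') = t"
    then have v: "v \<in> hom C' w x" "v' \<in> hom C' w x"
      and "Comp D (FA K e) (FA F (FA I v)) = FA K t" "Comp D (FA K e) (FA F (FA I v')) = FA K t"
      using iff by auto
    then have "FA I v = FA I v'"
      using F.couniversal_unique[OF u I.FA_hom[OF v(1)] I.FA_hom[OF v(2)]] by simp
    then show "v = v'" using I.faithfulD[OF I_ff v] by blast
  qed
qed

text \<open>
  The source of the couniversal arrow lies in \<open>C'\<close> by the sieve condition, so that it can be moved
  along an isomorphism to an object \<open>I x'\<close>.
\<close>

lemma couniversal_restricts:
  assumes u: "couniversal C D F x e (FO K y)" and y: "y \<in> Obj D'"
  obtains x' e' where "couniversal C' D' F' x' e' y" "couniversal C D F (FO I x') (FA K e') (FO K y)"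
proof -
  note x = F.couniversal_arrow[OF u]
  obtain x' where x': "x' \<in> Obj C'" "isomorphic C (FO I x') x" using sieve[OF x(1) y x(3)] by blast
  obtain i j where "i \<in> hom C (FO I x') x" "j \<in> hom C x (FO I x')"
    "Comp C j i = Id C (FO I x')" "Comp C i j = Id C x"
    using F.C.isomorphicE[OF x'(2)] .
  then have u': "couniversal C D F (FO I x') (Comp D e (FA F i)) (FO K y)"
    by (rule F.couniversal_precomp_iso[OF u])
  then have "Comp D e (FA F i) \<in> hom D (FO K (FO F' x')) (FO K y)"
    using F.couniversal_arrow(3)[OF u'] FI_Obj[OF x'(1)] by simp
  then obtain e' where e': "e' \<in> hom D' (FO F' x') y" "FA K e' = Comp D e (FA F i)"
    using K.fully_faithfulD[OF K_ff F'.FO_Obj[OF x'(1)] y] by blast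
  show ?thesis using that reflects_couniversal[OF x'(1) e'(1)] u' e'(2) by simp
qed

text \<open>
  Some couniversal arrow for \<open>F'\<close> at \<open>y\<close> has a couniversal image, namely the one obtained by
  restriction, and all others are isomorphic to it.
\<close>

lemma preserves_couniversal:
  assumes ex: "\<exists>x e. couniversal C D F x e (FO K y)"
    and u: "couniversal C' D' F' x e y"
  shows "couniversal C D F (FO I x) (FA K e) (FO K y)"
proof -
  note x = F'.couniversal_arrow[OF u]
  obtain x' e' where u': "couniversal C' D' F' x' e' y"
    and U': "couniversal C D F (FO I x') (FA K e') (FO K y)"
    using ex couniversal_restricts x(2) by metis
  obtain i j where i: "i \<in> hom C' x x'" and j: "j \<in> hom C' x' x"
    and ji: "Comp C' j i = Id C' x" and ij: "Comp C' i j = Id C' x'" and e: "Comp D' e' (FA F' i) = e"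
    using F'.couniversal_iso[OF u u'] by metis
  have "couniversal C D F (FO I x) (Comp D (FA K e') (FA F (FA I i))) (FO K y)"
    using F.couniversal_precomp_iso[OF U' I.FA_hom[OF i] I.FA_hom[OF j]]
      I.FA_Comp[OF i j] I.FA_Comp[OF j i] ji ij I.FA_Id x(1) F'.couniversal_arrow(1)[OF u'] by simp
  moreover have "Comp D (FA K e') (FA F (FA I i)) = FA K e"
    using FI_Arr[of i] i e K.FA_Comp[OF F'.FA_hom[OF i] F'.couniversal_arrow(3)[OF u']]
    by (simp add: hom_iff)
  ultimately show ?thesis by simp
qed

text \<open>
  The kernel of \<open>K e\<close> is tested on all objects of \<open>C\<close>, that of \<open>e\<close> only on objects
  of \<open>C'\<close>. The sieve condition closes the gap: an object of \<open>C\<close> that admits a test arrow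
  into \<open>K (F' x)\<close> is isomorphic to one from \<open>C'\<close>.
\<close>

lemma respects_kernel_transfer:
  assumes x: "x \<in> Obj C'" and e: "e \<in> hom D' (FO F' x) y" and s: "s \<in> hom D' (FO F' x) z"
    and rk: "respects_kernel C' D' F' x e s"
  shows "respects_kernel C D F (FO I x) (FA K e) (FA K s)"
  unfolding respects_kernel_def
proof (intro ballI impI)
  fix w a b assume w: "w \<in> Obj C" and a: "a \<in> hom D (FO F w) (FO F (FO I x))"
    and b: "b \<in> hom D (FO F w) (FO F (FO I x))" and eq: "Comp D (FA K e) a = Comp D (FA K e) b"
  have Fx: "FO F' x \<in> Obj D'" using F'.FO_Obj[OF x] .
  have a0: "a \<in> hom D (FO F w) (FO K (FO F' x))" and b0: "b \<in> hom D (FO F w) (FO K (FO F' x))"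
    using a b FI_Obj[OF x] by auto
  obtain w' where w': "w' \<in> Obj C'" "isomorphic C (FO I w') w" using sieve[OF w Fx a0] by blast
  obtain i j where i: "i \<in> hom C (FO I w') w" and j: "j \<in> hom C w (FO I w')" and ij: "Comp C i j = Id C w"
    using F.C.isomorphicE[OF w'(2)] by metis
  have Fi: "FA F i \<in> hom D (FO K (FO F' w')) (FO F w)" using F.FA_hom[OF i] FI_Obj[OF w'(1)] by simp
  have Fij: "Comp D (FA F i) (FA F j) = Id D (FO F w)" using F.FA_Comp[OF j i] ij F.FA_Id[OF w] by simp
  obtain a' where a': "a' \<in> hom D' (FO F' w') (FO F' x)" "FA K a' = Comp D a (FA F i)"
    using K.fully_faithfulD[OF K_ff F'.FO_Obj[OF w'(1)] Fx F.D.Comp_hom[OF Fi a0]] .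
  obtain b' where b': "b' \<in> hom D' (FO F' w') (FO F' x)" "FA K b' = Comp D b (FA F i)"
    using K.fully_faithfulD[OF K_ff F'.FO_Obj[OF w'(1)] Fx F.D.Comp_hom[OF Fi b0]] .
  note in_hom = a0 b0 Fi K.FA_hom[OF e] K.FA_hom[OF s] F.FA_hom[OF j]
  have "FA K (Comp D' e a') = Comp D (Comp D (FA K e) a) (FA F i)"
    using K.FA_Comp[OF a'(1) e] a'(2) in_hom by (simp add: hom_iff F.D.assoc)
  also have "\<dots> = FA K (Comp D' e b')"
    unfolding eq using K.FA_Comp[OF b'(1) e] b'(2) in_hom by (simp add: hom_iff F.D.assoc)
  finally have "Comp D' e a' = Comp D' e b'"
    using K.faithfulD[OF K_ff F'.D.Comp_hom[OF a'(1) e] F'.D.Comp_hom[OF b'(1) e]] by blast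
  then have "Comp D' s a' = Comp D' s b'"
    using rk w'(1) a'(1) b'(1) unfolding respects_kernel_def by blast
  then have "Comp D (FA K s) (Comp D a (FA F i)) = Comp D (FA K s) (Comp D b (FA F i))"
    using K.FA_Comp[OF a'(1) s] K.FA_Comp[OF b'(1) s] a'(2) b'(2) by simp
  then have "Comp D (Comp D (FA K s) (Comp D a (FA F i))) (FA F j) = Comp D (Comp D (FA K s) (Comp D b (FA F i))) (FA F j)"
    by simp
  then show "Comp D (FA K s) a = Comp D (FA K s) b"
    using in_hom Fij FI_Obj[OF w'(1)] by (simp add: hom_iff F.D.assoc)
qed

text \<open>
  A quotient, along a couniversal arrow, of an object of \<open>D'\<close> lies in \<open>D'\<close>. Let
  \<open>k : K y' \<rightarrow> y\<close> be the coreflection of \<open>y\<close>. The couniversal arrow \<open>e\<close> starts in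
  \<open>D'\<close>, so it factors as \<open>k \<cdot> e1\<close>. Because \<open>k\<close> is monic, \<open>e1\<close> has the
  same kernel as \<open>e\<close> and hence factors as \<open>l \<cdot> e\<close>, as \<open>e\<close> is a quotient. Then
  \<open>k \<cdot> l\<close> is the identity because \<open>e\<close> is epic on arrows out of \<open>y\<close>, and
  \<open>l \<cdot> k\<close> is the identity because \<open>k\<close> is monic.
\<close>

lemma quotient_of_restricted_object:
  assumes quot: "\<And>x e y. couniversal C D F x e y \<Longrightarrow> quotient_arrow C D F x e y"
    and x: "x \<in> Obj C'" and u: "couniversal C D F (FO I x) e y"
  shows "\<exists>y' \<in> Obj D'. isomorphic D y (FO K y')"
proof -
  note y = F.couniversal_arrow[OF u]
  have e: "e \<in> hom D (FO K (FO F' x)) y" using y(3) FI_Obj[OF x] by simp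
  obtain y' k where y': "y' \<in> Obj D'" and k: "k \<in> hom D (FO K y') y" and mono: "mono_arr D k"
    and factor: "\<And>z t. \<lbrakk>z \<in> Obj D'; t \<in> hom D (FO K z) y\<rbrakk>
      \<Longrightarrow> \<exists>t' \<in> hom D (FO K z) (FO K y'). Comp D k t' = t"
    using coreflection[OF y(2)] by blast
  have cancel: "a = b" if "a \<in> hom D w (FO K y')" "b \<in> hom D w (FO K y')" "Comp D k a = Comp D k b" for a b w
    using mono[unfolded mono_arr_def, rule_format, of a w b] that k by (simp add: hom_iff)
  obtain e1 where e1: "e1 \<in> hom D (FO F (FO I x)) (FO K y')" "Comp D k e1 = e"
    using factor[OF F'.FO_Obj[OF x] e] FI_Obj[OF x] by auto
  have "respects_kernel C D F (FO I x) e e1"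
    unfolding respects_kernel_def
  proof (intro ballI impI)
    fix w a b assume a: "a \<in> hom D (FO F w) (FO F (FO I x))" and b: "b \<in> hom D (FO F w) (FO F (FO I x))"
      and eq: "Comp D e a = Comp D e b"
    have "Comp D k (Comp D e1 a) = Comp D k (Comp D e1 b)"
      using eq e1 k a b F.D.assoc[of a e1 k] F.D.assoc[of b e1 k] by (simp add: hom_iff)
    then show "Comp D e1 a = Comp D e1 b"
      using cancel F.D.Comp_hom[OF a e1(1)] F.D.Comp_hom[OF b e1(1)] by blast
  qed
  then obtain l where l: "l \<in> hom D y (FO K y')" "Comp D l e = e1"
    using quot[OF u] e1(1) unfolding quotient_arrow_def by blast
  have kl: "Comp D k l \<in> hom D y y" using F.D.Comp_hom[OF l(1) k] .
  have "respects_kernel C D F (FO I x) e e" unfolding respects_kernel_def by simp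
  then have ex1: "\<exists>!m. m \<in> hom D y y \<and> Comp D m e = e"
    using quot[OF u] y(3) unfolding quotient_arrow_def by blast
  have "Comp D (Comp D k l) e = e" using l e1(2) k y(3) by (simp add: hom_iff F.D.assoc)
  then have kl_id: "Comp D k l = Id D y"
    using ex1 kl F.D.Id_hom[OF y(2)] F.D.Comp_Id_left[OF y(3)] by metis
  have "Comp D k (Comp D l k) = Comp D (Comp D k l) k" using k l by (simp add: hom_iff F.D.assoc)
  then have "Comp D l k = Id D (FO K y')"
    using kl_id cancel[OF F.D.Comp_hom[OF k l(1)] F.D.Id_hom[OF K.FO_Obj[OF y']]] k by (simp add: hom_iff)
  then show ?thesis using F.D.isomorphicI[OF l(1) k kl_id] y' by blast
qed

text \<open>
  An object \<open>w\<close> of \<open>C\<close> for which there is an arrow \<open>F w \<rightarrow> F (I x)\<close> at all is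
  isomorphic to some \<open>I (W w)\<close>, by the sieve condition. The algebra is extended to \<open>w\<close> by
  transport along a chosen isomorphism.
\<close>

lemma kleisli_algebra_extends:
  assumes a: "kleisli_algebra C' D' F' x a"
  obtains b where "kleisli_algebra C D F (FO I x) b"
    and "\<And>w t. \<lbrakk>w \<in> Obj C'; t \<in> hom D' (FO F' w) (FO F' x)\<rbrakk> \<Longrightarrow> b (FO I w) (FA K t) = FA I (a w t)"
proof -
  have x: "x \<in> Obj C'" using a unfolding kleisli_algebra_def by blast
  have Fx: "FO F' x \<in> Obj D'" using F'.FO_Obj[OF x] .
  have hom: "a w t \<in> hom C' w x" if "w \<in> Obj C'" "t \<in> hom D' (FO F' w) (FO F' x)" for w t
    using a that unfolding kleisli_algebra_def by blast
  have retr: "a w (FA F' u) = u" if "w \<in> Obj C'" "u \<in> hom C' w x" for w u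
    using a that unfolding kleisli_algebra_def by blast
  have mult: "a w' (Comp D' v t) = a w' (Comp D' (FA F' (a w v)) t)"
    if "w \<in> Obj C'" "w' \<in> Obj C'" "v \<in> hom D' (FO F' w) (FO F' x)" "t \<in> hom D' (FO F' w') (FO F' w)" for w w' v t
    using a that unfolding kleisli_algebra_def by blast
  have "\<forall>w. \<exists>w' i j. w \<in> Obj C \<longrightarrow> hom D (FO F w) (FO K (FO F' x)) \<noteq> {} \<longrightarrow> w' \<in> Obj C' \<and>
      i \<in> hom C (FO I w') w \<and> j \<in> hom C w (FO I w') \<and> Comp C i j = Id C w"
    using sieve[OF _ Fx] F.C.isomorphicE by (metis ex_in_conv)
  then obtain W i j where WIJ: "\<And>w. \<lbrakk>w \<in> Obj C; hom D (FO F w) (FO K (FO F' x)) \<noteq> {}\<rbrakk> \<Longrightarrow>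
      W w \<in> Obj C' \<and> i w \<in> hom C (FO I (W w)) w \<and> j w \<in> hom C w (FO I (W w)) \<and>
      Comp C (i w) (j w) = Id C w"
    by metis
  define pre where "pre w t = (SOME t'. t' \<in> hom D' (FO F' (W w)) (FO F' x) \<and> FA K t' = Comp D t (FA F (i w)))" for w t
  define b where "b w t = Comp C (FA I (a (W w) (pre w t))) (j w)" for w t
  have FIx: "FO F (FO I x) = FO K (FO F' x)" using FI_Obj[OF x] .
  have W: "W w \<in> Obj C'" and i: "i w \<in> hom C (FO I (W w)) w" and j: "j w \<in> hom C w (FO I (W w))"
    and ij: "Comp C (i w) (j w) = Id C w"
    and Fi: "FA F (i w) \<in> hom D (FO K (FO F' (W w))) (FO F w)"
    and pre: "pre w t \<in> hom D' (FO F' (W w)) (FO F' x)" "FA K (pre w t) = Comp D t (FA F (i w))"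
    if w: "w \<in> Obj C" and t: "t \<in> hom D (FO F w) (FO F (FO I x))" for w t
  proof -
    have t': "t \<in> hom D (FO F w) (FO K (FO F' x))" using t FIx by simp
    then have *: "W w \<in> Obj C'" "i w \<in> hom C (FO I (W w)) w" "j w \<in> hom C w (FO I (W w))"
      "Comp C (i w) (j w) = Id C w" using WIJ[OF w] by auto
    then show "W w \<in> Obj C'" "i w \<in> hom C (FO I (W w)) w" "j w \<in> hom C w (FO I (W w))"
      "Comp C (i w) (j w) = Id C w" by auto
    show Fi: "FA F (i w) \<in> hom D (FO K (FO F' (W w))) (FO F w)"
      using F.FA_hom[OF *(2)] FI_Obj[OF *(1)] by simp
    have "\<exists>t'. t' \<in> hom D' (FO F' (W w)) (FO F' x) \<and> FA K t' = Comp D t (FA F (i w))"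
      using K.fully_faithfulD[OF K_ff F'.FO_Obj[OF *(1)] Fx F.D.Comp_hom[OF Fi t']] by metis
    then have "pre w t \<in> hom D' (FO F' (W w)) (FO F' x) \<and> FA K (pre w t) = Comp D t (FA F (i w))"
      unfolding pre_def by (rule someI_ex)
    then show "pre w t \<in> hom D' (FO F' (W w)) (FO F' x)" "FA K (pre w t) = Comp D t (FA F (i w))" by auto
  qed
  have pre_eq: "pre w t = t'"
    if "w \<in> Obj C" "t \<in> hom D (FO F w) (FO F (FO I x))" "t' \<in> hom D' (FO F' (W w)) (FO F' x)"
      "FA K t' = Comp D t (FA F (i w))" for w t t'
    using K.faithfulD[OF K_ff pre(1)[OF that(1,2)] that(3)] pre(2)[OF that(1,2)] that(4) by simp
  have b_hom: "b w t \<in> hom C w (FO I x)" if "w \<in> Obj C" "t \<in> hom D (FO F w) (FO F (FO I x))" for w t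
    unfolding b_def using F.C.Comp_hom[OF j[OF that] I.FA_hom[OF hom[OF W[OF that] pre(1)[OF that]]]] .
  have b_alg: "kleisli_algebra C D F (FO I x) b"
    unfolding kleisli_algebra_def
  proof (intro conjI ballI I.FO_Obj[OF x])
    show "b w t \<in> hom C w (FO I x)" if "w \<in> Obj C" "t \<in> hom D (FO F w) (FO F (FO I x))" for w t
      using b_hom[OF that] .
    show "b w (FA F u) = u" if w: "w \<in> Obj C" and u: "u \<in> hom C w (FO I x)" for w u
    proof -
      have t: "FA F u \<in> hom D (FO F w) (FO F (FO I x))" using F.FA_hom[OF u] .
      note iw = i[OF w t] and jw = j[OF w t]
      obtain u' where u': "u' \<in> hom C' (W w) x" "FA I u' = Comp C u (i w)"
        using I.fully_faithfulD[OF I_ff W[OF w t] x F.C.Comp_hom[OF iw u]] .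
      have "FA K (FA F' u') = Comp D (FA F u) (FA F (i w))"
        using FI_Arr[of u'] u' F.FA_Comp[OF iw u] by (simp add: hom_iff)
      then have "pre w (FA F u) = FA F' u'" using pre_eq[OF w t F'.FA_hom[OF u'(1)]] by blast
      then have "b w (FA F u) = Comp C (Comp C u (i w)) (j w)"
        unfolding b_def using retr[OF W[OF w t] u'(1)] u'(2) by simp
      then show ?thesis using iw jw u ij[OF w t] by (simp add: hom_iff F.C.assoc)
    qed
    fix w w' v t assume w: "w \<in> Obj C" and w': "w' \<in> Obj C" and v: "v \<in> hom D (FO F w) (FO F (FO I x))"
      and t: "t \<in> hom D (FO F w') (FO F w)"
    have vt: "Comp D v t \<in> hom D (FO F w') (FO F (FO I x))" using F.D.Comp_hom[OF t v] .
    have bv: "FA F (b w v) \<in> hom D (FO F w) (FO F (FO I x))" using F.FA_hom[OF b_hom[OF w v]] .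
    have bvt: "Comp D (FA F (b w v)) t \<in> hom D (FO F w') (FO F (FO I x))" using F.D.Comp_hom[OF t bv] .
    note Fiw = Fi[OF w v] and Fiw' = Fi[OF w' vt]
    have Fjw: "FA F (j w) \<in> hom D (FO F w) (FO K (FO F' (W w)))"
      using F.FA_hom[OF j[OF w v]] FI_Obj[OF W[OF w v]] by simp
    have Fij: "Comp D (FA F (i w)) (FA F (j w)) = Id D (FO F w)"
      using F.FA_Comp[OF j[OF w v] i[OF w v]] ij[OF w v] F.FA_Id[OF w] by simp
    \<comment> \<open>The arrow \<open>t\<close> read through the chosen isomorphisms.\<close>
    have "Comp D (FA F (j w)) (Comp D t (FA F (i w'))) \<in> hom D (FO K (FO F' (W w'))) (FO K (FO F' (W w)))"
      using F.D.Comp_hom[OF F.D.Comp_hom[OF Fiw' t] Fjw] .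
    then obtain t' where t': "t' \<in> hom D' (FO F' (W w')) (FO F' (W w))"
      "FA K t' = Comp D (FA F (j w)) (Comp D t (FA F (i w')))"
      using K.fully_faithfulD[OF K_ff F'.FO_Obj[OF W[OF w' vt]] F'.FO_Obj[OF W[OF w v]]] by blast
    let ?v' = "pre w v"
    let ?av = "a (W w) ?v'"
    have v': "?v' \<in> hom D' (FO F' (W w)) (FO F' x)" "FA K ?v' = Comp D v (FA F (i w))" using pre[OF w v] .
    have av: "?av \<in> hom C' (W w) x" using hom[OF W[OF w v] v'(1)] .
    note in_hom = v t Fiw Fiw' Fjw FIx
    have "FA K (Comp D' ?v' t') = Comp D (Comp D v (FA F (i w))) (Comp D (FA F (j w)) (Comp D t (FA F (i w'))))"
      using K.FA_Comp[OF t'(1) v'(1)] t'(2) v'(2) by simp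
    also have "\<dots> = Comp D v (Comp D (Comp D (FA F (i w)) (FA F (j w))) (Comp D t (FA F (i w'))))"
      using in_hom by (simp add: hom_iff F.D.assoc)
    also have "\<dots> = Comp D (Comp D v t) (FA F (i w'))"
      unfolding Fij using in_hom by (simp add: hom_iff F.D.assoc)
    finally have 1: "pre w' (Comp D v t) = Comp D' ?v' t'"
      using pre_eq[OF w' vt F'.D.Comp_hom[OF t'(1) v'(1)]] by blast
    have IA: "FA F (FA I ?av) = FA K (FA F' ?av)" using FI_Arr[of ?av] av by (simp add: hom_iff)
    have KA: "FA K (FA F' ?av) \<in> hom D (FO K (FO F' (W w))) (FO K (FO F' x))"
      using K.FA_hom[OF F'.FA_hom[OF av]] .
    have "FA K (Comp D' (FA F' ?av) t') = Comp D (FA K (FA F' ?av)) (Comp D (FA F (j w)) (Comp D t (FA F (i w'))))"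
      using K.FA_Comp[OF t'(1) F'.FA_hom[OF av]] t'(2) by simp
    also have "\<dots> = Comp D (Comp D (Comp D (FA K (FA F' ?av)) (FA F (j w))) t) (FA F (i w'))"
      using in_hom KA by (simp add: hom_iff F.D.assoc)
    also have "Comp D (FA K (FA F' ?av)) (FA F (j w)) = FA F (b w v)"
      unfolding b_def using F.FA_Comp[OF j[OF w v] I.FA_hom[OF av]] IA by simp
    finally have 2: "pre w' (Comp D (FA F (b w v)) t) = Comp D' (FA F' ?av) t'"
      using pre_eq[OF w' bvt F'.D.Comp_hom[OF t'(1) F'.FA_hom[OF av]]] by blast
    show "b w' (Comp D v t) = b w' (Comp D (FA F (b w v)) t)"
      using mult[OF W[OF w v] W[OF w' vt] v'(1) t'(1)] unfolding b_def[of w'] 1 2 by simp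
  qed
  have "b (FO I w) (FA K t) = FA I (a w t)" if w: "w \<in> Obj C'" and t: "t \<in> hom D' (FO F' w) (FO F' x)" for w t
  proof -
    let ?w = "FO I w"
    have w': "?w \<in> Obj C" using I.FO_Obj[OF w] .
    have Kt: "FA K t \<in> hom D (FO F ?w) (FO F (FO I x))" using K.FA_hom[OF t] FI_Obj[OF w] FIx by simp
    note Ww = W[OF w' Kt] and iw = i[OF w' Kt] and jw = j[OF w' Kt]
    obtain i' where i': "i' \<in> hom C' (W ?w) w" "FA I i' = i ?w" using I.fully_faithfulD[OF I_ff Ww w iw] .
    have aw: "a w t \<in> hom C' w x" using hom[OF w t] .
    have "FA K (Comp D' t (FA F' i')) = Comp D (FA K t) (FA F (i ?w))"
      using K.FA_Comp[OF F'.FA_hom[OF i'(1)] t] FI_Arr[of i'] i' by (simp add: hom_iff)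
    then have "pre ?w (FA K t) = Comp D' t (FA F' i')"
      using pre_eq[OF w' Kt F'.D.Comp_hom[OF F'.FA_hom[OF i'(1)] t]] by blast
    moreover have "a (W ?w) (Comp D' t (FA F' i')) = Comp C' (a w t) i'"
      using mult[OF w Ww t F'.FA_hom[OF i'(1)]] F'.FA_Comp[OF i'(1) aw] retr[OF Ww F'.C.Comp_hom[OF i'(1) aw]]
      by simp
    ultimately have "b ?w (FA K t) = Comp C (Comp C (FA I (a w t)) (i ?w)) (j ?w)"
      unfolding b_def using I.FA_Comp[OF i'(1) aw] i'(2) by simp
    then show ?thesis using I.FA_hom[OF aw] iw jw ij[OF w' Kt] by (simp add: hom_iff F.C.assoc)
  qed
  then show ?thesis using that b_alg by blast
qed

text \<open>
  The first two clauses for \<open>F'\<close> are read off from those for \<open>F\<close>. For the third, an algebra is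
  extended to \<open>C\<close> and realized there by some \<open>y\<close>; as a quotient of an object from
  \<open>D'\<close>, this \<open>y\<close> lies in \<open>D'\<close>.
\<close>

theorem monadic_left_adjoint_restricts:
  assumes m: "monadic_left_adjoint C D F"
  shows "monadic_left_adjoint C' D' F'"
proof -
  have ex: "\<And>y. y \<in> Obj D \<Longrightarrow> \<exists>x e. couniversal C D F x e y"
    and quot: "\<And>x e y. couniversal C D F x e y \<Longrightarrow> quotient_arrow C D F x e y"
    and alg: "\<And>x a. kleisli_algebra C D F x a \<Longrightarrow>
        \<exists>y e. couniversal C D F x e y \<and> coequalizes_algebra C D F x a e"
    using m unfolding monadic_left_adjoint_def by blast+
  show ?thesis
    unfolding monadic_left_adjoint_def
  proof (intro conjI ballI allI impI)
    fix y assume y: "y \<in> Obj D'"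
    then show "\<exists>x e. couniversal C' D' F' x e y"
      using ex[OF K.FO_Obj] couniversal_restricts by metis
  next
    fix x e y assume u: "couniversal C' D' F' x e y"
    note x = F'.couniversal_arrow[OF u]
    have U: "couniversal C D F (FO I x) (FA K e) (FO K y)"
      using preserves_couniversal[OF ex[OF K.FO_Obj[OF x(2)]] u] .
    show "quotient_arrow C' D' F' x e y"
      unfolding quotient_arrow_def
    proof (intro allI ballI impI)
      fix z s assume s: "s \<in> hom D' (FO F' x) z" and rk: "respects_kernel C' D' F' x e s"
      have z: "z \<in> Obj D'" using F'.D.Obj_of_hom s by blast
      have "FA K s \<in> hom D (FO F (FO I x)) (FO K z)" using K.FA_hom[OF s] FI_Obj[OF x(1)] by simp
      then have ex1: "\<exists>!k. k \<in> hom D (FO K y) (FO K z) \<and> Comp D k (FA K e) = FA K s"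
        using quot[OF U] respects_kernel_transfer[OF x(1,3) s rk] unfolding quotient_arrow_def by blast
      have iff: "Comp D' k e = s \<longleftrightarrow> Comp D (FA K k) (FA K e) = FA K s" if "k \<in> hom D' y z" for k
        using K.FA_Comp[OF x(3) that] K.faithfulD[OF K_ff F'.D.Comp_hom[OF x(3) that] s] by auto
      show "\<exists>!k. k \<in> hom D' y z \<and> Comp D' k e = s"
      proof (rule ex_ex1I)
        obtain k where k: "k \<in> hom D (FO K y) (FO K z)" "Comp D k (FA K e) = FA K s" using ex1 by blast
        obtain k' where "k' \<in> hom D' y z" "FA K k' = k" using K.fully_faithfulD[OF K_ff x(2) z k(1)] .
        then show "\<exists>k. k \<in> hom D' y z \<and> Comp D' k e = s" using iff k(2) by blast
      next
        fix k l assume "k \<in> hom D' y z \<and> Comp D' k e = s" "l \<in> hom D' y z \<and> Comp D' l e = s"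
        then have kl: "k \<in> hom D' y z" "l \<in> hom D' y z" "Comp D (FA K k) (FA K e) = FA K s"
          "Comp D (FA K l) (FA K e) = FA K s" using iff by auto
        then have "FA K k = FA K l" using ex1 K.FA_hom[OF kl(1)] K.FA_hom[OF kl(2)] by blast
        then show "k = l" using K.faithfulD[OF K_ff kl(1,2)] by blast
      qed
    qed
  next
    fix x a assume a: "kleisli_algebra C' D' F' x a"
    have x: "x \<in> Obj C'" and hom: "\<And>w t. \<lbrakk>w \<in> Obj C'; t \<in> hom D' (FO F' w) (FO F' x)\<rbrakk> \<Longrightarrow> a w t \<in> hom C' w x"
      using a unfolding kleisli_algebra_def by blast+
    obtain b where b: "kleisli_algebra C D F (FO I x) b"
      and ba: "\<And>w t. \<lbrakk>w \<in> Obj C'; t \<in> hom D' (FO F' w) (FO F' x)\<rbrakk> \<Longrightarrow> b (FO I w) (FA K t) = FA I (a w t)"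
      using kleisli_algebra_extends[OF a] by blast
    obtain y e where u: "couniversal C D F (FO I x) e y" and co: "coequalizes_algebra C D F (FO I x) b e"
      using alg[OF b] by blast
    note y = F.couniversal_arrow[OF u]
    obtain y' i j where y': "y' \<in> Obj D'" and i: "i \<in> hom D y (FO K y')" and j: "j \<in> hom D (FO K y') y"
      and ji: "Comp D j i = Id D y" and ij: "Comp D i j = Id D (FO K y')"
      using quotient_of_restricted_object[OF quot x u] F.D.isomorphicE by metis
    have u1: "couniversal C D F (FO I x) (Comp D i e) (FO K y')"
      using F.couniversal_postcomp_iso[OF u i j ji ij] .
    have "Comp D i e \<in> hom D (FO K (FO F' x)) (FO K y')"
      using F.couniversal_arrow(3)[OF u1] FI_Obj[OF x] by simp
    then obtain e' where e': "e' \<in> hom D' (FO F' x) y'" "FA K e' = Comp D i e"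
      using K.fully_faithfulD[OF K_ff F'.FO_Obj[OF x] y'] by blast
    have "couniversal C' D' F' x e' y'" using reflects_couniversal[OF x e'(1)] u1 e'(2) by simp
    moreover have "coequalizes_algebra C' D' F' x a e'"
      unfolding coequalizes_algebra_def
    proof (intro ballI)
      fix w t assume w: "w \<in> Obj C'" and t: "t \<in> hom D' (FO F' w) (FO F' x)"
      have aw: "a w t \<in> hom C' w x" using hom[OF w t] .
      have Kt: "FA K t \<in> hom D (FO F (FO I w)) (FO F (FO I x))"
        using K.FA_hom[OF t] FI_Obj[OF w] FI_Obj[OF x] by simp
      have KA: "FA F (FA I (a w t)) \<in> hom D (FO F (FO I w)) (FO F (FO I x))" using F.FA_hom[OF I.FA_hom[OF aw]] .
      have eq: "Comp D e (FA K t) = Comp D e (FA F (FA I (a w t)))"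
        using co[unfolded coequalizes_algebra_def, rule_format, OF I.FO_Obj[OF w] Kt] ba[OF w t] by simp
      have "FA K (Comp D' e' t) = Comp D i (Comp D e (FA K t))"
        using K.FA_Comp[OF t e'(1)] e'(2) i y(3) Kt by (simp add: hom_iff F.D.assoc)
      also have "\<dots> = Comp D (FA K e') (FA F (FA I (a w t)))"
        unfolding eq using e'(2) i y(3) KA by (simp add: hom_iff F.D.assoc)
      also have "\<dots> = FA K (Comp D' e' (FA F' (a w t)))"
        using FI_Arr[of "a w t"] aw K.FA_Comp[OF F'.FA_hom[OF aw] e'(1)] by (simp add: hom_iff)
      finally show "Comp D' e' t = Comp D' e' (FA F' (a w t))"
        using K.faithfulD[OF K_ff F'.D.Comp_hom[OF t e'(1)] F'.D.Comp_hom[OF F'.FA_hom[OF aw] e'(1)]] by blast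
    qed
    ultimately show "\<exists>y e. couniversal C' D' F' x e y \<and> coequalizes_algebra C' D' F' x a e" by blast
  qed
qed

end

section \<open>Slices and effective descent\<close>

lemma hom_slice:
  "hom (slice C b) f g = {(f, h, g) | h. f \<in> Arr C \<and> Cod C f = b \<and> g \<in> Arr C \<and> Cod C g = b \<and>
     h \<in> hom C (Dom C f) (Dom C g) \<and> Comp C g h = f}"
  by (auto simp: slice_def hom_def)

lemma slice_simps [simp]:
  "f \<in> Obj (slice C b) \<longleftrightarrow> f \<in> Arr C \<and> Cod C f = b"
  "Id (slice C b) f = (f, Id C (Dom C f), f)"
  "Comp (slice C b) (g, k, l) (f, h, g') = (f, Comp C k h, l)"
  by (simp_all add: slice_def)

context category
begin

lemma category_slice: "category (slice C b)"
proof
  fix f assume "f \<in> Arr (slice C b)"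
  then show "Dom (slice C b) f \<in> Obj (slice C b)" "Cod (slice C b) f \<in> Obj (slice C b)"
    by (auto simp: slice_def)
next
  fix f assume "f \<in> Obj (slice C b)"
  then show "Id (slice C b) f \<in> hom (slice C b) f f" by (simp add: hom_slice hom_iff Dom_Obj)
next
  fix f g h s t assume "s \<in> hom (slice C b) f g" "t \<in> hom (slice C b) g h"
  then obtain k l where s: "s = (f, k, g)" "k \<in> hom C (Dom C f) (Dom C g)" "Comp C g k = f"
    and t: "t = (g, l, h)" "l \<in> hom C (Dom C g) (Dom C h)" "Comp C h l = g"
    and obj: "f \<in> Arr C" "Cod C f = b" "h \<in> Arr C" "Cod C h = b" unfolding hom_slice by blast
  have "Comp C h (Comp C l k) = f"
    using assoc[of k l h] s t(2,3) obj by (simp add: hom_iff)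
  then show "Comp (slice C b) t s \<in> hom (slice C b) f h"
    using s(1,2) t(1,2) obj by (simp add: hom_slice hom_iff)
next
  fix f g s assume "s \<in> hom (slice C b) f g"
  then show "Comp (slice C b) (Id (slice C b) g) s = s" "Comp (slice C b) s (Id (slice C b) f) = s"
    by (auto simp only: hom_slice mem_Collect_eq hom_iff slice_simps Comp_Id_Arr)
next
  fix f g h l s t r assume "s \<in> hom (slice C b) f g" "t \<in> hom (slice C b) g h" "r \<in> hom (slice C b) h l"
  then obtain k m n where "s = (f, k, g)" "t = (g, m, h)" "r = (h, n, l)" and "k \<in> hom C (Dom C f) (Dom C g)"
    "m \<in> hom C (Dom C g) (Dom C h)" "n \<in> hom C (Dom C h) (Dom C l)" unfolding hom_slice by blast
  then show "Comp (slice C b) r (Comp (slice C b) t s) = Comp (slice C b) (Comp (slice C b) r t) s"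
    by (simp add: hom_iff assoc)
qed

lemma slice_push_functor:
  assumes p: "p \<in> hom C a b"
  shows "cat_functor (slice C a) (slice C b) (slice_push C p)"
proof (intro cat_functor.intro cat_functor_axioms.intro category_slice)
  show "FO (slice_push C p) x \<in> Obj (slice C b)" if "x \<in> Obj (slice C a)" for x
    using that p by (simp add: slice_push_def hom_iff)
  show "FA (slice_push C p) f \<in> hom (slice C b) (FO (slice_push C p) x) (FO (slice_push C p) y)"
    if f: "f \<in> hom (slice C a) x y" for f x y
  proof -
    obtain h where h: "f = (x, h, y)" "h \<in> hom C (Dom C x) (Dom C y)" "Comp C y h = x"
      and xy: "x \<in> Arr C" "Cod C x = a" "y \<in> Arr C" "Cod C y = a" using f unfolding hom_slice by blast
    have "Comp C (Comp C p y) h = Comp C p x" using assoc[of h y p] h(2,3) xy p by (simp add: hom_iff)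
    then show ?thesis using h(1,2) xy p by (simp add: slice_push_def hom_slice hom_iff)
  qed
  show "FA (slice_push C p) (Id (slice C a) x) = Id (slice C b) (FO (slice_push C p) x)"
    if "x \<in> Obj (slice C a)" for x
    using that p by (simp add: slice_push_def hom_iff)
  show "FA (slice_push C p) (Comp (slice C a) g f) = Comp (slice C b) (FA (slice_push C p) g) (FA (slice_push C p) f)"
    if f: "f \<in> hom (slice C a) x y" and g: "g \<in> hom (slice C a) y z" for f g x y z
  proof -
    obtain h where "f = (x, h, y)" using f unfolding hom_slice by blast
    moreover obtain k where "g = (y, k, z)" using g unfolding hom_slice by blast
    ultimately show ?thesis by (simp add: slice_push_def)
  qed
qed

text \<open>
  A couniversal arrow for \<open>p\<^sub>!\<close> at \<open>g\<close> is a pullback square of \<open>p\<close> and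
  \<open>g\<close>: it consists of a projection \<open>u\<close> to \<open>a\<close> and of an arrow over \<open>b\<close>
  from \<open>p \<cdot> u\<close> to \<open>g\<close>, whose middle component is the other projection.
\<close>

lemma pullback_of_couniversal:
  assumes p: "p \<in> hom C a b" and cu: "couniversal (slice C a) (slice C b) (slice_push C p) u e g"
  shows "is_pullback C p g u (fst (snd e))"
proof -
  interpret P: cat_functor "slice C a" "slice C b" "slice_push C p" by (rule slice_push_functor[OF p])
  obtain v where e: "e = (Comp C p u, v, g)" and u: "u \<in> Arr C" "Cod C u = a"
    and g: "g \<in> Arr C" "Cod C g = b" and v: "v \<in> hom C (Dom C u) (Dom C g)" "Comp C g v = Comp C p u"
    using P.couniversal_arrow[OF cu] p by (auto simp: hom_slice slice_push_def hom_iff)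
  have "\<exists>!h. h \<in> hom C w (Dom C u) \<and> Comp C u h = u' \<and> Comp C v h = v'"
    if u': "u' \<in> hom C w a" and v': "v' \<in> hom C w (Dom C g)" and eq: "Comp C p u' = Comp C g v'" for w u' v'
  proof -
    have "u' \<in> Obj (slice C a)" "(Comp C p u', v', g) \<in> hom (slice C b) (FO (slice_push C p) u') g"
      using u' v' eq p g by (auto simp: hom_slice slice_push_def hom_iff)
    then have "\<exists>!s. s \<in> hom (slice C a) u' u \<and> Comp (slice C b) e (FA (slice_push C p) s) = (Comp C p u', v', g)"
      using cu unfolding couniversal_def by blast
    then obtain s where s: "s \<in> hom (slice C a) u' u"
        "Comp (slice C b) e (FA (slice_push C p) s) = (Comp C p u', v', g)"
      and uniq: "\<And>s'. \<lbrakk>s' \<in> hom (slice C a) u' u;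
        Comp (slice C b) e (FA (slice_push C p) s') = (Comp C p u', v', g)\<rbrakk> \<Longrightarrow> s' = s" by blast
    obtain h where h: "s = (u', h, u)" using s(1) unfolding hom_slice by blast
    have char: "(u', h', u) \<in> hom (slice C a) u' u \<and>
        Comp (slice C b) e (FA (slice_push C p) (u', h', u)) = (Comp C p u', v', g) \<longleftrightarrow>
        h' \<in> hom C w (Dom C u) \<and> Comp C u h' = u' \<and> Comp C v h' = v'" for h'
      using u' u by (auto simp: hom_slice slice_push_def e hom_iff)
    show ?thesis
    proof (rule ex1I)
      show "h \<in> hom C w (Dom C u) \<and> Comp C u h = u' \<and> Comp C v h = v'" using char[of h] s h by blast
      show "h' = h" if "h' \<in> hom C w (Dom C u) \<and> Comp C u h' = u' \<and> Comp C v h' = v'" for h'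
        using char[of h'] uniq[of "(u', h', u)"] that h by blast
    qed
  qed
  then show ?thesis
    unfolding is_pullback_def using p u g v e by (auto simp: hom_iff)
qed

theorem effective_descent_iff_monadic_left_adjoint:
  assumes p: "p \<in> hom C a b"
  shows "effective_descent C p \<longleftrightarrow> monadic_left_adjoint (slice C a) (slice C b) (slice_push C p)"
proof -
  interpret P: cat_functor "slice C a" "slice C b" "slice_push C p" by (rule slice_push_functor[OF p])
  have "\<exists>u v. is_pullback C p g u v"
    if m: "monadic_left_adjoint (slice C a) (slice C b) (slice_push C p)" and g: "g \<in> Arr C" "Cod C g = Cod C p" for g
  proof -
    have "g \<in> Obj (slice C b)" using g p by (simp add: hom_iff)
    then show ?thesis using m pullback_of_couniversal[OF p] unfolding monadic_left_adjoint_def by blast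
  qed
  moreover have "Dom C p = a" "Cod C p = b" "p \<in> Arr C" using p by (auto simp: hom_iff)
  ultimately show ?thesis
    unfolding effective_descent_def using P.monadic_iff_left_adjoint by auto
qed

end

section \<open>Coreflections onto sieves\<close>

text \<open>
  The functor \<open>U\<close> has a left adjoint \<open>J\<close> with \<open>U J\<close> the identity, so \<open>J\<close>
  embeds \<open>A\<close> as a full coreflective subcategory of \<open>L\<close>. The last condition says that the objects
  of this subcategory form a sieve up to isomorphism, and it implies that the coreflections are monic.
\<close>

locale sieve_coreflection = U: cat_functor L A U
  for L :: "('o1, 'm1) cat" and A :: "('o2, 'm2) cat" and U :: "('o1, 'm1, 'o2, 'm2) ftor" +
  fixes J :: "'o2 \<Rightarrow> 'o1"
  assumes J_Obj: "a \<in> Obj A \<Longrightarrow> J a \<in> Obj L"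
    and U_J: "a \<in> Obj A \<Longrightarrow> FO U (J a) = a"
    and unique_lift: "\<lbrakk>f \<in> Obj L; p \<in> hom A a (FO U f)\<rbrakk> \<Longrightarrow> \<exists>!P. P \<in> hom L (J a) f \<and> FA U P = p"
    and J_sieve: "\<lbrakk>a \<in> Obj A; t \<in> hom L w (J a)\<rbrakk> \<Longrightarrow> \<exists>a' \<in> Obj A. isomorphic L (J a') w"
begin

definition lift :: "'o2 \<Rightarrow> 'o1 \<Rightarrow> 'm2 \<Rightarrow> 'm1" where
  "lift a f p = (THE P. P \<in> hom L (J a) f \<and> FA U P = p)"

lemma lift:
  assumes "f \<in> Obj L" "p \<in> hom A a (FO U f)"
  shows "lift a f p \<in> hom L (J a) f" "FA U (lift a f p) = p"
  using theI'[OF unique_lift[OF assms]] unfolding lift_def by auto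

lemma lift_eqI:
  assumes P: "P \<in> hom L (J a) f" and a: "a \<in> Obj A"
  shows "lift a f (FA U P) = P"
proof -
  have f: "f \<in> Obj L" using U.C.Obj_of_hom P by blast
  have "FA U P \<in> hom A a (FO U f)" using U.FA_hom[OF P] U_J[OF a] by simp
  then show ?thesis using unique_lift[OF f] lift[OF f] P by blast
qed

lemma comp_lift:
  assumes P: "P \<in> hom L f g" and p: "p \<in> hom A a (FO U f)"
  shows "Comp L P (lift a f p) = lift a g (Comp A (FA U P) p)"
proof -
  have f: "f \<in> Obj L" using U.C.Obj_of_hom P by blast
  have a: "a \<in> Obj A" using U.D.Obj_of_hom p by blast
  note l = lift[OF f p]
  show ?thesis using lift_eqI[OF U.C.Comp_hom[OF l(1) P] a] U.FA_Comp[OF l(1) P] l(2) by simp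
qed

text \<open>
  The functor \<open>J\<close> on slices, followed by composition with the coreflection \<open>J (U f) \<rightarrow> f\<close>:
  an object \<open>h : a \<rightarrow> U f\<close> goes to its transpose \<open>J a \<rightarrow> f\<close>.
\<close>

definition slice_lift :: "'o1 \<Rightarrow> ('m2, 'm2 \<times> 'm2 \<times> 'm2, 'm1, 'm1 \<times> 'm1 \<times> 'm1) ftor" where
  "slice_lift f = \<lparr>FO = (\<lambda>h. lift (Dom A h) f h),
     FA = (\<lambda>(h, k, h'). (lift (Dom A h) f h, lift (Dom A h) (J (Dom A h')) k, lift (Dom A h') f h'))\<rparr>"

lemma lift_slice_Obj:
  assumes f: "f \<in> Obj L" and h: "h \<in> Arr A" "Cod A h = FO U f"
  shows "lift (Dom A h) f h \<in> hom L (J (Dom A h)) f" "FA U (lift (Dom A h) f h) = h" "Dom A h \<in> Obj A"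
  using lift[OF f, of h "Dom A h"] h U.D.Dom_Obj by (auto simp: hom_iff)

lemma lift_slice_Arr:
  assumes f: "f \<in> Obj L" and k: "k \<in> hom A a b"
  shows "lift a (J b) k \<in> hom L (J a) (J b)" "FA U (lift a (J b) k) = k"
  using lift[OF J_Obj, of b k a] k U.D.Obj_of_hom[OF k] U_J by auto

lemma slice_lift_functor:
  assumes f: "f \<in> Obj L"
  shows "cat_functor (slice A (FO U f)) (slice L f) (slice_lift f)"
proof (intro cat_functor.intro cat_functor_axioms.intro U.C.category_slice U.D.category_slice)
  show "FO (slice_lift f) h \<in> Obj (slice L f)" if "h \<in> Obj (slice A (FO U f))" for h
    using lift_slice_Obj[OF f, of h] that by (simp add: slice_lift_def hom_iff)
  show "FA (slice_lift f) s \<in> hom (slice L f) (FO (slice_lift f) h) (FO (slice_lift f) h')"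
    if s: "s \<in> hom (slice A (FO U f)) h h'" for s h h'
  proof -
    obtain k where k: "s = (h, k, h')" "k \<in> hom A (Dom A h) (Dom A h')" "Comp A h' k = h"
      and h: "h \<in> Arr A" "Cod A h = FO U f" and h': "h' \<in> Arr A" "Cod A h' = FO U f"
      using s unfolding hom_slice by blast
    note lh = lift_slice_Obj[OF f h] and lh' = lift_slice_Obj[OF f h'] and lk = lift_slice_Arr[OF f k(2)]
    have "Comp L (lift (Dom A h') f h') (lift (Dom A h) (J (Dom A h')) k) = lift (Dom A h) f h"
      using comp_lift[OF lh'(1), of k "Dom A h"] k U_J[OF lh'(3)] lh'(2) by simp
    then show ?thesis using lh lh' lk k(1) by (simp add: slice_lift_def hom_slice hom_iff)
  qed
  show "FA (slice_lift f) (Id (slice A (FO U f)) h) = Id (slice L f) (FO (slice_lift f) h)"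
    if "h \<in> Obj (slice A (FO U f))" for h
  proof -
    have h: "h \<in> Arr A" "Cod A h = FO U f" using that by auto
    note lh = lift_slice_Obj[OF f h]
    have "lift (Dom A h) (J (Dom A h)) (Id A (Dom A h)) = Id L (J (Dom A h))"
      using lift_eqI[OF U.C.Id_hom[OF J_Obj[OF lh(3)]] lh(3)] U.FA_Id[OF J_Obj[OF lh(3)]] U_J[OF lh(3)] by simp
    then show ?thesis using lh(1) by (simp add: slice_lift_def hom_iff)
  qed
  show "FA (slice_lift f) (Comp (slice A (FO U f)) t s) = Comp (slice L f) (FA (slice_lift f) t) (FA (slice_lift f) s)"
    if s: "s \<in> hom (slice A (FO U f)) x y" and t: "t \<in> hom (slice A (FO U f)) y z" for s t x y z
  proof -
    obtain k where k: "s = (x, k, y)" "k \<in> hom A (Dom A x) (Dom A y)" using s unfolding hom_slice by blast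
    obtain l where l: "t = (y, l, z)" "l \<in> hom A (Dom A y) (Dom A z)" using t unfolding hom_slice by blast
    have y: "Dom A y \<in> Obj A" using U.D.Obj_of_hom k(2) by blast
    note ll = lift_slice_Arr[OF f l(2)]
    have "Comp L (lift (Dom A y) (J (Dom A z)) l) (lift (Dom A x) (J (Dom A y)) k) =
        lift (Dom A x) (J (Dom A z)) (Comp A l k)"
      using comp_lift[OF ll(1), of k "Dom A x"] k(2) U_J[OF y] ll(2) by simp
    then show ?thesis using k(1) l(1) by (simp add: slice_lift_def)
  qed
qed

text \<open>
  An arrow from one transpose to another over \<open>f\<close> is an arrow between objects in the image of
  \<open>J\<close>, and these are the lifts of their images under \<open>U\<close>.
\<close>

lemma slice_lift_fully_faithful:
  assumes f: "f \<in> Obj L"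
  shows "cat_functor.fully_faithful (slice A (FO U f)) (slice L f) (slice_lift f)"
proof -
  interpret S: cat_functor "slice A (FO U f)" "slice L f" "slice_lift f" by (rule slice_lift_functor[OF f])
  show ?thesis
    unfolding S.fully_faithful_def
  proof (intro ballI)
    fix h h' s assume "h \<in> Obj (slice A (FO U f))" "h' \<in> Obj (slice A (FO U f))"
      and s: "s \<in> hom (slice L f) (FO (slice_lift f) h) (FO (slice_lift f) h')"
    then have h: "h \<in> Arr A" "Cod A h = FO U f" and h': "h' \<in> Arr A" "Cod A h' = FO U f" by auto
    note lh = lift_slice_Obj[OF f h] and lh' = lift_slice_Obj[OF f h']
    obtain m where m: "s = (lift (Dom A h) f h, m, lift (Dom A h') f h')"
      "m \<in> hom L (J (Dom A h)) (J (Dom A h'))" "Comp L (lift (Dom A h') f h') m = lift (Dom A h) f h"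
      using s lh(1) lh'(1) by (auto simp: hom_slice slice_lift_def hom_iff)
    have Um: "FA U m \<in> hom A (Dom A h) (Dom A h')" using U.FA_hom[OF m(2)] U_J lh(3) lh'(3) by simp
    have "Comp A h' (FA U m) = h"
      using U.FA_Comp[OF m(2) lh'(1)] m(3) lh(2) lh'(2) by simp
    then have arr: "(h, FA U m, h') \<in> hom (slice A (FO U f)) h h'" using Um h h' by (simp add: hom_slice)
    have img: "FA (slice_lift f) (h, FA U m, h') = s"
      using lift_eqI[OF m(2) lh(3)] m(1) by (simp add: slice_lift_def)
    have uniq: "r = (h, FA U m, h')" if r: "r \<in> hom (slice A (FO U f)) h h'" "FA (slice_lift f) r = s" for r
    proof -
      obtain k where k: "r = (h, k, h')" "k \<in> hom A (Dom A h) (Dom A h')" using r(1) unfolding hom_slice by blast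
      have "lift (Dom A h) (J (Dom A h')) k = m" using r(2) k(1) m(1) by (simp add: slice_lift_def)
      then have "k = FA U m" using lift_slice_Arr(2)[OF f k(2)] by simp
      then show ?thesis using k(1) by simp
    qed
    show "\<exists>!r. r \<in> hom (slice A (FO U f)) h h' \<and> FA (slice_lift f) r = s"
      using arr img uniq by blast
  qed
qed

text \<open>
  The sieve condition and the monic coreflections pass from \<open>L\<close> to its slices: the coreflection of
  \<open>y : Y \<rightarrow> g\<close> is the coreflection \<open>\<kappa> : J (U Y) \<rightarrow> Y\<close>, regarded as an arrow over
  \<open>g\<close>. The squares with the push-forward functors commute strictly, because lifts are unique.
\<close>

lemma monadic_restriction_slice:
  assumes P: "P \<in> hom L f g"
  shows "monadic_restriction (slice L f) (slice L g) (slice A (FO U f)) (slice A (FO U g))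
    (slice_push L P) (slice_push A (FA U P)) (slice_lift f) (slice_lift g)"
proof (intro monadic_restriction.intro monadic_restriction_axioms.intro)
  have f: "f \<in> Obj L" and g: "g \<in> Obj L" using U.C.Obj_of_hom[OF P] .
  have UP: "FA U P \<in> hom A (FO U f) (FO U g)" using U.FA_hom[OF P] .
  show "cat_functor (slice L f) (slice L g) (slice_push L P)" using U.C.slice_push_functor[OF P] .
  show "cat_functor (slice A (FO U f)) (slice A (FO U g)) (slice_push A (FA U P))"
    using U.D.slice_push_functor[OF UP] .
  show "cat_functor (slice A (FO U f)) (slice L f) (slice_lift f)" using slice_lift_functor[OF f] .
  show "cat_functor (slice A (FO U g)) (slice L g) (slice_lift g)" using slice_lift_functor[OF g] .
  show "cat_functor.fully_faithful (slice A (FO U f)) (slice L f) (slice_lift f)"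
    using slice_lift_fully_faithful[OF f] .
  show "cat_functor.fully_faithful (slice A (FO U g)) (slice L g) (slice_lift g)"
    using slice_lift_fully_faithful[OF g] .
  have push: "Comp L P (lift (Dom A h) f h) = lift (Dom A (Comp A (FA U P) h)) g (Comp A (FA U P) h)"
    if "h \<in> Arr A" "Cod A h = FO U f" for h
    using comp_lift[OF P, of h "Dom A h"] that UP by (simp add: hom_iff)
  show "FO (slice_push L P) (FO (slice_lift f) h) = FO (slice_lift g) (FO (slice_push A (FA U P)) h)"
    if "h \<in> Obj (slice A (FO U f))" for h
    using push[of h] that by (simp add: slice_push_def slice_lift_def)
  show "FA (slice_push L P) (FA (slice_lift f) s) = FA (slice_lift g) (FA (slice_push A (FA U P)) s)"
    if s': "s \<in> Arr (slice A (FO U f))" for s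
  proof -
    obtain h k h' where s: "s = (h, k, h')" "h \<in> Arr A" "Cod A h = FO U f" "h' \<in> Arr A" "Cod A h' = FO U f"
      using s' unfolding slice_def by auto
    then show ?thesis using push[of h] push[of h'] UP by (simp add: slice_push_def slice_lift_def hom_iff)
  qed
  show "\<exists>w' \<in> Obj (slice A (FO U f)). isomorphic (slice L f) (FO (slice_lift f) w') w"
    if w: "w \<in> Obj (slice L f)" and y: "y \<in> Obj (slice A (FO U g))"
      and t: "t \<in> hom (slice L g) (FO (slice_push L P) w) (FO (slice_lift g) y)" for w y t
  proof -
    have w': "w \<in> hom L (Dom L w) f" using w by (simp add: hom_iff)
    note ly = lift_slice_Obj[OF g, of y]
    obtain m where m: "m \<in> hom L (Dom L w) (J (Dom A y))"
      using t w y P ly by (auto simp: hom_slice slice_push_def slice_lift_def hom_iff)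
    obtain a where a: "a \<in> Obj A" "isomorphic L (J a) (Dom L w)"
      using J_sieve[OF _ m] ly y by auto
    obtain i j where i: "i \<in> hom L (J a) (Dom L w)" and j: "j \<in> hom L (Dom L w) (J a)"
      and ji: "Comp L j i = Id L (J a)" and ij: "Comp L i j = Id L (Dom L w)"
      using U.C.isomorphicE[OF a(2)] .
    have wi: "Comp L w i \<in> hom L (J a) f" using U.C.Comp_hom[OF i w'] .
    let ?w' = "FA U (Comp L w i)"
    have U: "?w' \<in> hom A a (FO U f)" using U.FA_hom[OF wi] U_J[OF a(1)] by simp
    have eq: "FO (slice_lift f) ?w' = Comp L w i"
      using lift_eqI[OF wi a(1)] U by (simp add: slice_lift_def hom_iff)
    have retract: "Comp L (Comp L w i) j = w" using w' i j ij by (simp add: hom_iff U.C.assoc)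
    interpret S: category "slice L f" by (rule U.C.category_slice)
    have "isomorphic (slice L f) (Comp L w i) w"
    proof (rule S.isomorphicI)
      show "(Comp L w i, i, w) \<in> hom (slice L f) (Comp L w i) w" using i wi w' by (simp add: hom_slice hom_iff)
      show "(w, j, Comp L w i) \<in> hom (slice L f) w (Comp L w i)"
        using j wi w' retract by (simp add: hom_slice hom_iff)
    qed (use ji ij wi w' in \<open>simp_all add: hom_iff\<close>)
    then have "isomorphic (slice L f) (FO (slice_lift f) ?w') w" using eq by simp
    moreover have "?w' \<in> Obj (slice A (FO U f))" using U by (simp add: hom_iff)
    ultimately show ?thesis by blast
  qed
  show "\<exists>y' \<in> Obj (slice A (FO U g)). \<exists>k \<in> hom (slice L g) (FO (slice_lift g) y') y. mono_arr (slice L g) k \<and>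
      (\<forall>z \<in> Obj (slice A (FO U g)). \<forall>t \<in> hom (slice L g) (FO (slice_lift g) z) y.
        \<exists>t' \<in> hom (slice L g) (FO (slice_lift g) z) (FO (slice_lift g) y'). Comp (slice L g) k t' = t)"
    if "y \<in> Obj (slice L g)" for y
  proof -
    have y: "y \<in> hom L (Dom L y) g" using that by (simp add: hom_iff)
    have Dy: "Dom L y \<in> Obj L" using U.C.Obj_of_hom[OF y] by blast
    let ?a = "FO U (Dom L y)"
    have a: "?a \<in> Obj A" using U.FO_Obj[OF Dy] .
    have Uy: "FA U y \<in> hom A ?a (FO U g)" using U.FA_hom[OF y] .
    have obj: "FA U y \<in> Obj (slice A (FO U g))" using Uy by (simp add: hom_iff)
    let ?\<kappa> = "lift ?a (Dom L y) (Id A ?a)"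
    note \<kappa> = lift[OF Dy U.D.Id_hom[OF a]]
    let ?y = "lift ?a g (FA U y)"
    note ly = lift[OF g Uy]
    have Ky: "FO (slice_lift g) (FA U y) = ?y" using Uy by (simp add: slice_lift_def hom_iff)
    have y\<kappa>: "Comp L y ?\<kappa> = ?y" using comp_lift[OF y U.D.Id_hom[OF a]] Uy by (simp add: hom_iff)
    have k: "(?y, ?\<kappa>, y) \<in> hom (slice L g) ?y y" using y\<kappa> ly \<kappa> y by (simp add: hom_slice hom_iff)
    \<comment> \<open>The source of arrows into \<open>J ?a\<close> is some \<open>J c\<close> by the sieve condition, and arrows out
      of \<open>J c\<close> are determined by their images under \<open>U\<close>, which sends \<open>?\<kappa>\<close> to an identity.\<close>
    have cancel: "m = n" if m: "m \<in> hom L w (J ?a)" and n: "n \<in> hom L w (J ?a)"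
        and eq: "Comp L ?\<kappa> m = Comp L ?\<kappa> n" for m n w
    proof -
      obtain c where c: "c \<in> Obj A" "isomorphic L (J c) w" using J_sieve[OF a m] by blast
      obtain i j where i: "i \<in> hom L (J c) w" and j: "j \<in> hom L w (J c)" and ij: "Comp L i j = Id L w"
        using U.C.isomorphicE[OF c(2)] by metis
      have U_eq: "FA U (Comp L r i) = FA U (Comp L (Comp L ?\<kappa> r) i)" if r: "r \<in> hom L w (J ?a)" for r
      proof -
        have ri: "Comp L r i \<in> hom L (J c) (J ?a)" using U.C.Comp_hom[OF i r] .
        have "FA U (Comp L ?\<kappa> (Comp L r i)) = Comp A (Id A ?a) (FA U (Comp L r i))"
          using U.FA_Comp[OF ri \<kappa>(1)] \<kappa>(2) by simp
        then show ?thesis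
          using U.FA_hom[OF ri] U_J[OF a] r i \<kappa>(1) by (simp add: hom_iff U.C.assoc)
      qed
      have "Comp L m i = Comp L n i"
        using lift_eqI[OF U.C.Comp_hom[OF i m] c(1)] lift_eqI[OF U.C.Comp_hom[OF i n] c(1)]
          U_eq[OF m] U_eq[OF n] eq by simp
      then have "Comp L (Comp L m i) j = Comp L (Comp L n i) j" by simp
      then show "m = n" using m n i j ij by (simp add: hom_iff U.C.assoc)
    qed
    have mono: "mono_arr (slice L g) (?y, ?\<kappa>, y)"
      unfolding mono_arr_def
    proof (intro allI ballI impI)
      fix w r s assume r: "r \<in> hom (slice L g) w (Dom (slice L g) (?y, ?\<kappa>, y))"
        and s: "s \<in> hom (slice L g) w (Dom (slice L g) (?y, ?\<kappa>, y))"
        and eq: "Comp (slice L g) (?y, ?\<kappa>, y) r = Comp (slice L g) (?y, ?\<kappa>, y) s"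
      have Dk: "Dom (slice L g) (?y, ?\<kappa>, y) = ?y" by (simp add: slice_def)
      obtain m where m: "r = (w, m, ?y)" "m \<in> hom L (Dom L w) (J ?a)"
        using r ly(1) unfolding Dk by (auto simp: hom_slice hom_iff)
      obtain n where n: "s = (w, n, ?y)" "n \<in> hom L (Dom L w) (J ?a)"
        using s ly(1) unfolding Dk by (auto simp: hom_slice hom_iff)
      show "r = s" using cancel[OF m(2) n(2)] eq m(1) n(1) by simp
    qed
    have factor: "\<exists>t' \<in> hom (slice L g) (FO (slice_lift g) z) ?y. Comp (slice L g) (?y, ?\<kappa>, y) t' = t"
      if "z \<in> Obj (slice A (FO U g))" and t: "t \<in> hom (slice L g) (FO (slice_lift g) z) y" for z t
    proof -
      have z: "z \<in> Arr A" "Cod A z = FO U g" using that(1) by auto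
      note lz = lift_slice_Obj[OF g z]
      let ?z = "lift (Dom A z) g z"
      obtain m where m: "t = (?z, m, y)" "m \<in> hom L (J (Dom A z)) (Dom L y)" "Comp L y m = ?z"
        using t lz(1) by (auto simp: slice_lift_def hom_slice hom_iff)
      have Um: "FA U m \<in> hom A (Dom A z) ?a" using U.FA_hom[OF m(2)] U_J[OF lz(3)] by simp
      let ?m = "lift (Dom A z) (J ?a) (FA U m)"
      note lm = lift_slice_Arr[OF g Um]
      have \<kappa>m: "Comp L ?\<kappa> ?m = m"
        using comp_lift[OF \<kappa>(1), of "FA U m" "Dom A z"] U_J[OF a] Um \<kappa>(2) lift_eqI[OF m(2) lz(3)]
        by (simp add: hom_iff)
      have "Comp L ?y ?m = ?z"
        using m(3) \<kappa>m y\<kappa> U.C.assoc[of ?m ?\<kappa> y] y \<kappa>(1) lm(1) by (simp add: hom_iff)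
      then have arr: "(?z, ?m, ?y) \<in> hom (slice L g) ?z ?y" using lz(1) ly(1) lm(1) by (simp add: hom_slice hom_iff)
      have comp: "Comp (slice L g) (?y, ?\<kappa>, y) (?z, ?m, ?y) = t" using \<kappa>m m(1) by simp
      have Kz: "FO (slice_lift g) z = ?z" by (simp add: slice_lift_def)
      show ?thesis unfolding Kz using arr comp by blast
    qed
    show ?thesis
      by (rule bexI[OF _ obj], unfold Ky, rule bexI[OF _ k]) (use mono factor in blast)
  qed
qed

theorem preserves_effective_descent: "preserves_effective_descent L A U"
  unfolding preserves_effective_descent_def
proof (intro allI impI)
  fix P assume ed: "effective_descent L P"
  let ?f = "Dom L P" and ?g = "Cod L P"
  have P: "P \<in> hom L ?f ?g" using ed by (simp add: effective_descent_def hom_iff)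
  interpret R: monadic_restriction "slice L ?f" "slice L ?g" "slice A (FO U ?f)" "slice A (FO U ?g)"
    "slice_push L P" "slice_push A (FA U P)" "slice_lift ?f" "slice_lift ?g"
    by (rule monadic_restriction_slice[OF P])
  show "effective_descent A (FA U P)"
    using R.monadic_left_adjoint_restricts ed U.C.effective_descent_iff_monadic_left_adjoint[OF P]
      U.D.effective_descent_iff_monadic_left_adjoint[OF U.FA_hom[OF P]] by blast
qed

end

section \<open>The lax comma category\<close>

context two_category
begin

sublocale U: category "underlying A"
  by (rule category_underlying)

lemma underlying_simps [simp]:
  "Obj (underlying A) = Obj A" "Arr (underlying A) = Arr A" "Dom (underlying A) = Dom A"
  "Cod (underlying A) = Cod A" "Id (underlying A) = Id A" "Comp (underlying A) = Comp A"
  by (simp_all add: underlying_def)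

lemma hom_category_simps [simp]:
  "Obj (hom_category A x y) = hom (underlying A) x y"
  "Id (hom_category A x y) = VId A" "Comp (hom_category A x y) = VComp A"
  by (simp_all add: hom_category_def)

lemma hom_hom_category:
  "\<alpha> \<in> hom (hom_category A x y) f g \<longleftrightarrow>
    \<alpha> \<in> Cell A \<and> Src A \<alpha> = f \<and> Tgt A \<alpha> = g \<and> f \<in> hom (underlying A) x y \<and> g \<in> hom (underlying A) x y"
  by (auto simp: hom_category_def hom_def)

lemma category_hom': "f \<in> hom (underlying A) x y \<Longrightarrow> category (hom_category A x y)"
  using category_hom U.Obj_of_hom by fastforce

lemma VId_hom: "f \<in> hom (underlying A) x y \<Longrightarrow> VId A f \<in> hom (hom_category A x y) f f"
  using category.Id_hom[OF category_hom'] by fastforce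

lemma VComp_hom:
  assumes "\<alpha> \<in> hom (hom_category A x y) f g" "\<beta> \<in> hom (hom_category A x y) g h"
  shows "VComp A \<beta> \<alpha> \<in> hom (hom_category A x y) f h"
proof -
  have "f \<in> hom (underlying A) x y" using assms(1) by (simp add: hom_hom_category)
  then show ?thesis using category.Comp_hom[OF category_hom' assms] by simp
qed

lemma VComp_assoc:
  assumes "\<alpha> \<in> hom (hom_category A x y) f g" "\<beta> \<in> hom (hom_category A x y) g h"
    "\<gamma> \<in> hom (hom_category A x y) h k"
  shows "VComp A \<gamma> (VComp A \<beta> \<alpha>) = VComp A (VComp A \<gamma> \<beta>) \<alpha>"
proof -
  have "f \<in> hom (underlying A) x y" using assms(1) by (simp add: hom_hom_category)
  then show ?thesis using category.Comp_assoc[OF category_hom' assms] by simp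
qed

lemma VComp_VId:
  assumes "\<alpha> \<in> hom (hom_category A x y) f g"
  shows "VComp A (VId A g) \<alpha> = \<alpha>" "VComp A \<alpha> (VId A f) = \<alpha>"
proof -
  have f: "f \<in> hom (underlying A) x y" using assms by (simp add: hom_hom_category)
  show "VComp A (VId A g) \<alpha> = \<alpha>" using category.Comp_Id_left[OF category_hom'[OF f] assms] by simp
  show "VComp A \<alpha> (VId A f) = \<alpha>" using category.Comp_Id_right[OF category_hom'[OF f] assms] by simp
qed

lemma Arr_hom_category: "\<alpha> \<in> hom (hom_category A x y) f g \<Longrightarrow> \<alpha> \<in> Arr (hom_category A x y)"
  by (simp add: hom_iff)

lemma whisker_hom:
  assumes "p \<in> hom (underlying A) w x" "\<alpha> \<in> hom (hom_category A x y) f g"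
  shows "whisker_right A \<alpha> p \<in> hom (hom_category A w y) (Comp A f p) (Comp A g p)"
  unfolding whisker_right_def using HComp_hom[OF VId_hom[OF assms(1)] assms(2)] .

lemma whisker_VComp:
  assumes p: "p \<in> hom (underlying A) w x" and a: "\<alpha> \<in> hom (hom_category A x y) f g"
    and b: "\<beta> \<in> hom (hom_category A x y) g h"
  shows "whisker_right A (VComp A \<beta> \<alpha>) p = VComp A (whisker_right A \<beta> p) (whisker_right A \<alpha> p)"
  unfolding whisker_right_def
  using interchange[OF VId_hom[OF p] VId_hom[OF p] a b] VComp_VId(1)[OF VId_hom[OF p]] by simp

lemma whisker_Comp:
  assumes p: "p \<in> hom (underlying A) v w" and q: "q \<in> hom (underlying A) w x"
    and a: "\<alpha> \<in> hom (hom_category A x y) f g"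
  shows "whisker_right A \<alpha> (Comp A q p) = whisker_right A (whisker_right A \<alpha> q) p"
  unfolding whisker_right_def
  using HComp_assoc[OF VId_hom[OF p, THEN Arr_hom_category] VId_hom[OF q, THEN Arr_hom_category]
      Arr_hom_category[OF a]] HComp_VId[OF p q] by simp

lemma whisker_VId:
  "\<lbrakk>p \<in> hom (underlying A) w x; f \<in> hom (underlying A) x y\<rbrakk> \<Longrightarrow> whisker_right A (VId A f) p = VId A (Comp A f p)"
  unfolding whisker_right_def by (rule HComp_VId)

lemma whisker_Id:
  "\<alpha> \<in> hom (hom_category A x y) f g \<Longrightarrow> whisker_right A \<alpha> (Id A x) = \<alpha>"
  unfolding whisker_right_def using HComp_Id_right[OF Arr_hom_category] .

lemma lax_comma_simps [simp]:
  "f \<in> Obj (lax_comma A X) \<longleftrightarrow> f \<in> hom (underlying A) (Dom A f) X"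
  "Id (lax_comma A X) f = (f, (Id A (Dom A f), VId A f), f)"
  "Comp (lax_comma A X) (g, (q, \<chi>), h) (f, (p, \<pi>), g') =
    (f, (Comp A q p, VComp A (whisker_right A \<chi> p) \<pi>), h)"
  by (auto simp: lax_comma_def hom_iff)

lemma hom_lax_comma:
  "s \<in> hom (lax_comma A X) f g \<longleftrightarrow> (\<exists>p \<pi>. s = (f, (p, \<pi>), g) \<and>
     f \<in> hom (underlying A) (Dom A f) X \<and> g \<in> hom (underlying A) (Dom A g) X \<and>
     p \<in> hom (underlying A) (Dom A f) (Dom A g) \<and>
     \<pi> \<in> hom (hom_category A (Dom A f) X) f (Comp A g p))"
proof -
  have "hom (lax_comma A X) f g = {(f, (p, \<pi>), g) | p \<pi>. f \<in> Arr A \<and> Cod A f = X \<and> g \<in> Arr A \<and> Cod A g = X \<and>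
      p \<in> hom (underlying A) (Dom A f) (Dom A g) \<and> \<pi> \<in> hom (hom_category A (Dom A f) X) f (Comp A g p)}"
    by (auto simp: lax_comma_def hom_def)
  then show ?thesis by (auto simp: hom_iff[of _ "underlying A"])
qed

lemma hom_lax_commaE:
  assumes "s \<in> hom (lax_comma A X) f g"
  obtains p \<pi> where "s = (f, (p, \<pi>), g)" "f \<in> hom (underlying A) (Dom A f) X"
    "g \<in> hom (underlying A) (Dom A g) X" "p \<in> hom (underlying A) (Dom A f) (Dom A g)"
    "\<pi> \<in> hom (hom_category A (Dom A f) X) f (Comp A g p)"
  using assms unfolding hom_lax_comma by blast

lemma category_lax_comma: "category (lax_comma A X)"
proof
  let ?L = "lax_comma A X"
  fix s assume "s \<in> Arr ?L"
  then have "s \<in> hom ?L (Dom ?L s) (Cod ?L s)" by (simp add: hom_iff)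
  then show "Dom ?L s \<in> Obj ?L" "Cod ?L s \<in> Obj ?L" by (auto elim: hom_lax_commaE)
next
  let ?L = "lax_comma A X"
  fix f assume f: "f \<in> Obj ?L"
  then have f': "f \<in> hom (underlying A) (Dom A f) X" by simp
  then show "Id ?L f \<in> hom ?L f f"
    using U.Id_hom[of "Dom A f"] U.Obj_of_hom[OF f'] VId_hom[OF f'] U.Comp_Id_right[OF f']
    by (simp add: hom_lax_comma)
next
  let ?L = "lax_comma A X"
  fix s t f g h assume s: "s \<in> hom ?L f g" and t: "t \<in> hom ?L g h"
  obtain p \<pi> where s': "s = (f, (p, \<pi>), g)" "p \<in> hom (underlying A) (Dom A f) (Dom A g)"
    "\<pi> \<in> hom (hom_category A (Dom A f) X) f (Comp A g p)" "f \<in> hom (underlying A) (Dom A f) X"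
    using s by (rule hom_lax_commaE)
  obtain q \<chi> where t': "t = (g, (q, \<chi>), h)" "q \<in> hom (underlying A) (Dom A g) (Dom A h)"
    "\<chi> \<in> hom (hom_category A (Dom A g) X) g (Comp A h q)" "h \<in> hom (underlying A) (Dom A h) X"
    using t by (rule hom_lax_commaE)
  have "Comp A (Comp A h q) p = Comp A h (Comp A q p)" using U.Comp_assoc[OF s'(2) t'(2,4)] by simp
  then show "Comp ?L t s \<in> hom ?L f h"
    using s'(1,4) t'(1,4) U.Comp_hom[OF s'(2) t'(2)] VComp_hom[OF s'(3) whisker_hom[OF s'(2) t'(3)]]
    by (simp add: hom_lax_comma)
next
  let ?L = "lax_comma A X"
  fix s f g assume s: "s \<in> hom ?L f g"
  obtain p \<pi> where s': "s = (f, (p, \<pi>), g)" "p \<in> hom (underlying A) (Dom A f) (Dom A g)"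
    "\<pi> \<in> hom (hom_category A (Dom A f) X) f (Comp A g p)" "g \<in> hom (underlying A) (Dom A g) X"
    using s by (rule hom_lax_commaE)
  show "Comp ?L (Id ?L g) s = s"
    using s'(1) U.Comp_Id_left[OF s'(2)] whisker_VId[OF s'(2,4)] VComp_VId(1)[OF s'(3)] by simp
  show "Comp ?L s (Id ?L f) = s"
    using s'(1) U.Comp_Id_right[OF s'(2)] whisker_Id[OF s'(3)] VComp_VId(2)[OF s'(3)] by simp
next
  let ?L = "lax_comma A X"
  fix s t r f g h k assume s: "s \<in> hom ?L f g" and t: "t \<in> hom ?L g h" and r: "r \<in> hom ?L h k"
  obtain p \<pi> where s': "s = (f, (p, \<pi>), g)" "p \<in> hom (underlying A) (Dom A f) (Dom A g)"
    "\<pi> \<in> hom (hom_category A (Dom A f) X) f (Comp A g p)"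
    using s by (rule hom_lax_commaE)
  obtain q \<chi> where t': "t = (g, (q, \<chi>), h)" "q \<in> hom (underlying A) (Dom A g) (Dom A h)"
    "\<chi> \<in> hom (hom_category A (Dom A g) X) g (Comp A h q)"
    using t by (rule hom_lax_commaE)
  obtain m \<mu> where r': "r = (h, (m, \<mu>), k)" "m \<in> hom (underlying A) (Dom A h) (Dom A k)"
    "\<mu> \<in> hom (hom_category A (Dom A h) X) h (Comp A k m)"
    using r by (rule hom_lax_commaE)
  have wq: "whisker_right A \<mu> q \<in> hom (hom_category A (Dom A g) X) (Comp A h q) (Comp A (Comp A k m) q)"
    using whisker_hom[OF t'(2) r'(3)] .
  have "VComp A (whisker_right A \<mu> (Comp A q p)) (VComp A (whisker_right A \<chi> p) \<pi>) =
      VComp A (VComp A (whisker_right A (whisker_right A \<mu> q) p) (whisker_right A \<chi> p)) \<pi>"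
    unfolding whisker_Comp[OF s'(2) t'(2) r'(3)]
    using VComp_assoc[OF s'(3) whisker_hom[OF s'(2) t'(3)] whisker_hom[OF s'(2) wq]] .
  also have "\<dots> = VComp A (whisker_right A (VComp A (whisker_right A \<mu> q) \<chi>) p) \<pi>"
    unfolding whisker_VComp[OF s'(2) t'(3) wq] ..
  finally show "Comp ?L r (Comp ?L t s) = Comp ?L (Comp ?L r t) s"
    using s'(1) t'(1) r'(1) U.Comp_assoc[OF s'(2) t'(2) r'(2)] by simp
qed

lemma lax_comma_forget_functor: "cat_functor (lax_comma A X) (underlying A) (lax_comma_forget A)"
proof (intro cat_functor.intro cat_functor_axioms.intro category_lax_comma category_underlying)
  show "FO (lax_comma_forget A) f \<in> Obj (underlying A)" if "f \<in> Obj (lax_comma A X)" for f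
    using that U.Obj_of_hom(1)[of f "Dom A f" X] by (simp add: lax_comma_forget_def)
  show "FA (lax_comma_forget A) s \<in> hom (underlying A) (FO (lax_comma_forget A) f) (FO (lax_comma_forget A) g)"
    if "s \<in> hom (lax_comma A X) f g" for s f g
    using that by (auto simp: lax_comma_forget_def elim: hom_lax_commaE)
  show "FA (lax_comma_forget A) (Id (lax_comma A X) f) = Id (underlying A) (FO (lax_comma_forget A) f)"
    if "f \<in> Obj (lax_comma A X)" for f
    by (simp add: lax_comma_forget_def)
  show "FA (lax_comma_forget A) (Comp (lax_comma A X) t s) =
      Comp (underlying A) (FA (lax_comma_forget A) t) (FA (lax_comma_forget A) s)"
    if "s \<in> hom (lax_comma A X) f g" "t \<in> hom (lax_comma A X) g h" for s t f g h
    using that by (auto simp: lax_comma_forget_def elim!: hom_lax_commaE)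
qed

lemma lax_comma_vertical_iso:
  assumes f: "f \<in> hom (underlying A) a X" and g: "g \<in> hom (underlying A) a X"
    and iso: "isomorphic (hom_category A a X) f g"
  shows "isomorphic (lax_comma A X) f g"
proof -
  interpret H: category "hom_category A a X" using category_hom'[OF f] .
  interpret L: category "lax_comma A X" by (rule category_lax_comma)
  obtain \<sigma> \<tau> where s: "\<sigma> \<in> hom (hom_category A a X) f g" and t: "\<tau> \<in> hom (hom_category A a X) g f"
    and ts: "VComp A \<tau> \<sigma> = VId A f" and st: "VComp A \<sigma> \<tau> = VId A g"
    using H.isomorphicE[OF iso] by auto
  have a: "a \<in> Obj A" using U.Obj_of_hom(1)[OF f] by simp
  have Id_a: "Id A a \<in> hom (underlying A) a a" using U.Id_hom[of a] a by simp
  have D: "Dom A f = a" "Dom A g = a" using f g by (auto simp: hom_iff)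
  have unit: "Comp A f (Id A a) = f" "Comp A g (Id A a) = g" "Comp A (Id A a) (Id A a) = Id A a"
    using U.Comp_Id_right[OF f] U.Comp_Id_right[OF g] U.Comp_Id_right[OF Id_a] by simp_all
  show ?thesis
  proof (rule L.isomorphicI)
    show "(f, (Id A a, \<sigma>), g) \<in> hom (lax_comma A X) f g"
      using f g s Id_a D unit by (simp add: hom_lax_comma)
    show "(g, (Id A a, \<tau>), f) \<in> hom (lax_comma A X) g f"
      using f g t Id_a D unit by (simp add: hom_lax_comma)
  qed (simp_all add: whisker_Id[OF s] whisker_Id[OF t] ts st unit D)
qed

end

lemma (in category) initial_isomorphic:
  assumes z: "initial C z" and z': "initial C z'"
  shows "isomorphic C z z'"
proof -
  have Obj: "z \<in> Obj C" "z' \<in> Obj C" using z z' by (auto simp: initial_def)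
  have "\<exists>f. f \<in> hom C z z'" "\<exists>g. g \<in> hom C z' z" using z z' Obj unfolding initial_def by blast+
  then obtain f g where f: "f \<in> hom C z z'" and g: "g \<in> hom C z' z" by blast
  have "Comp C g f = Id C z" using z Obj Comp_hom[OF f g] Id_hom unfolding initial_def by blast
  moreover have "Comp C f g = Id C z'" using z' Obj Comp_hom[OF g f] Id_hom unfolding initial_def by blast
  ultimately show ?thesis using isomorphicI f g by blast
qed

text \<open>
  The initial objects \<open>J a\<close> of the fibres make the forgetful functor the coreflection onto a sieve. A
  lift of \<open>p : a \<rightarrow> dom f\<close> to \<open>J a \<rightarrow> f\<close> is a 2-cell from the initial object to
  \<open>f \<cdot> p\<close>, hence unique. An arrow \<open>w \<rightarrow> J a\<close> over \<open>p\<close> is a 2-cell from \<open>w\<close>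
  to \<open>J a \<cdot> p\<close>, which is initial because precomposition preserves initial objects; by strictness
  \<open>w\<close> is initial in its fibre.
\<close>

theorem lemma28:
  fixes A :: "('o, 'm, 'c) two_cat" and X :: 'o
  assumes "two_category A"
    and "X \<in> Obj A"
    and "\<And>B. B \<in> Obj A \<Longrightarrow> \<exists>z. strict_initial (hom_category A B X) z"
    and "\<And>B B' f. f \<in> hom (underlying A) B B' \<Longrightarrow>
      preserves_initial_objects (hom_category A B' X) (hom_category A B X) (precomposition A f)"
  shows "preserves_effective_descent (lax_comma A X) (underlying A) (lax_comma_forget A)"
proof -
  interpret two_category A by fact
  obtain J where strict: "\<And>a. a \<in> Obj A \<Longrightarrow> strict_initial (hom_category A a X) (J a)"
    using assms(3) by metis
  have init: "initial (hom_category A a X) (J a)" if "a \<in> Obj A" for a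
    using strict[OF that] by (simp add: strict_initial_def)
  have J: "J a \<in> hom (underlying A) a X" and DJ: "Dom A (J a) = a" if "a \<in> Obj A" for a
    using init[OF that] by (auto simp: initial_def hom_iff)
  have "sieve_coreflection (lax_comma A X) (underlying A) (lax_comma_forget A) J"
  proof (intro sieve_coreflection.intro sieve_coreflection_axioms.intro lax_comma_forget_functor)
    show "J a \<in> Obj (lax_comma A X)" "FO (lax_comma_forget A) (J a) = a" if "a \<in> Obj (underlying A)" for a
      using J[of a] DJ[of a] that by (simp_all add: lax_comma_forget_def)
    show "\<exists>!P. P \<in> hom (lax_comma A X) (J a) f \<and> FA (lax_comma_forget A) P = p"
      if f: "f \<in> Obj (lax_comma A X)" and p: "p \<in> hom (underlying A) a (FO (lax_comma_forget A) f)" for f p a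
    proof -
      have a: "a \<in> Obj A" using U.Obj_of_hom(1)[OF p] by simp
      have f': "f \<in> hom (underlying A) (Dom A f) X" using f by simp
      have p': "p \<in> hom (underlying A) a (Dom A f)" using p by (simp add: lax_comma_forget_def)
      have "Comp A f p \<in> hom (underlying A) a X" using U.Comp_hom[OF p' f'] by simp
      then have "\<exists>!\<pi>. \<pi> \<in> hom (hom_category A a X) (J a) (Comp A f p)"
        using init[OF a] by (simp add: initial_def)
      then obtain \<pi> where \<pi>: "\<pi> \<in> hom (hom_category A a X) (J a) (Comp A f p)"
        and uniq: "\<And>\<pi>'. \<pi>' \<in> hom (hom_category A a X) (J a) (Comp A f p) \<Longrightarrow> \<pi>' = \<pi>" by blast
      show ?thesis
      proof (rule ex1I)
        show "(J a, (p, \<pi>), f) \<in> hom (lax_comma A X) (J a) f \<and> FA (lax_comma_forget A) (J a, (p, \<pi>), f) = p"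
          using J[OF a] DJ[OF a] f' p' \<pi> by (simp add: hom_lax_comma lax_comma_forget_def)
        show "P = (J a, (p, \<pi>), f)"
          if P: "P \<in> hom (lax_comma A X) (J a) f \<and> FA (lax_comma_forget A) P = p" for P
        proof -
          obtain q \<chi> where "P = (J a, (q, \<chi>), f)" "\<chi> \<in> hom (hom_category A (Dom A (J a)) X) (J a) (Comp A f q)"
            using P by (auto elim: hom_lax_commaE)
          then show ?thesis using P uniq DJ[OF a] by (simp add: lax_comma_forget_def)
        qed
      qed
    qed
    show "\<exists>a' \<in> Obj (underlying A). isomorphic (lax_comma A X) (J a') w"
      if "a \<in> Obj (underlying A)" and t: "t \<in> hom (lax_comma A X) w (J a)" for a t w
    proof -
      have a: "a \<in> Obj A" using that(1) by simp
      obtain p \<pi> where w: "w \<in> hom (underlying A) (Dom A w) X"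
        and p: "p \<in> hom (underlying A) (Dom A w) (Dom A (J a))"
        and \<pi>: "\<pi> \<in> hom (hom_category A (Dom A w) X) w (Comp A (J a) p)"
        using t by (rule hom_lax_commaE)
      let ?b = "Dom A w"
      have b: "?b \<in> Obj A" using U.Obj_of_hom(1)[OF w] by simp
      interpret H: category "hom_category A ?b X" using category_hom'[OF w] .
      have "initial (hom_category A ?b X) (Comp A (J a) p)"
        using assms(4)[of p ?b a] p DJ[OF a] init[OF a]
        by (simp add: preserves_initial_objects_def precomposition_def)
      then obtain \<sigma> where "\<sigma> \<in> hom (hom_category A ?b X) (Comp A (J a) p) (J ?b)"
        using H.initial_isomorphic[OF _ init[OF b]] unfolding isomorphic_def by blast
      then have "hom (hom_category A ?b X) w (J ?b) \<noteq> {}" using VComp_hom[OF \<pi>] by blast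
      then have "isomorphic (hom_category A ?b X) w (J ?b)"
        using strict[OF b] w by (simp add: strict_initial_def)
      then have "isomorphic (lax_comma A X) (J ?b) w"
        using lax_comma_vertical_iso[OF J[OF b] w] H.isomorphic_sym by blast
      then show ?thesis using b by auto
    qed
  qed
  then show ?thesis by (rule sieve_coreflection.preserves_effective_descent)
qed

end
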